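(* Let $m\ge1$, $e_1,\dots,e_m\in\mathbb R$ and $\beta\ge0$. Let $\mathcal P_t=e^{t\mathcal L_\beta}$ be the Fermi Ornstein-Uhlenbeck semigroup on the Clifford algebra $\mathcal A$ with $2m$ generators, whose generator is $$\mathcal L_\beta A=\frac14\sum_{j=1}^m\Big[e^{\beta e_j/2}\big(V_j^*[A,V_j]+[V_j^*,A]V_j\big)+e^{-\beta e_j/2}\big(V_j[A,V_j^*]+[V_j,A]V_j^*\big)\Big],$$ and let $\sigma_\beta$ be its invariant state. Put $\lambda_\beta=\min\{\cosh(\beta e_j/2): j=1,\dots,m\}$. Then for all $\rho\in\mathfrak S_+(\mathcal A)$ and all $t\ge0$, $$D(\mathcal P_t^\dagger\rho\,\|\,\sigma_\beta)\le e^{-2\lambda_\beta t}D(\rho\,\|\,\sigma_\beta).$$ Moreover, the relative entropy functional $\rho\mapsto D(\rho\|\sigma_\beta)$ is geodesically $\lambda_\beta$-convex on $\mathfrak S_+(\mathcal A)$ for the Riemannian metric $g_{\mathcal L_\beta}$ associated to $\mathcal L_\beta$.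
   Context: Clifford algebra: $Q_1,\dots,Q_m,P_1,\dots,P_m$ are self-adjoint operators on $\mathbb C^{2^m}$ with $Q_jQ_k+Q_kQ_j=P_jP_k+P_kP_j=2\delta_{jk}\mathbf 1$ and $Q_jP_k+P_kQ_j=0$; $\mathcal A$ is the algebra they generate (which is all of $\mathcal M_{2^m}(\mathbb C)$). $Z_j=\frac1{\sqrt2}(Q_j+iP_j)$, $N_j=\frac12Z_j^*Z_j$ (commuting orthogonal projections), $h=\sum_{j=1}^me_jN_j$, $\sigma_\beta=e^{-\beta h}/\operatorname{Tr}[e^{-\beta h}]$, $W=i^m\prod_{j=1}^mQ_jP_j$ (self-adjoint and unitary), $V_j=WZ_j$. With $\Delta_{\sigma_\beta}(A)=\sigma_\beta A\sigma_\beta^{-1}$ one has $\Delta_{\sigma_\beta}(V_j)=e^{\beta e_j}V_j$, $\Delta_{\sigma_\beta}(V_j^* )=e^{-\beta e_j}V_j^*$. $\mathfrak S_+(\mathcal A)$ is the set of positive definite $\rho\in\mathcal A$ with $\operatorname{Tr}\rho=1$; its tangent space at each point is the space of traceless self-adjoint elements of $\mathcal A$. $D(\rho\|\sigma)=\operatorname{Tr}[\rho(\log\rho-\log\sigma)]$. $\dagger$ denotes the adjoint with respect to $\operatorname{Tr}[A^*B]$. $\mathcal P_t$ consists of unital completely positive maps, is ergodic (the eigenspace of $\mathcal P_t$, $t>0$, for eigenvalue $1$ is spanned by $\mathbf 1$), is self-adjoint for the inner product $\operatorname{Tr}[\sigma_\beta A^*B]$, and has $\sigma_\beta$ as unique invariant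 state. Riemannian metric $g_{\mathcal L_\beta}$: let $(X_k)_{k\in\mathcal J}$ denote the family of the $2m$ operators $\frac12V_1,\dots,\frac12V_m,\frac12V_1^*,\dots,\frac12V_m^*$, with corresponding numbers $\omega_k$ defined by $\Delta_{\sigma_\beta}(X_k)=e^{-\omega_k}X_k$ (so $\omega=-\beta e_j$ for $\frac12V_j$ and $\omega=\beta e_j$ for $\frac12V_j^*$); then $\mathcal L_\beta A=\sum_ke^{-\omega_k/2}(X_k^*[A,X_k]+[X_k^*,A]X_k)$. Set $\partial_kA=[X_k,A]$, $\nabla A=(\partial_kA)_k$, $\operatorname{div}(A_k)_k=\sum_k[A_k,X_k^*]$, $[\rho]_\omega A=\int_0^1e^{\omega(s-1/2)}\rho^sA\rho^{1-s}\,ds$. For $\rho\in\mathfrak S_+(\mathcal A)$ and a traceless self-adjoint $T\in\mathcal A$ there is a unique traceless self-adjoint $U_T\in\mathcal A$ with $T=-\operatorname{div}\big(([\rho]_{\omega_k}\partial_kU_T)_k\big)$, and $g_{\mathcal L_\beta,\rho}(S,T)=\sum_k\operatorname{Tr}\big[(\partial_kU_S)^*[\rho]_{\omega_k}(\partial_kU_T)\big]$. A function $F$ on a Riemannian manifold $(\mathcal M,g)$ is geodesically $\lambda$-convex if for every distance-minimizing geodesic $\gamma:[0,1]\to\mathcal M$ and all $s\in(0,1)$, $\frac{d^2}{ds^2}F(\gamma(s))\ge\lambda\,g(\dot\gamma(s),\dot\gamma(s))$. *)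

theory Defs
  imports "HOL-Analysis.Analysis"
begin

section \<open>Complex matrices\<close>

text \<open>
  Operators on a Hilbert space of dimension \<open>CARD('n)\<close> are square complex matrices. The class
  multiplication on \<open>complex^'n^'n\<close> is entrywise, so \<open>**\<close>, \<open>mat 1\<close> and explicit powers are used.
\<close>

type_synonym 'n op = "complex^'n^'n"

definition adj :: "'n::finite op \<Rightarrow> 'n op" where
  "adj A = map_matrix cnj (transpose A)"

definition cscale :: "complex \<Rightarrow> 'n::finite op \<Rightarrow> 'n op" (infixr "*\<^sub>C" 75) where
  "c *\<^sub>C A = map_matrix ((*) c) A"

definition comm :: "'n::finite op \<Rightarrow> 'n op \<Rightarrow> 'n op" where
  "comm A B = A ** B - B ** A"

definition selfadjoint :: "'n::finite op \<Rightarrow> bool" where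
  "selfadjoint A \<longleftrightarrow> adj A = A"

definition posdef :: "'n::finite op \<Rightarrow> bool" where
  "posdef A \<longleftrightarrow> selfadjoint A \<and>
     (\<forall>x. x \<noteq> 0 \<longrightarrow> Re (\<Sum>i\<in>UNIV. cnj (x $ i) * (A *v x) $ i) > 0)"

text \<open>
  Functional calculus of a self-adjoint operator: \<open>f(A)\<close> acts as \<open>f(x)\<close> on the eigenspace of \<open>A\<close>
  for the (real) eigenvalue \<open>x\<close>. This determines \<open>f(A)\<close> because the eigenspaces span.
\<close>

definition mfun :: "(real \<Rightarrow> real) \<Rightarrow> 'n::finite op \<Rightarrow> 'n op" where
  "mfun f A = (THE B. \<forall>(x::real) v. A *v v = complex_of_real x *s v \<longrightarrow>
                                  B *v v = complex_of_real (f x) *s v)"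

definition complex_subalgebra :: "'n::finite op set \<Rightarrow> bool" where
  "complex_subalgebra S \<longleftrightarrow> mat 1 \<in> S \<and>
     (\<forall>A\<in>S. \<forall>B\<in>S. A + B \<in> S \<and> A ** B \<in> S) \<and> (\<forall>c. \<forall>A\<in>S. c *\<^sub>C A \<in> S)"

definition states :: "'n::finite op set \<Rightarrow> 'n op set" where
  "states \<A> = {\<rho>\<in>\<A>. posdef \<rho> \<and> trace \<rho> = 1}"

definition traceless_sa :: "'n::finite op set \<Rightarrow> 'n op set" where
  "traceless_sa \<A> = {T\<in>\<A>. selfadjoint T \<and> trace T = 0}"

text \<open>The trace below is real for positive definite arguments.\<close>

definition rel_entropy :: "'n::finite op \<Rightarrow> 'n op \<Rightarrow> real" where
  "rel_entropy \<rho> \<sigma> = Re (trace (\<rho> ** (mfun ln \<rho> - mfun ln \<sigma>)))"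

definition modular :: "'n::finite op \<Rightarrow> 'n op \<Rightarrow> 'n op" where
  "modular \<sigma> A = \<sigma> ** A ** matrix_inv \<sigma>"

definition exp_semigroup :: "('n::finite op \<Rightarrow> 'n op) \<Rightarrow> real \<Rightarrow> 'n op \<Rightarrow> 'n op" where
  "exp_semigroup L t A = (\<Sum>k. (t ^ k / fact k) *\<^sub>R (L ^^ k) A)"

text \<open>The adjoint of \<open>K\<close>, as an operator on \<open>\<A>\<close>, for the inner product \<open>Tr[A\<^sup>* B]\<close>.\<close>

definition hs_adjoint :: "'n::finite op set \<Rightarrow> ('n op \<Rightarrow> 'n op) \<Rightarrow> 'n op \<Rightarrow> 'n op" where
  "hs_adjoint \<A> K A = (THE C. C \<in> \<A> \<and> (\<forall>B\<in>\<A>. trace (adj B ** C) = trace (adj (K B) ** A)))"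


section \<open>The Clifford algebra and the Fermi Ornstein-Uhlenbeck generator\<close>

definition clifford_generators ::
    "nat \<Rightarrow> (nat \<Rightarrow> 'n::finite op) \<Rightarrow> (nat \<Rightarrow> 'n op) \<Rightarrow> bool" where
  "clifford_generators m Q P \<longleftrightarrow>
     (\<forall>j\<in>{1..m}. selfadjoint (Q j) \<and> selfadjoint (P j)) \<and>
     (\<forall>j\<in>{1..m}. \<forall>k\<in>{1..m}.
        Q j ** Q k + Q k ** Q j = mat (if j = k then 2 else 0) \<and>
        P j ** P k + P k ** P j = mat (if j = k then 2 else 0) \<and>
        Q j ** P k + P k ** Q j = 0)"

definition clifford_algebra ::
    "nat \<Rightarrow> (nat \<Rightarrow> 'n::finite op) \<Rightarrow> (nat \<Rightarrow> 'n op) \<Rightarrow> 'n op set" where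
  "clifford_algebra m Q P = complex_subalgebra hull (Q ` {1..m} \<union> P ` {1..m})"

definition fermi_Z :: "(nat \<Rightarrow> 'n::finite op) \<Rightarrow> (nat \<Rightarrow> 'n op) \<Rightarrow> nat \<Rightarrow> 'n op" where
  "fermi_Z Q P j = (1 / sqrt 2) *\<^sub>R (Q j + \<i> *\<^sub>C P j)"

definition fermi_N :: "(nat \<Rightarrow> 'n::finite op) \<Rightarrow> (nat \<Rightarrow> 'n op) \<Rightarrow> nat \<Rightarrow> 'n op" where
  "fermi_N Q P j = (1 / 2) *\<^sub>R (adj (fermi_Z Q P j) ** fermi_Z Q P j)"

definition fermi_h ::
    "nat \<Rightarrow> (nat \<Rightarrow> real) \<Rightarrow> (nat \<Rightarrow> 'n::finite op) \<Rightarrow> (nat \<Rightarrow> 'n op) \<Rightarrow> 'n op" where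
  "fermi_h m e Q P = (\<Sum>j\<in>{1..m}. e j *\<^sub>R fermi_N Q P j)"

definition fermi_sigma ::
    "nat \<Rightarrow> real \<Rightarrow> (nat \<Rightarrow> real) \<Rightarrow> (nat \<Rightarrow> 'n::finite op) \<Rightarrow> (nat \<Rightarrow> 'n op) \<Rightarrow> 'n op" where
  "fermi_sigma m \<beta> e Q P =
     (let G = mfun exp ((- \<beta>) *\<^sub>R fermi_h m e Q P) in inverse (trace G) *\<^sub>C G)"

definition fermi_W :: "nat \<Rightarrow> (nat \<Rightarrow> 'n::finite op) \<Rightarrow> (nat \<Rightarrow> 'n op) \<Rightarrow> 'n op" where
  "fermi_W m Q P = \<i> ^ m *\<^sub>C foldr (\<lambda>j M. Q j ** P j ** M) [1..<Suc m] (mat 1)"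

definition fermi_V ::
    "nat \<Rightarrow> (nat \<Rightarrow> 'n::finite op) \<Rightarrow> (nat \<Rightarrow> 'n op) \<Rightarrow> nat \<Rightarrow> 'n op" where
  "fermi_V m Q P j = fermi_W m Q P ** fermi_Z Q P j"

definition fermi_generator ::
    "nat \<Rightarrow> real \<Rightarrow> (nat \<Rightarrow> real) \<Rightarrow> (nat \<Rightarrow> 'n::finite op) \<Rightarrow> (nat \<Rightarrow> 'n op) \<Rightarrow> 'n op \<Rightarrow> 'n op" where
  "fermi_generator m \<beta> e Q P A = (1 / 4) *\<^sub>R (\<Sum>j\<in>{1..m}. let V = fermi_V m Q P j in
       exp (\<beta> * e j / 2) *\<^sub>R (adj V ** comm A V + comm (adj V) A ** V)
     + exp (- \<beta> * e j / 2) *\<^sub>R (V ** comm A (adj V) + comm V A ** adj V))"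


section \<open>The Riemannian metric associated to a family of jump operators\<close>

text \<open>
  Throughout, \<open>J\<close> is a finite index set, \<open>X\<close> the family of jump operators and \<open>\<omega>\<close> their Bohr
  frequencies. An element of the range of the gradient is a family of operators indexed by \<open>J\<close>.
\<close>

definition bohr_freq :: "'n::finite op \<Rightarrow> 'n op \<Rightarrow> real" where
  "bohr_freq \<sigma> A = (THE w. modular \<sigma> A = exp (- w) *\<^sub>R A)"

definition twisted_mult :: "'n::finite op \<Rightarrow> real \<Rightarrow> 'n op \<Rightarrow> 'n op" where
  "twisted_mult \<rho> w A = integral {0..1}
     (\<lambda>s. exp (w * (s - 1 / 2)) *\<^sub>R
          (mfun (\<lambda>x. x powr s) \<rho> ** A ** mfun (\<lambda>x. x powr (1 - s)) \<rho>))"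

definition nc_grad :: "('k \<Rightarrow> 'n::finite op) \<Rightarrow> 'n op \<Rightarrow> 'k \<Rightarrow> 'n op" where
  "nc_grad X A k = comm (X k) A"

definition nc_div :: "'k set \<Rightarrow> ('k \<Rightarrow> 'n::finite op) \<Rightarrow> ('k \<Rightarrow> 'n op) \<Rightarrow> 'n op" where
  "nc_div J X B = (\<Sum>k\<in>J. comm (B k) (adj (X k)))"

definition potential ::
    "'n::finite op set \<Rightarrow> 'k set \<Rightarrow> ('k \<Rightarrow> 'n op) \<Rightarrow> ('k \<Rightarrow> real) \<Rightarrow> 'n op \<Rightarrow> 'n op \<Rightarrow> 'n op" where
  "potential \<A> J X \<omega> \<rho> T = (THE U. U \<in> traceless_sa \<A> \<and>
     T = - nc_div J X (\<lambda>k. twisted_mult \<rho> (\<omega> k) (nc_grad X U k)))"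

text \<open>
  The sum below is real for the families considered here: by the definition of the potential it
  equals \<open>Tr[U\<^sub>S T]\<close> with both factors self-adjoint.
\<close>

definition qms_metric ::
    "'n::finite op set \<Rightarrow> 'k set \<Rightarrow> ('k \<Rightarrow> 'n op) \<Rightarrow> ('k \<Rightarrow> real) \<Rightarrow>
     'n op \<Rightarrow> 'n op \<Rightarrow> 'n op \<Rightarrow> real" where
  "qms_metric \<A> J X \<omega> \<rho> S T = Re (\<Sum>k\<in>J.
     trace (adj (nc_grad X (potential \<A> J X \<omega> \<rho> S) k) **
            twisted_mult \<rho> (\<omega> k) (nc_grad X (potential \<A> J X \<omega> \<rho> T) k)))"

text \<open>The index \<open>(j, False)\<close> stands for \<open>V\<^sub>j / 2\<close> and \<open>(j, True)\<close> for \<open>V\<^sub>j\<^sup>* / 2\<close>.\<close>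

definition fermi_index :: "nat \<Rightarrow> (nat \<times> bool) set" where
  "fermi_index m = {1..m} \<times> UNIV"

definition fermi_jump ::
    "nat \<Rightarrow> (nat \<Rightarrow> 'n::finite op) \<Rightarrow> (nat \<Rightarrow> 'n op) \<Rightarrow> nat \<times> bool \<Rightarrow> 'n op" where
  "fermi_jump m Q P = (\<lambda>(j, b). (1 / 2) *\<^sub>R (if b then adj (fermi_V m Q P j) else fermi_V m Q P j))"

definition fermi_metric ::
    "nat \<Rightarrow> real \<Rightarrow> (nat \<Rightarrow> real) \<Rightarrow> (nat \<Rightarrow> 'n::finite op) \<Rightarrow> (nat \<Rightarrow> 'n op) \<Rightarrow>
     'n op \<Rightarrow> 'n op \<Rightarrow> 'n op \<Rightarrow> real" where
  "fermi_metric m \<beta> e Q P =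
     qms_metric (clifford_algebra m Q P) (fermi_index m) (fermi_jump m Q P)
       (\<lambda>k. bohr_freq (fermi_sigma m \<beta> e Q P) (fermi_jump m Q P k))"


section \<open>Geodesic convexity\<close>

text \<open>
  \<open>M\<close> is a relatively open subset of an affine subspace of a normed space \<open>'a\<close>, so curves in \<open>M\<close>
  and their velocities are read in \<open>'a\<close>; \<open>g x u v\<close> is the metric at \<open>x \<in> M\<close>. Derivatives are
  one-sided at the end points of \<open>[0,1]\<close>. Admissible curves for the distance are \<open>C\<^sup>1\<close> up to the
  end points (with speed possibly vanishing, so that reparametrised piecewise \<open>C\<^sup>1\<close> curves are
  included); in particular the speed is continuous and the length integral exists.
\<close>

definition velocity :: "(real \<Rightarrow> 'a::real_normed_vector) \<Rightarrow> real \<Rightarrow> 'a" where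
  "velocity \<gamma> s = vector_derivative \<gamma> (at s within {0..1})"

definition C1_curve :: "(real \<Rightarrow> 'a::real_normed_vector) \<Rightarrow> bool" where
  "C1_curve \<gamma> \<longleftrightarrow> (\<exists>D. (\<forall>s\<in>{0..1}. (\<gamma> has_vector_derivative D s) (at s within {0..1})) \<and>
                     continuous_on {0..1} D)"

definition smooth_curve :: "(real \<Rightarrow> 'a::real_normed_vector) \<Rightarrow> bool" where
  "smooth_curve \<gamma> \<longleftrightarrow> (\<exists>D. D 0 = \<gamma> \<and>
     (\<forall>n::nat. \<forall>s\<in>{0..1}. (D n has_vector_derivative D (Suc n) s) (at s within {0..1})))"

definition riem_length ::
    "('a::real_normed_vector \<Rightarrow> 'a \<Rightarrow> 'a \<Rightarrow> real) \<Rightarrow> (real \<Rightarrow> 'a) \<Rightarrow> real" where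
  "riem_length g \<gamma> = integral {0..1} (\<lambda>s. sqrt (g (\<gamma> s) (velocity \<gamma> s) (velocity \<gamma> s)))"

definition riem_dist ::
    "'a::real_normed_vector set \<Rightarrow> ('a \<Rightarrow> 'a \<Rightarrow> 'a \<Rightarrow> real) \<Rightarrow> 'a \<Rightarrow> 'a \<Rightarrow> real" where
  "riem_dist M g x y =
     Inf {riem_length g \<gamma> |\<gamma>. C1_curve \<gamma> \<and> \<gamma> ` {0..1} \<subseteq> M \<and> \<gamma> 0 = x \<and> \<gamma> 1 = y}"

text \<open>Geodesics are parametrised with constant speed.\<close>

definition minimizing_geodesic ::
    "'a::real_normed_vector set \<Rightarrow> ('a \<Rightarrow> 'a \<Rightarrow> 'a \<Rightarrow> real) \<Rightarrow> (real \<Rightarrow> 'a) \<Rightarrow> bool" where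
  "minimizing_geodesic M g \<gamma> \<longleftrightarrow> smooth_curve \<gamma> \<and> \<gamma> ` {0..1} \<subseteq> M \<and>
     (\<exists>c. \<forall>s\<in>{0..1}. sqrt (g (\<gamma> s) (velocity \<gamma> s) (velocity \<gamma> s)) = c) \<and>
     riem_length g \<gamma> = riem_dist M g (\<gamma> 0) (\<gamma> 1)"

definition geodesically_convex ::
    "'a::real_normed_vector set \<Rightarrow> ('a \<Rightarrow> 'a \<Rightarrow> 'a \<Rightarrow> real) \<Rightarrow> ('a \<Rightarrow> real) \<Rightarrow> real \<Rightarrow> bool" where
  "geodesically_convex M g F lam \<longleftrightarrow> (\<forall>\<gamma>. minimizing_geodesic M g \<gamma> \<longrightarrow>
     (\<exists>F1 F2. \<forall>s\<in>{0<..<1}.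
        ((\<lambda>r. F (\<gamma> r)) has_real_derivative F1 s) (at s) \<and>
        (F1 has_real_derivative F2 s) (at s) \<and>
        F2 s \<ge> lam * g (\<gamma> s) (velocity \<gamma> s) (velocity \<gamma> s)))"

end

theory Submission
  imports Defs
begin

text \<open>
  The operators \<open>V\<^sub>j\<close> satisfy the canonical anticommutation relations, and these give
  \<open>[V\<^sub>k, L A] = (L' - cosh (\<beta> e\<^sub>k / 2)) [V\<^sub>k, A]\<close>, where \<open>L'\<close> is \<open>L\<close> with the sign of its jump term
  reversed. A Schwarz inequality for \<open>exp (t L')\<close> against \<open>P\<^sub>t\<close> controls the Hilbert-Schmidt norms
  weighted by \<open>\<rho>\<close> on the left and on the right, and interpolating between these two (which replaces
  Lieb's concavity theorem) shows that \<open>P\<^sub>t\<^sup>\<dagger>\<close> contracts the metric: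
  \<open>g(P\<^sub>t\<^sup>\<dagger> T, P\<^sub>t\<^sup>\<dagger> T) \<le> exp (-2 \<lambda> t) g(T, T)\<close>.

  Since \<open>L\<^sup>\<dagger> \<rho>\<close> is minus the gradient of the relative entropy \<open>F\<close>, the case \<open>T = L\<^sup>\<dagger> \<rho>\<close> is the exponential
  decay of the entropy production, and integrating it up to infinity gives the decay of \<open>F\<close>.

  Convexity needs no geodesic equation. A minimizing geodesic \<open>\<gamma>\<close> is at most as long as the curves
  \<open>s \<mapsto> P\<^sub>\<tau>\<^sup>\<dagger> \<gamma>(s)\<close>, \<open>\<tau> = \<epsilon> \<phi>(s)\<close>, with the same end points. The gradient flow identity and the
  contraction bound the first variation, and letting \<open>\<epsilon>\<close> tend to 0 yields
  \<open>\<integral> \<phi>' (F \<circ> \<gamma>)' \<le> - \<lambda> \<integral> \<phi> g(\<gamma>', \<gamma>')\<close> for all test functions \<open>\<phi> \<ge> 0\<close>.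
\<close>

text \<open>A commutator with one jump operator passes unchanged through products of two other jump
  operators, but changes sign at the single factor on either side of the argument in the sandwiched
  term; hence the reversed sign. Only the mode \<open>k\<close> itself leaves a defect,
  \<open>1/4\<close> times \<open>2 * (p + q)\<close> with \<open>p\<close>, \<open>q\<close> the
  two weights \<open>exp (\<beta> e / 2)\<close> and \<open>exp (- \<beta> e / 2)\<close>, and this
  is the cosh. The reversed generator need not preserve positivity, yet its Schwarz defect is still
  a sum of squares, of anticommutators in place of commutators. That inequality reaches only the end
  points \<open>s = 0\<close> and \<open>s = 1\<close> of the integral defining the twisted
  multiplication. A power in between is a positive superposition of K-functionals, and such an
  infimum over splittings inherits every bound valid at both ends. All this is done for potentials
  in the Heisenberg picture; the metric is the inverse quadratic form, so its contraction follows by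
  duality. In the first variation the squared speed of the deformed curve only has to be bounded:
  the term quadratic in \<open>\<phi>'\<close> comes with a favourable sign.\<close>

lemmas scaleR_complex = scaleR_conv_of_real[where 'a = complex]

section \<open>Operators\<close>

lemma mm_zero_left [simp]: "(0::'n::finite op) ** A = 0"
  and mm_zero_right [simp]: "A ** (0::'n::finite op) = 0"
  by (simp_all add: matrix_matrix_mult_def vec_eq_iff)

lemma mm_add_left: "((A::'n::finite op) + B) ** C = A ** C + B ** C"
  by (simp add: matrix_matrix_mult_def vec_eq_iff algebra_simps sum.distrib)

lemma mm_add_right: "(A::'n::finite op) ** (B + C) = A ** B + A ** C"
  by (simp add: matrix_matrix_mult_def vec_eq_iff algebra_simps sum.distrib)

lemma mm_minus_left: "(- (A::'n::finite op)) ** B = - (A ** B)"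
  and mm_minus_right: "(A::'n::finite op) ** (- B) = - (A ** B)"
  by (simp_all add: matrix_matrix_mult_def vec_eq_iff sum_negf)

lemma mm_diff_left: "((A::'n::finite op) - B) ** C = A ** C - B ** C"
  and mm_diff_right: "(A::'n::finite op) ** (B - C) = A ** B - A ** C"
  by (simp_all add: matrix_matrix_mult_def vec_eq_iff algebra_simps sum_subtractf)

lemma mm_scaleR_left: "(c *\<^sub>R (A::'n::finite op)) ** B = c *\<^sub>R (A ** B)"
  and mm_scaleR_right: "(A::'n::finite op) ** (c *\<^sub>R B) = c *\<^sub>R (A ** B)"
  by (simp_all add: matrix_matrix_mult_def vec_eq_iff scaleR_sum_right)

lemma mm_cscale_left: "(c *\<^sub>C (A::'n::finite op)) ** B = c *\<^sub>C (A ** B)"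
  and mm_cscale_right: "(A::'n::finite op) ** (c *\<^sub>C B) = c *\<^sub>C (A ** B)"
  by (simp_all add: cscale_def matrix_matrix_mult_def vec_eq_iff sum_distrib_left algebra_simps)

lemmas mm_distribs = mm_add_left mm_add_right mm_minus_left mm_minus_right mm_diff_left
  mm_diff_right mm_scaleR_left mm_scaleR_right

lemma mm_sum_left: "sum (f :: _ \<Rightarrow> 'n::finite op) S ** (B::'n::finite op) = (\<Sum>k\<in>S. f k ** B)"
  by (induction S rule: infinite_finite_induct) (simp_all add: mm_add_left)

lemma mm_sum_right: "(B::'n::finite op) ** sum (f :: _ \<Rightarrow> 'n op) S = (\<Sum>k\<in>S. B ** f k)"
  by (induction S rule: infinite_finite_induct) (simp_all add: mm_add_right)

lemma bounded_bilinear_mm: "bounded_bilinear ((**) :: 'n::finite op \<Rightarrow> _)"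
  unfolding bilinear_conv_bounded_bilinear[symmetric]
  by (simp add: bilinear_def linear_iff mm_distribs)

lemmas has_vector_derivative_mm =
  bounded_bilinear.has_vector_derivative[OF bounded_bilinear_mm]

lemma linear_mm_left: "linear (\<lambda>A::'n::finite op. B ** A)"
  and linear_mm_right: "linear (\<lambda>A::'n::finite op. A ** B)"
  by (simp_all add: linear_iff mm_distribs)

lemma cscale_add_right: "c *\<^sub>C (A + B) = c *\<^sub>C A + c *\<^sub>C B"
  and cscale_diff_right: "c *\<^sub>C (A - B) = c *\<^sub>C A - c *\<^sub>C B"
  and cscale_minus_right: "c *\<^sub>C (- A) = - (c *\<^sub>C A)"
  and cscale_scaleR: "c *\<^sub>C (r *\<^sub>R A) = r *\<^sub>R (c *\<^sub>C A)"
  and cscale_cscale: "c *\<^sub>C d *\<^sub>C A = (c * d) *\<^sub>C A"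
  and cscale_of_real: "complex_of_real r *\<^sub>C A = r *\<^sub>R A"
  and cscale_one [simp]: "1 *\<^sub>C A = A"
  and cscale_zero_right [simp]: "c *\<^sub>C 0 = 0"
  by (simp_all add: cscale_def vec_eq_iff algebra_simps scaleR_complex)

lemma linear_cscale: "linear (\<lambda>A. c *\<^sub>C A)"
  by (simp add: linear_iff cscale_add_right cscale_scaleR)

lemma cscale_sum_right: "c *\<^sub>C sum f S = (\<Sum>k\<in>S. c *\<^sub>C f k)"
  by (induction S rule: infinite_finite_induct) (simp_all add: cscale_add_right)

lemma adj_nth: "adj A $ i $ j = cnj (A $ j $ i)"
  by (simp add: adj_def transpose_def)

lemma adj_add: "adj (A + B) = adj A + adj B"
  and adj_diff: "adj (A - B) = adj A - adj B"
  and adj_minus: "adj (- A) = - adj A"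
  and adj_scaleR: "adj (r *\<^sub>R A) = r *\<^sub>R adj A"
  and adj_cscale: "adj (c *\<^sub>C A) = cnj c *\<^sub>C adj A"
  and adj_zero [simp]: "adj 0 = 0"
  and adj_one [simp]: "adj (mat 1) = mat 1"
  and adj_adj [simp]: "adj (adj A) = A"
  by (auto simp: vec_eq_iff adj_nth cscale_def mat_def)

lemma adj_mm: "adj (A ** B) = adj B ** adj A"
  by (simp add: vec_eq_iff adj_nth matrix_matrix_mult_def mult.commute)

lemma adj_sum: "adj (sum f S) = (\<Sum>k\<in>S. adj (f k))"
  by (induction S rule: infinite_finite_induct) (simp_all add: adj_add)

lemma linear_adj: "linear adj"
  by (simp add: linear_iff adj_add adj_scaleR)

lemmas adj_simps = adj_add adj_diff adj_minus adj_scaleR adj_mm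

lemma trace_scaleR: "trace (r *\<^sub>R (A::'n::finite op)) = complex_of_real r * trace A"
  by (simp add: trace_def sum_distrib_left scaleR_complex)

lemma trace_cscale: "trace (c *\<^sub>C (A::'n::finite op)) = c * trace A"
  by (simp add: trace_def cscale_def sum_distrib_left)

lemma trace_adj: "trace (adj A) = cnj (trace A)"
  by (simp add: trace_def adj_nth)

lemma linear_trace: "linear (trace :: 'n::finite op \<Rightarrow> complex)"
  by (simp add: linear_iff trace_add trace_scaleR scaleR_complex)

text \<open>The Euclidean inner product of matrices is the real part of the Hilbert-Schmidt product.
  Adjoints below are taken for this real product; the imaginary part is recovered by pairing with
  \<open>\<i> *\<^sub>C A\<close>.\<close>

lemma inner_op: "A \<bullet> B = Re (trace (adj A ** B))"
proof -
  have "A \<bullet> B = (\<Sum>i\<in>UNIV. \<Sum>j\<in>UNIV. Re (cnj (A $ i $ j) * B $ i $ j))"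
    by (simp add: inner_vec_def inner_complex_def)
  also have "\<dots> = (\<Sum>j\<in>UNIV. \<Sum>i\<in>UNIV. Re (cnj (A $ i $ j) * B $ i $ j))"
    by (rule sum.swap)
  finally show ?thesis
    by (simp add: trace_def matrix_matrix_mult_def adj_nth)
qed

lemma inner_mm_left: "((A::'n::finite op) ** B) \<bullet> (C::'n op) = B \<bullet> (adj A ** C)"
  by (simp add: inner_op adj_mm matrix_mul_assoc)

lemma inner_mm_right: "((A::'n::finite op) ** B) \<bullet> (C::'n op) = A \<bullet> (C ** adj B)"
  by (simp add: inner_op adj_mm) (metis matrix_mul_assoc trace_mul_sym)

lemma inner_adj_adj: "adj A \<bullet> adj B = A \<bullet> B"
  by (simp add: inner_op)
    (metis adj_adj adj_mm complex_cnj_cnj inner_commute inner_op trace_adj trace_mul_sym cnj.simps(1))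

lemma inner_cscale_i_left: "(\<i> *\<^sub>C A) \<bullet> B = Im (trace (adj A ** B))"
  by (simp add: inner_op adj_cscale mm_cscale_left trace_cscale)

lemma trace_mm_eq_inner: "trace (adj A ** B) = Complex (A \<bullet> B) ((\<i> *\<^sub>C A) \<bullet> B)"
  by (simp add: complex_eq_iff inner_op[symmetric] inner_cscale_i_left)

lemma cinner_Re: "x \<bullet> y = Re (\<Sum>i\<in>UNIV. cnj (x $ i) * (y::complex^'n::finite) $ i)"
  by (simp add: inner_vec_def inner_complex_def)

lemma inner_mv: "x \<bullet> (A *v y) = (adj A *v x) \<bullet> (y::complex^'n::finite)"
proof -
  have "(\<Sum>i\<in>UNIV. \<Sum>j\<in>UNIV. cnj (x $ i) * (A $ i $ j * y $ j)) =
        (\<Sum>j\<in>UNIV. \<Sum>i\<in>UNIV. cnj (x $ i) * (A $ i $ j * y $ j))"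
    by (rule sum.swap)
  then show ?thesis
    by (simp add: cinner_Re matrix_vector_mult_def sum_distrib_left sum_distrib_right adj_nth mult_ac del: Re_sum)
qed

lemma posdef_inner: "posdef A \<longleftrightarrow> adj A = A \<and> (\<forall>x. x \<noteq> 0 \<longrightarrow> 0 < x \<bullet> (A *v x))"
  by (simp add: posdef_def selfadjoint_def cinner_Re del: Re_sum)

lemma mv_scaleR: "(A::'n::finite op) *v (c *\<^sub>R x) = c *\<^sub>R (A *v x)"
  by (rule linear_cmul[OF matrix_vector_mul_linear])

section \<open>Spectral decomposition\<close>

definition dg :: "('n \<Rightarrow> real) \<Rightarrow> 'n::finite op" where
  "dg d = (\<chi> i j. if i = j then complex_of_real (d i) else 0)"

definition unitary_op :: "'n::finite op \<Rightarrow> bool" where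
  "unitary_op U \<longleftrightarrow> adj U ** U = mat 1 \<and> U ** adj U = mat 1"

lemma mm_dg_right: "(A ** dg d) $ i $ j = A $ i $ j * complex_of_real (d j)"
  by (simp add: matrix_matrix_mult_def dg_def if_distrib [of "\<lambda>x. _ * x"] cong: if_cong)

lemma mm_dg_left: "(dg d ** A) $ i $ j = complex_of_real (d i) * A $ i $ j"
  by (simp add: matrix_matrix_mult_def dg_def if_distrib [of "\<lambda>x. x * _"] cong: if_cong)

lemma dg_mv: "(dg d *v x) $ i = complex_of_real (d i) * x $ i"
  by (simp add: matrix_vector_mult_def dg_def if_distrib [of "\<lambda>x. x * _"] cong: if_cong)

lemma adj_dg [simp]: "adj (dg d) = dg d"
  by (auto simp: vec_eq_iff adj_nth dg_def)

lemma unitary_op_cancel: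
  assumes "unitary_op U"
  shows "adj U ** (U ** A) = A" "U ** (adj U ** A) = A" "A ** U ** adj U = A" "A ** adj U ** U = A"
  using assms by (simp_all add: unitary_op_def matrix_mul_assoc) (simp_all add: unitary_op_def flip: matrix_mul_assoc)

lemma norm_unitary_op:
  fixes A :: "'n::finite op"
  assumes "unitary_op U" "unitary_op V" shows "norm (adj U ** A ** V) = norm A"
proof -
  have "(adj U ** A ** V) \<bullet> (adj U ** A ** V) = A \<bullet> A"
    using assms by (simp only: inner_mm_right[of _ V] unitary_op_cancel(3)[of V] inner_mm_left[of "adj U"]
        adj_adj unitary_op_cancel(2))
  then show ?thesis by (simp add: norm_eq_sqrt_inner)
qed

text \<open>Induction on \<open>k\<close>: the next eigenvector maximises the quadratic form of
  \<open>A\<close> on the unit sphere of the orthogonal complement of the previous ones, which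
  \<open>A\<close> leaves invariant.\<close>

lemma exists_cortho_eigenvectors:
  fixes A :: "'n::finite op"
  assumes A: "adj A = A" and "k \<le> CARD('n)"
  shows "\<exists>(u :: nat \<Rightarrow> complex^'n) d. (\<forall>i<k. A *v u i = complex_of_real (d i) *s u i) \<and>
     (\<forall>i<k. \<forall>j<k. (\<Sum>l\<in>UNIV. cnj (u i $ l) * u j $ l) = (if i = j then 1 else 0))"
  using assms(2)
proof (induction k)
  case (Suc k)
  define cd where "cd = (\<lambda>x y :: complex^'n. \<Sum>l\<in>UNIV. cnj (x $ l) * y $ l)"
  have cd_scal': "cd (c *s x) y = cnj c * cd x y" and cd_cnj: "cd y x = cnj (cd x y)"
    and cd_scaleR: "cd x (r *\<^sub>R y) = r * cd x y" and cd_diff: "cd x (y - z) = cd x y - cd x z" for x y z c r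
    by (simp_all add: cd_def algebra_simps sum.distrib sum_distrib_left scaleR_complex sum_subtractf)
  have inn: "x \<bullet> y = Re (cd x y)" for x y by (simp add: cd_def cinner_Re del: Re_sum)
  have cd_A: "cd (A *v x) y = cd x (A *v y)" for x y
  proof -
    have "(\<Sum>i\<in>UNIV. \<Sum>j\<in>UNIV. cnj (A $ i $ j * x $ j) * y $ i) =
        (\<Sum>j\<in>UNIV. \<Sum>i\<in>UNIV. cnj (A $ i $ j * x $ j) * y $ i)"
      by (rule sum.swap)
    moreover have "cnj (A $ i $ j) = A $ j $ i" for i j using A by (metis adj_nth)
    ultimately show ?thesis
      by (simp add: cd_def matrix_vector_mult_def sum_distrib_left sum_distrib_right mult_ac)
  qed
  obtain u d where ev: "\<And>i. i < k \<Longrightarrow> A *v u i = complex_of_real (d i) *s u i"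
    and on: "\<And>i j. i < k \<Longrightarrow> j < k \<Longrightarrow> cd (u i) (u j) = (if i = j then 1 else 0)"
    using Suc.IH[OF Suc_leD[OF Suc.prems]] unfolding cd_def by (elim exE conjE) blast
  define S where "S = {x. \<forall>i<k. cd (u i) x = 0}"
  have S_diff: "x - y \<in> S" if "x \<in> S" "y \<in> S" for x y
    using that by (auto simp: S_def cd_diff)
  have S_scaleR: "r *\<^sub>R x \<in> S" if "x \<in> S" for x r
    using that by (auto simp: S_def cd_scaleR)
  have S_A: "A *v x \<in> S" if "x \<in> S" for x
    using that by (auto simp: S_def ev cd_scal' simp flip: cd_A)
  have cont: "continuous_on UNIV (\<lambda>x. cd y x)" for y
    unfolding cd_def by (intro continuous_intros)
  have "closed S"
  proof -
    have "S = (\<Inter>i\<in>{..<k}. {x. cd (u i) x = 0})" by (auto simp: S_def)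
    then show ?thesis by (auto intro!: closed_INT closed_Collect_eq cont continuous_on_const)
  qed
  \<comment> \<open>Complex orthogonality to \<open>u i\<close> is real orthogonality to
    \<open>u i\<close> and \<open>\<i> *s u i\<close>, so a real dimension count with
    \<open>2 k\<close> vectors yields a nonzero element of \<open>S\<close>.\<close>
  let ?B = "u ` {..<k} \<union> (\<lambda>i. \<i> *s u i) ` {..<k}"
  have "dim (span ?B) \<le> card ?B" by (metis dim_le_card' dim_span finite_Un finite_imageI finite_lessThan)
  also have "\<dots> \<le> k + k"
    by (metis (no_types, lifting) add_mono card_Un_le card_image_le card_lessThan finite_lessThan order_trans)
  also have "\<dots> < DIM(complex^'n)" using Suc.prems by simp
  finally have "span ?B \<subset> UNIV" by (metis dim_UNIV dim_span less_not_refl psubsetI subset_UNIV)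
  then obtain x0 where x0: "x0 \<noteq> 0" "\<And>y. y \<in> span ?B \<Longrightarrow> orthogonal x0 y"
    using orthogonal_to_subspace_exists_gen[of ?B UNIV] by auto
  have "x0 \<in> S"
    unfolding S_def
  proof safe
    fix i assume "i < k"
    then have "u i \<bullet> x0 = 0" "(\<i> *s u i) \<bullet> x0 = 0"
      using x0(2)[OF span_base, of "u i"] x0(2)[OF span_base, of "\<i> *s u i"]
      by (auto simp: orthogonal_def inner_commute)
    then show "cd (u i) x0 = 0" by (simp add: inn cd_scal' complex_eq_iff)
  qed
  then have "inverse (norm x0) *\<^sub>R x0 \<in> S \<inter> sphere 0 1" using x0(1) by (simp add: S_scaleR)
  then have ne: "S \<inter> sphere 0 1 \<noteq> {}" by blast
  have "compact (S \<inter> sphere 0 1)" using \<open>closed S\<close> by (simp add: closed_Int_compact)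
  moreover have cA: "continuous_on (S \<inter> sphere 0 1) (\<lambda>x. x \<bullet> (A *v x))"
    by (intro continuous_intros linear_continuous_on matrix_vector_mul_bounded_linear)
  ultimately obtain x where x: "x \<in> S \<inter> sphere 0 1"
     and mx: "\<And>y. y \<in> S \<inter> sphere 0 1 \<Longrightarrow> y \<bullet> (A *v y) \<le> x \<bullet> (A *v x)"
    using continuous_attains_sup[OF _ ne, of "\<lambda>x. x \<bullet> (A *v x)"] cA by blast
  define \<mu> where "\<mu> = x \<bullet> (A *v x)"
  define B where "B = (\<lambda>y. \<mu> * (y \<bullet> y) - y \<bullet> (A *v y))"
  have B0: "0 \<le> B y" if "y \<in> S" for y
  proof (cases "y = 0")
    case False
    then have "inverse (norm y) *\<^sub>R y \<in> S \<inter> sphere 0 1" using that by (simp add: S_scaleR)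
    from mx[OF this] have "inverse (norm y) * inverse (norm y) * (y \<bullet> (A *v y)) \<le> \<mu>"
      by (simp add: \<mu>_def mv_scaleR)
    then show ?thesis using False
      by (simp add: B_def divide_simps dot_square_norm power2_eq_square mult_ac split: if_splits)
  qed (simp add: B_def)
  \<comment> \<open>\<open>B\<close> is a nonnegative quadratic form on \<open>S\<close> vanishing
    at \<open>x\<close>. Moving from \<open>x\<close> in the direction of the residual
    \<open>y\<close> gives \<open>2 * (y \<bullet> y) \<le> t * B y\<close> for all
    \<open>t > 0\<close>, which forces \<open>y = 0\<close>.\<close>
  define y where "y = \<mu> *\<^sub>R x - A *v x"
  have yS: "y \<in> S" using x by (simp add: y_def S_diff S_scaleR S_A)
  have sym: "x \<bullet> (A *v y) = y \<bullet> (A *v x)"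
    by (metis A inner_commute inner_mv)
  have Bx: "x \<bullet> x = 1" using x by (simp add: dot_square_norm)
  have "2 * (y \<bullet> y) \<le> t * B y" if "t > 0" for t
  proof -
    have "x - t *\<^sub>R y \<in> S" using x yS by (simp add: S_diff S_scaleR)
    from B0[OF this] have "0 \<le> - 2 * t * (\<mu> * (y \<bullet> x) - y \<bullet> (A *v x)) + t * t * B y"
      using Bx by (simp add: B_def algebra_simps mv_scaleR sym inner_commute[of x y] \<mu>_def[symmetric])
    also have "\<mu> * (y \<bullet> x) - y \<bullet> (A *v x) = y \<bullet> y"
      unfolding y_def by (simp add: inner_diff_right)
    finally have "0 \<le> t * (t * B y - 2 * (y \<bullet> y))" by (simp add: algebra_simps)
    then show ?thesis using that by (simp add: zero_le_mult_iff)
  qed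
  note * = this
  have "y \<bullet> y \<le> 0"
  proof (rule ccontr)
    assume "\<not> ?thesis"
    then have "0 < y \<bullet> y" by linarith
    moreover have "0 \<le> B y" using B0 yS by blast
    ultimately have "2 * (y \<bullet> y) \<le> (y \<bullet> y) / (B y + 1) * B y"
      by (intro *) (auto intro: divide_pos_pos)
    also have "\<dots> \<le> y \<bullet> y" using \<open>0 \<le> B y\<close> \<open>0 < y \<bullet> y\<close> by (simp add: divide_simps algebra_simps)
    finally show False using \<open>0 < y \<bullet> y\<close> by simp
  qed
  then have "y = 0" by (metis antisym inner_eq_zero_iff inner_ge_zero)
  then have Ax: "A *v x = complex_of_real \<mu> *s x"
    by (simp add: y_def vec_eq_iff scaleR_complex)
  have cdx: "cd x x = 1"
    using Bx cd_cnj[of x x] by (simp add: inn complex_eq_iff)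
  have ux: "cd (u i) x = 0" "cd x (u i) = 0" if "i < k" for i
    using x that cd_cnj[of "u i" x] by (auto simp: S_def cd_cnj[of "x" "u i"])
  show ?case
  proof (intro exI[of _ "u(k := x)"] exI[of _ "d(k := \<mu>)"] conjI allI impI)
    fix i assume "i < Suc k" then show "A *v (u(k := x)) i = complex_of_real ((d(k := \<mu>)) i) *s (u(k := x)) i"
      using ev Ax by (auto simp: less_Suc_eq)
  next
    fix i j assume "i < Suc k" "j < Suc k"
    then have "cd ((u(k := x)) i) ((u(k := x)) j) = (if i = j then 1 else 0)"
      using on cdx ux by (auto simp: less_Suc_eq)
    then show "(\<Sum>l\<in>UNIV. cnj ((u(k := x)) i $ l) * (u(k := x)) j $ l) = (if i = j then 1 else 0)"
      by (simp add: cd_def)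
  qed
qed simp

theorem spectral_theorem:
  fixes A :: "'n::finite op"
  assumes "adj A = A"
  obtains U d where "unitary_op U" "A = U ** dg d ** adj U"
proof -
  obtain u :: "nat \<Rightarrow> complex^'n" and d where
    ev: "\<And>i. i < CARD('n) \<Longrightarrow> A *v u i = complex_of_real (d i) *s u i" and
    on: "\<And>i j. i < CARD('n) \<Longrightarrow> j < CARD('n) \<Longrightarrow>
        (\<Sum>l\<in>UNIV. cnj (u i $ l) * u j $ l) = (if i = j then 1 else 0)"
    using exists_cortho_eigenvectors[OF assms order_refl] by blast
  obtain h :: "'n \<Rightarrow> nat" where h: "bij_betw h UNIV {0..<CARD('n)}"
    using ex_bij_betw_finite_nat[of "UNIV :: 'n set"] by auto
  have hlt: "h i < CARD('n)" for i using h by (auto simp: bij_betw_def)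
  have hinj: "h i = h j \<longleftrightarrow> i = j" for i j using h by (auto simp: bij_betw_def inj_on_def)
  define U :: "'n op" where "U = (\<chi> i j. u (h j) $ i)"
  have 1: "adj U ** U = mat 1"
    by (simp add: vec_eq_iff matrix_matrix_mult_def adj_nth U_def on hlt hinj mat_def)
  then have 2: "U ** adj U = mat 1" by (simp add: matrix_left_right_inverse)
  have "A ** U = U ** dg (\<lambda>i. d (h i))"
    using ev[OF hlt] unfolding vec_eq_iff mm_dg_right
    by (simp add: matrix_matrix_mult_def U_def matrix_vector_mult_def mult.commute)
  then have "A = U ** dg (\<lambda>i. d (h i)) ** adj U"
    by (metis 2 matrix_mul_assoc matrix_mul_rid)
  with 1 2 that show ?thesis by (auto simp: unitary_op_def)
qed

text \<open>The columns of \<open>U\<close> are eigenvectors and span, which gives uniqueness. For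
  existence, the coordinates \<open>adj U *v v\<close> of an eigenvector \<open>v\<close> for
  \<open>x\<close> vanish at every index with \<open>d i \<noteq> x\<close>.\<close>

lemma mfun_spectral:
  assumes U: "unitary_op U" and A: "A = U ** dg d ** adj U"
  shows "mfun f A = U ** dg (\<lambda>i. f (d i)) ** adj U"
  unfolding mfun_def
proof (rule the_equality)
  show "\<forall>x v. A *v v = complex_of_real x *s v \<longrightarrow>
      (U ** dg (\<lambda>i. f (d i)) ** adj U) *v v = complex_of_real (f x) *s v"
  proof (intro allI impI)
    fix x :: real and v assume v: "A *v v = complex_of_real x *s v"
    define w where "w = adj U *v v"
    have vU: "v = U *v w" using U by (simp add: w_def matrix_vector_mul_assoc unitary_op_def)
    have "dg d *v w = adj U *v (A *v v)"
      using U by (simp add: A w_def matrix_vector_mul_assoc matrix_mul_assoc unitary_op_def)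
    also have "\<dots> = complex_of_real x *s w"
      by (simp only: v w_def) (simp add: matrix_vector_mult_def vec_eq_iff sum_distrib_left mult_ac)
    finally have "d i = x \<or> w $ i = 0" for i by (simp add: vec_eq_iff dg_mv) blast
    then have "dg (\<lambda>i. f (d i)) *v w = complex_of_real (f x) *s w"
      by (simp add: vec_eq_iff dg_mv) metis
    then have "U *v (dg (\<lambda>i. f (d i)) *v w) = complex_of_real (f x) *s v"
      unfolding vU by (simp add: matrix_vector_mult_def vec_eq_iff sum_distrib_left mult_ac)
    then show "(U ** dg (\<lambda>i. f (d i)) ** adj U) *v v = complex_of_real (f x) *s v"
      by (simp add: w_def matrix_vector_mul_assoc matrix_mul_assoc)
  qed
next
  fix B assume B: "\<forall>x v. A *v v = complex_of_real x *s v \<longrightarrow> B *v v = complex_of_real (f x) *s v"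
  have col: "M *v (\<chi> i. U $ i $ j) = (\<chi> i. (M ** U) $ i $ j)" for M j
    by (simp add: matrix_vector_mult_def matrix_matrix_mult_def)
  have "A ** U = U ** dg d" using U by (simp add: A unitary_op_def flip: matrix_mul_assoc)
  then have "B *v (\<chi> i. U $ i $ j) = complex_of_real (f (d j)) *s (\<chi> i. U $ i $ j)" for j
    by (intro B[rule_format]) (simp add: col vec_eq_iff mm_dg_right mult.commute)
  then have "B ** U = U ** dg (\<lambda>i. f (d i))"
    by (simp add: col vec_eq_iff mm_dg_right mult.commute)
  then show "B = U ** dg (\<lambda>i. f (d i)) ** adj U"
    by (metis U unitary_op_cancel(3))
qed

lemma adj_conj_dg: "adj (U ** dg d ** adj U) = U ** dg d ** adj U"
  by (simp add: adj_mm matrix_mul_assoc)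

lemma inner_conj_dg:
  "x \<bullet> ((U ** dg d ** adj U) *v x) = (\<Sum>i\<in>UNIV. d i * (norm ((adj U *v x) $ i))\<^sup>2)"
proof -
  have "x \<bullet> ((U ** dg d ** adj U) *v x) = (adj U *v x) \<bullet> (dg d *v (adj U *v x))"
    by (simp add: inner_mv flip: matrix_vector_mul_assoc)
  also have "\<dots> = (\<Sum>i\<in>UNIV. d i * (norm ((adj U *v x) $ i))\<^sup>2)"
    unfolding inner_vec_def by (intro sum.cong refl) (simp only: dg_mv inner_complex_def cmod_power2, simp add: power2_eq_square algebra_simps)
  finally show ?thesis .
qed

lemma conj_dg_posdef:
  assumes "unitary_op U" shows "posdef (U ** dg d ** adj U) \<longleftrightarrow> (\<forall>i. 0 < d i)"
proof
  assume p: "posdef (U ** dg d ** adj U)"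
  show "\<forall>i. 0 < d i"
  proof
    fix i
    define x where "x = U *v axis i 1"
    have x: "adj U *v x = axis i 1" using assms by (simp add: x_def matrix_vector_mul_assoc unitary_op_def)
    then have "x \<noteq> 0" by (metis axis_eq_0_iff matrix_vector_mult_0_right zero_neq_one)
    then have "0 < x \<bullet> ((U ** dg d ** adj U) *v x)" using p by (simp add: posdef_inner)
    also have "x \<bullet> ((U ** dg d ** adj U) *v x) = d i"
      by (simp add: inner_conj_dg x axis_def if_distrib[of norm] if_distrib[of "\<lambda>x. x ^ 2"] if_distrib[of "\<lambda>x. _ * x"] cong: if_cong)
    finally show "0 < d i" .
  qed
next
  assume d: "\<forall>i. 0 < d i"
  show "posdef (U ** dg d ** adj U)"
    unfolding posdef_inner
  proof (intro conjI allI impI)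
    fix x :: "complex^'a" assume "x \<noteq> 0"
    then have "adj U *v x \<noteq> 0"
      using assms by (metis matrix_vector_mul_assoc matrix_vector_mul_lid matrix_vector_mult_0_right unitary_op_def)
    then obtain i where "(adj U *v x) $ i \<noteq> 0" by (auto simp: vec_eq_iff)
    then show "0 < x \<bullet> ((U ** dg d ** adj U) *v x)"
      unfolding inner_conj_dg using d by (intro sum_pos2[of _ i]) (auto simp: less_imp_le)
  qed (simp add: adj_conj_dg)
qed

lemma posdef_spectral:
  assumes "posdef A"
  obtains U d where "unitary_op U" "A = U ** dg d ** adj U" "\<And>i. 0 < d i"
  using assms by (metis conj_dg_posdef posdef_inner spectral_theorem)

section \<open>The logarithm\<close>

text \<open>Entrywise (Schur) multiplication by a real kernel. In an eigenbasis of
  \<open>\<rho>\<close> the weighted norms, the twisted multiplication and the derivative of the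
  logarithm all take this form.\<close>

definition schur :: "('n \<Rightarrow> 'n \<Rightarrow> real) \<Rightarrow> 'n::finite op \<Rightarrow> 'n op" where
  "schur c X = (\<chi> i j. complex_of_real (c i j) * X $ i $ j)"

lemma linear_schur: "linear (schur c)"
  by (simp add: schur_def linear_iff vec_eq_iff algebra_simps scaleR_complex)

section \<open>Norm estimates, rank-one operators and lower bounds of quadratic forms\<close>

lemma norm_op_squared: "(norm (X::'n::finite op))\<^sup>2 = (\<Sum>i\<in>UNIV. \<Sum>j\<in>UNIV. (cmod (X $ i $ j))\<^sup>2)"
  unfolding power2_norm_eq_inner inner_vec_def ..

lemma norm_op_le_const:
  fixes X :: "'n::finite op" and c :: real
  assumes "\<And>i j. cmod (X $ i $ j) \<le> c" "0 \<le> c"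
  shows "norm X \<le> CARD('n) * c"
proof -
  have "(norm X)\<^sup>2 \<le> (\<Sum>i\<in>(UNIV::'n set). \<Sum>j\<in>(UNIV::'n set). c\<^sup>2)"
    unfolding norm_op_squared by (rule sum_mono, rule sum_mono, rule power_mono) (use assms in auto)
  also have "\<dots> = (CARD('n) * c)\<^sup>2" by (simp add: power_mult_distrib power2_eq_square)
  finally show ?thesis by (rule power2_le_imp_le) (use assms(2) in simp)
qed

lemma norm_entry_le: "cmod ((X::'n::finite op) $ i $ j) \<le> norm X"
  using Finite_Cartesian_Product.norm_nth_le[of "X $ i" j] Finite_Cartesian_Product.norm_nth_le[of X i] by linarith

text \<open>The rank-one operator of \<open>x\<close>. It writes \<open>x \<bullet> (A *v x)\<close>
  as an inner product with \<open>A\<close>, so that Cauchy-Schwarz and differentiation apply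
  directly.\<close>

definition outer :: "complex^'n \<Rightarrow> 'n::finite op" where
  "outer x = (\<chi> i j. x $ i * cnj (x $ j))"

lemma adj_outer [simp]: "adj (outer x) = outer x"
  by (simp add: vec_eq_iff adj_nth outer_def)

lemma inner_outer: "outer x \<bullet> M = x \<bullet> (M *v x)"
  by (simp add: inner_vec_def[where 'a = "complex^'a"] outer_def cinner_Re matrix_vector_mult_def
      sum_distrib_left mult_ac del: Re_sum)
    (simp add: mult_ac)

lemma norm_outer: "norm (outer x) = x \<bullet> x"
proof -
  have "outer x \<bullet> outer x = x \<bullet> ((x \<bullet> x) *\<^sub>R x)"
    unfolding inner_outer
  proof (rule arg_cong[of _ _ "(\<bullet>) x"])
    have "(\<Sum>j\<in>UNIV. cnj (x $ j) * x $ j) = complex_of_real (x \<bullet> x)"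
      by (simp add: complex_eq_iff cinner_Re)
    then show "outer x *v x = (x \<bullet> x) *\<^sub>R x"
      by (simp add: vec_eq_iff outer_def matrix_vector_mult_def mult.assoc scaleR_complex mult_ac flip: sum_distrib_left)
  qed
  then have "(norm (outer x))\<^sup>2 = (x \<bullet> x)\<^sup>2"
    unfolding power2_norm_eq_inner by (simp add: power2_eq_square)
  then show ?thesis by simp
qed

text \<open>The operator inequality \<open>A \<ge> \<delta> 1\<close>; the case
  \<open>\<delta> = 0\<close> is positive semidefiniteness.\<close>

definition lbd :: "real \<Rightarrow> 'n::finite op \<Rightarrow> bool" where
  "lbd \<delta> A \<longleftrightarrow> adj A = A \<and> (\<forall>x. \<delta> * (x \<bullet> x) \<le> x \<bullet> (A *v x))"

lemma unitary_col:
  assumes "unitary_op U"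
  obtains x where "adj U *v x = axis i 1" "x \<bullet> x = 1"
proof
  show "adj U *v (U *v axis i 1) = axis i 1" using assms by (simp add: matrix_vector_mul_assoc unitary_op_def)
  have "(U *v axis i 1) \<bullet> (U *v axis i 1) = axis i (1::complex) \<bullet> axis i 1"
    using assms inner_mv[of "U *v axis i 1" U "axis i 1"] by (simp add: matrix_vector_mul_assoc unitary_op_def)
  then show "(U *v axis i 1) \<bullet> (U *v axis i 1) = 1" by (simp add: inner_axis_axis)
qed

lemma inner_conj_dg_axis:
  "adj U *v x = axis i 1 \<Longrightarrow> x \<bullet> ((U ** dg d ** adj U) *v x) = d i"
  by (simp add: inner_conj_dg axis_def if_distrib[of norm] if_distrib[of "\<lambda>x. x ^ 2"] if_distrib[of "\<lambda>x. _ * x"] cong: if_cong)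

lemma lbd_conj_dg:
  assumes "unitary_op U" shows "lbd \<delta> (U ** dg d ** adj U) \<longleftrightarrow> (\<forall>i. \<delta> \<le> d i)"
proof
  assume *: "lbd \<delta> (U ** dg d ** adj U)"
  show "\<forall>i. \<delta> \<le> d i"
  proof
    fix i obtain x where "adj U *v x = axis i 1" "x \<bullet> x = 1" using unitary_col[OF assms] by blast
    then show "\<delta> \<le> d i" using * inner_conj_dg_axis unfolding lbd_def by (metis mult.right_neutral)
  qed
next
  assume d: "\<forall>i. \<delta> \<le> d i"
  have "\<delta> * (x \<bullet> x) \<le> x \<bullet> ((U ** dg d ** adj U) *v x)" for x
  proof -
    have "x \<bullet> x = x \<bullet> ((U ** dg (\<lambda>_. 1) ** adj U) *v x)"
    proof -
      have "dg (\<lambda>_. 1) = (mat 1 :: 'a op)" by (simp add: dg_def mat_def vec_eq_iff)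
      then show ?thesis using assms by (simp add: unitary_op_def)
    qed
    also have "\<dots> = (\<Sum>i\<in>UNIV. (norm ((adj U *v x) $ i))\<^sup>2)" by (simp add: inner_conj_dg)
    finally have "\<delta> * (x \<bullet> x) = (\<Sum>i\<in>UNIV. \<delta> * (norm ((adj U *v x) $ i))\<^sup>2)"
      by (simp add: sum_distrib_left)
    also have "\<dots> \<le> (\<Sum>i\<in>UNIV. d i * (norm ((adj U *v x) $ i))\<^sup>2)"
      using d by (intro sum_mono mult_right_mono) auto
    finally show ?thesis by (simp add: inner_conj_dg)
  qed
  then show "lbd \<delta> (U ** dg d ** adj U)" by (simp add: lbd_def adj_conj_dg)
qed

lemma posdef_lbd:
  assumes "posdef A" obtains \<delta> where "0 < \<delta>" "lbd \<delta> A"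
proof -
  obtain U d where U: "unitary_op U" "A = U ** dg d ** adj U" "\<And>i. 0 < d i"
    using posdef_spectral[OF assms] by blast
  show ?thesis
  proof (rule that)
    show "0 < Min (range d)" using U(3) by (subst Min_gr_iff) auto
    show "lbd (Min (range d)) A" using U(1) unfolding U(2) lbd_conj_dg[OF U(1)] by simp
  qed
qed

lemma lbd_mono: "lbd \<delta> A \<Longrightarrow> \<delta>' \<le> \<delta> \<Longrightarrow> lbd \<delta>' A"
  unfolding lbd_def by (meson inner_ge_zero mult_right_mono order_trans)

lemma lbd_perturb:
  assumes "lbd \<delta> A" "adj B = B" "norm (B - A) \<le> \<epsilon>" shows "lbd (\<delta> - \<epsilon>) B"
  unfolding lbd_def
proof (intro conjI allI)
  fix x
  have "\<bar>outer x \<bullet> (B - A)\<bar> \<le> (x \<bullet> x) * norm (B - A)"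
    by (metis Cauchy_Schwarz_ineq2 norm_outer)
  also have "\<dots> \<le> (x \<bullet> x) * \<epsilon>" using assms(3) by (intro mult_left_mono) auto
  finally have "\<bar>x \<bullet> (B *v x) - x \<bullet> (A *v x)\<bar> \<le> \<epsilon> * (x \<bullet> x)"
    by (simp add: inner_diff_right inner_outer mult.commute)
  moreover have "\<delta> * (x \<bullet> x) \<le> x \<bullet> (A *v x)" using assms(1) by (simp add: lbd_def)
  ultimately show "(\<delta> - \<epsilon>) * (x \<bullet> x) \<le> x \<bullet> (B *v x)" by (simp add: algebra_simps)
qed (use assms in auto)

text \<open>The divided difference of the logarithm, in a form that needs no case distinction.\<close>

definition ln_dd :: "real \<Rightarrow> real \<Rightarrow> real" where
  "ln_dd x y = integral {0..1} (\<lambda>\<theta>. 1 / (y + \<theta> * (x - y)))"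

lemma segment_ge:
  fixes x y :: real assumes "\<delta> \<le> x" "\<delta> \<le> y" "\<theta> \<in> {0..1}" shows "\<delta> \<le> y + \<theta> * (x - y)"
proof -
  have "\<delta> = (1 - \<theta>) * \<delta> + \<theta> * \<delta>" by (simp add: algebra_simps)
  also have "\<dots> \<le> (1 - \<theta>) * y + \<theta> * x" using assms by (intro add_mono mult_left_mono) auto
  finally show ?thesis by (simp add: algebra_simps)
qed

lemma ln_dd_integrable:
  assumes "0 < x" "0 < (y::real)" shows "(\<lambda>\<theta>. 1 / (y + \<theta> * (x - y))) integrable_on {0..1}"
proof (rule integrable_continuous_real, rule continuous_on_divide)
  show "\<forall>\<theta>\<in>{0..1}. y + \<theta> * (x - y) \<noteq> 0"
  proof
  fix \<theta> :: real assume "\<theta> \<in> {0..1}"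
  then show "y + \<theta> * (x - y) \<noteq> 0" using segment_ge[of "min x y" x y \<theta>] assms by auto
  qed
qed (intro continuous_intros)+

lemma ln_dd_mult:
  assumes "0 < x" "0 < y" shows "ln_dd x y * (x - y) = ln x - ln y"
proof -
  have "((\<lambda>\<theta>. 1 / (y + \<theta> * (x - y)) * (x - y)) has_integral ln (y + 1 * (x - y)) - ln (y + 0 * (x - y))) {0..1}"
  proof (rule fundamental_theorem_of_calculus)
    fix \<theta> :: real assume "\<theta> \<in> {0..1}"
    then have "0 < y + \<theta> * (x - y)" using segment_ge[of "min x y" x y \<theta>] assms by auto
    then show "((\<lambda>\<theta>. ln (y + \<theta> * (x - y))) has_vector_derivative 1 / (y + \<theta> * (x - y)) * (x - y)) (at \<theta> within {0..1})"
      unfolding has_real_derivative_iff_has_vector_derivative[symmetric]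
      by (auto intro!: derivative_eq_intros)
  qed simp
  moreover have "((\<lambda>\<theta>. 1 / (y + \<theta> * (x - y)) * (x - y)) has_integral ln_dd x y * (x - y)) {0..1}"
    unfolding ln_dd_def by (intro has_integral_mult_left integrable_integral ln_dd_integrable assms)
  ultimately show ?thesis by (auto dest: has_integral_unique)
qed

lemma ln_dd_diag: "0 < x \<Longrightarrow> ln_dd x x = 1 / x"
  by (simp add: ln_dd_def)

text \<open>The integrand is the reciprocal of a point of a segment inside
  \<open>[\<delta>, \<infinity>)\<close>, where the reciprocal has Lipschitz constant
  \<open>1 / \<delta>\<^sup>2\<close>.\<close>

lemma ln_dd_lipschitz:
  assumes "0 < \<delta>" "\<delta> \<le> x" "\<delta> \<le> y" "\<delta> \<le> z"
  shows "\<bar>ln_dd x z - ln_dd y z\<bar> \<le> \<bar>x - y\<bar> / \<delta>\<^sup>2"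
proof -
  have "norm (integral {0..1} (\<lambda>\<theta>. 1 / (z + \<theta> * (x - z)) - 1 / (z + \<theta> * (y - z)))) \<le>
      integral {0..1} (\<lambda>\<theta>::real. \<bar>x - y\<bar> / \<delta>\<^sup>2)"
  proof (rule integral_norm_bound_integral)
    fix \<theta> :: real assume \<theta>: "\<theta> \<in> {0..1}"
    have p: "\<delta> \<le> z + \<theta> * (x - z)" "\<delta> \<le> z + \<theta> * (y - z)"
      using segment_ge[of \<delta>] \<theta> assms by auto
    have "1 / (z + \<theta> * (x - z)) - 1 / (z + \<theta> * (y - z)) =
        \<theta> * (y - x) / ((z + \<theta> * (x - z)) * (z + \<theta> * (y - z)))"
      using p assms by (simp add: divide_simps algebra_simps)
    also have "\<bar>\<dots>\<bar> \<le> \<bar>x - y\<bar> / \<delta>\<^sup>2"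
      unfolding abs_divide power2_eq_square abs_mult using p assms(1) \<theta>
      by (intro frac_le mult_mono mult_pos_pos) (auto simp: abs_minus_commute mult_left_le_one_le)
    finally show "norm (1 / (z + \<theta> * (x - z)) - 1 / (z + \<theta> * (y - z))) \<le> \<bar>x - y\<bar> / \<delta>\<^sup>2" by simp
  qed (use assms in \<open>auto intro!: integrable_diff ln_dd_integrable\<close>)
  then show ?thesis using assms
    by (simp add: ln_dd_def integral_diff ln_dd_integrable)
qed

text \<open>Rows are taken in an eigenbasis of \<open>A\<close> and columns in one of
  \<open>B\<close>. In this mixed basis a difference of functions acts entrywise although
  \<open>A\<close> and \<open>B\<close> need not commute.\<close>

lemma mfun_mixed_basis:
  assumes U: "unitary_op U" "A = U ** dg a ** adj U" and V: "unitary_op V" "B = V ** dg b ** adj V"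
  shows "(adj U ** (mfun f A - mfun f B) ** V) $ i $ j = complex_of_real (f (a i) - f (b j)) * (adj U ** V) $ i $ j"
    and "(adj U ** (A - B) ** V) $ i $ j = complex_of_real (a i - b j) * (adj U ** V) $ i $ j"
proof -
  have *: "adj U ** (U ** dg c ** adj U - V ** dg c' ** adj V) ** V = dg c ** (adj U ** V) - (adj U ** V) ** dg c'" for c c'
    using U(1) V(1)
    by (simp add: mm_distribs unitary_op_cancel flip: matrix_mul_assoc) (simp add: unitary_op_def)
  show "(adj U ** (mfun f A - mfun f B) ** V) $ i $ j = complex_of_real (f (a i) - f (b j)) * (adj U ** V) $ i $ j"
    unfolding mfun_spectral[OF U] mfun_spectral[OF V] *
    by (simp add: mm_dg_left mm_dg_right algebra_simps)
  show "(adj U ** (A - B) ** V) $ i $ j = complex_of_real (a i - b j) * (adj U ** V) $ i $ j"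
    unfolding U(2) V(2) * by (simp add: mm_dg_left mm_dg_right algebra_simps)
qed

text \<open>The Daletskii-Krein formula for the Frechet derivative of the logarithm at
  \<open>V ** dg a ** adj V\<close>.\<close>

definition ln_deriv :: "'n::finite op \<Rightarrow> ('n \<Rightarrow> real) \<Rightarrow> 'n op \<Rightarrow> 'n op" where
  "ln_deriv V a X = V ** schur (\<lambda>i j. ln_dd (a i) (a j)) (adj V ** X ** V) ** adj V"

text \<open>In the mixed basis the difference of logarithms has kernel
  \<open>ln_dd (b i) (a j)\<close>, the linear term \<open>ln_dd (a k) (a j)\<close>. Their
  difference is at most \<open>\<bar>b i - a k\<bar> / \<delta>\<^sup>2\<close>, and
  \<open>b i - a k\<close> times the overlap of the two eigenvectors is again an entry of
  \<open>B - A\<close>. This is the second factor \<open>norm (B - A)\<close>.\<close>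

lemma mfun_ln_taylor:
  assumes V: "unitary_op V" "A = V ** dg a ** adj V"
    and lb: "0 < \<delta>" "lbd \<delta> A" "lbd \<delta> (B :: 'n::finite op)"
  shows "norm (mfun ln B - mfun ln A - ln_deriv V a (B - A)) \<le> (CARD('n))\<^sup>2 / \<delta>\<^sup>2 * (norm (B - A))\<^sup>2"
proof -
  obtain U b where U: "unitary_op U" "B = U ** dg b ** adj U" using lb spectral_theorem unfolding lbd_def by blast
  have ge: "\<delta> \<le> a i" "\<delta> \<le> b i" for i
    using lb(2,3) lbd_conj_dg[OF U(1), of \<delta> b] lbd_conj_dg[OF V(1), of \<delta> a] by (auto simp: U(2) V(2))
  have pos: "0 < a i" "0 < b i" for i using ge[of i] lb(1) by auto
  define X where "X = mfun ln B - mfun ln A"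
  define \<Delta> where "\<Delta> = B - A"
  let ?M = "adj V ** \<Delta> ** V" and ?W = "adj U ** V"
  have X: "(adj U ** X ** V) $ i $ j = ln_dd (b i) (a j) * (adj U ** \<Delta> ** V) $ i $ j" for i j
    using ln_dd_mult[OF pos(2)[of i] pos(1)[of j]] unfolding X_def \<Delta>_def mfun_mixed_basis[OF U V]
    by (simp only: of_real_mult[symmetric] mult.assoc[symmetric])
  have eU: "adj U ** \<Delta> ** V = ?W ** ?M" using V(1) by (simp add: unitary_op_cancel flip: matrix_mul_assoc)
  have eD: "adj U ** ln_deriv V a \<Delta> ** V = ?W ** schur (\<lambda>i j. ln_dd (a i) (a j)) ?M"
    using V(1) by (simp add: ln_deriv_def unitary_op_def flip: matrix_mul_assoc)
  have "norm (X - ln_deriv V a \<Delta>) = norm (adj U ** (X - ln_deriv V a \<Delta>) ** V)"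
    by (simp add: norm_unitary_op U V)
  also have "\<dots> \<le> CARD('n) * (CARD('n) / \<delta>\<^sup>2 * (norm \<Delta>)\<^sup>2)"
  proof (rule norm_op_le_const)
    fix i j
    have "(adj U ** (X - ln_deriv V a \<Delta>) ** V) $ i $ j =
        ln_dd (b i) (a j) * (?W ** ?M) $ i $ j - (?W ** schur (\<lambda>i j. ln_dd (a i) (a j)) ?M) $ i $ j"
      by (simp only: mm_distribs vector_minus_component X eD flip: eU)
    also have "\<dots> = (\<Sum>k\<in>UNIV. complex_of_real (ln_dd (b i) (a j) - ln_dd (a k) (a j)) * ?W $ i $ k * ?M $ k $ j)"
      by (simp add: matrix_matrix_mult_def[of ?W] schur_def sum_distrib_left algebra_simps flip: sum_subtractf)
    also have "norm \<dots> \<le> (\<Sum>k\<in>(UNIV::'n set). (norm \<Delta>)\<^sup>2 / \<delta>\<^sup>2)"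
    proof (rule sum_norm_le)
      fix k
      have "\<bar>ln_dd (b i) (a j) - ln_dd (a k) (a j)\<bar> \<le> \<bar>b i - a k\<bar> / \<delta>\<^sup>2"
        using ge lb by (intro ln_dd_lipschitz) auto
      then have "cmod (complex_of_real (ln_dd (b i) (a j) - ln_dd (a k) (a j)) * ?W $ i $ k * ?M $ k $ j)
         \<le> \<bar>b i - a k\<bar> / \<delta>\<^sup>2 * cmod (?W $ i $ k) * cmod (?M $ k $ j)"
        unfolding norm_mult norm_of_real by (intro mult_right_mono) auto
      also have "\<dots> = cmod ((adj U ** \<Delta> ** V) $ i $ k) * cmod (?M $ k $ j) / \<delta>\<^sup>2"
        unfolding \<Delta>_def mfun_mixed_basis(2)[OF U V] norm_mult norm_of_real by simp
      also have "\<dots> \<le> norm (adj U ** \<Delta> ** V) * norm ?M / \<delta>\<^sup>2"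
        using lb(1) by (intro divide_right_mono mult_mono norm_entry_le) auto
      also have "\<dots> = (norm \<Delta>)\<^sup>2 / \<delta>\<^sup>2"
        by (simp add: norm_unitary_op U V power2_eq_square)
      finally show "cmod (complex_of_real (ln_dd (b i) (a j) - ln_dd (a k) (a j)) * ?W $ i $ k * ?M $ k $ j)
         \<le> (norm \<Delta>)\<^sup>2 / \<delta>\<^sup>2" .
    qed
    finally show "cmod ((adj U ** (X - ln_deriv V a \<Delta>) ** V) $ i $ j) \<le> CARD('n) / \<delta>\<^sup>2 * (norm \<Delta>)\<^sup>2"
      by simp
  qed simp
  finally show ?thesis by (simp add: X_def \<Delta>_def power2_eq_square mult_ac)
qed

text \<open>The derivative is taken within the self-adjoint operators, where the functional calculus
  is controlled. The pairing with \<open>A\<close> reduces to a trace because the divided difference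
  of \<open>ln\<close> on the diagonal is \<open>1 / x\<close>.\<close>

theorem mfun_ln_has_derivative:
  assumes "posdef (A :: 'n::finite op)"
  obtains Y where "(mfun ln has_derivative Y) (at A within {B. adj B = B})"
    "\<And>X. A \<bullet> Y X = Re (trace X)"
proof -
  obtain V a where V: "unitary_op V" "A = V ** dg a ** adj V" and apos: "\<And>i. 0 < a i"
    using posdef_spectral[OF assms] by blast
  obtain \<delta> where \<delta>: "0 < \<delta>" "lbd \<delta> A" using posdef_lbd[OF assms] .
  show ?thesis
  proof (rule that)
    have "linear (ln_deriv V a)"
      using linear_compose[OF linear_compose[OF linear_compose[OF linear_mm_left linear_mm_right] linear_schur]
          linear_compose[OF linear_mm_left linear_mm_right]]
      by (simp add: ln_deriv_def[abs_def] o_def)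
    then have bl: "bounded_linear (ln_deriv V a)" by (simp add: linear_conv_bounded_linear)
    show "(mfun ln has_derivative ln_deriv V a) (at A within {B. adj B = B})"
    proof (rule has_derivativeI_sandwich[OF _ bl])
      show "0 < \<delta> / 2" using \<delta> by simp
      fix B assume B: "B \<in> {B. adj B = B}" "B \<noteq> A" "dist B A < \<delta> / 2"
      have "lbd (\<delta> - \<delta> / 2) B" using B \<delta> by (intro lbd_perturb) (auto simp: dist_norm)
      then have "lbd (\<delta> / 2) B" by simp
      moreover have "lbd (\<delta> / 2) A" using \<delta> by (auto intro: lbd_mono)
      ultimately have "norm (mfun ln B - mfun ln A - ln_deriv V a (B - A)) \<le> (CARD('n))\<^sup>2 / (\<delta>/2)\<^sup>2 * (norm (B - A))\<^sup>2"
        using \<delta> by (intro mfun_ln_taylor[OF V]) auto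
      then show "norm (mfun ln B - mfun ln A - ln_deriv V a (B - A)) / norm (B - A) \<le> (CARD('n))\<^sup>2 / (\<delta>/2)\<^sup>2 * norm (B - A)"
        using B(2) by (subst pos_divide_le_eq) (simp_all add: power2_eq_square mult_ac)
    next
      have "((\<lambda>B. (CARD('n))\<^sup>2 / (\<delta>/2)\<^sup>2 * norm (B - A)) \<longlongrightarrow> (CARD('n))\<^sup>2 / (\<delta>/2)\<^sup>2 * norm (A - A)) (at A within {B. adj B = B})"
        by (intro tendsto_intros)
      then show "((\<lambda>B. (CARD('n))\<^sup>2 / (\<delta>/2)\<^sup>2 * norm (B - A)) \<longlongrightarrow> 0) (at A within {B. adj B = B})" by simp
    qed
    fix X
    let ?M = "adj V ** X ** V"
    have "A \<bullet> ln_deriv V a X = dg a \<bullet> schur (\<lambda>i j. ln_dd (a i) (a j)) ?M"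
      unfolding V(2) ln_deriv_def using V(1)
      by (simp only: inner_mm_right[of _ "adj V"] inner_mm_left[of V] adj_adj unitary_op_cancel(4)[of V])
        (simp only: unitary_op_cancel(1) flip: matrix_mul_assoc)
    also have "\<dots> = (\<Sum>i\<in>UNIV. \<Sum>j\<in>UNIV. if j = i then Re (?M $ i $ i) else 0)"
      unfolding inner_vec_def using apos less_imp_neq[OF apos]
      by (intro sum.cong refl) (auto simp: dg_def schur_def inner_complex_def ln_dd_diag)
    also have "\<dots> = Re (trace ?M)" by (simp add: trace_def)
    also have "trace ?M = trace X"
      using V(1) by (metis matrix_mul_assoc matrix_mul_lid trace_mul_sym unitary_op_def)
    finally show "A \<bullet> ln_deriv V a X = Re (trace X)" .
  qed
qed

lemma continuous_on_mfun_ln: "continuous_on {A. posdef A} (mfun ln)"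
  unfolding continuous_on_eq_continuous_within
proof
  fix A :: "'n::finite op" assume "A \<in> {A. posdef A}"
  then obtain Y where "(mfun ln has_derivative Y) (at A within {B. adj B = B})"
    using mfun_ln_has_derivative by blast
  then have "continuous (at A within {B. adj B = B}) (mfun ln)" by (rule has_derivative_continuous)
  then show "continuous (at A within {A. posdef A}) (mfun ln)"
    by (rule continuous_within_subset) (auto simp: posdef_inner)
qed

lemma has_vector_derivative_mfun_ln:
  assumes \<gamma>: "(\<gamma> has_vector_derivative \<gamma>') (at s within S)" and s: "s \<in> S"
    and pd: "\<And>r. r \<in> S \<Longrightarrow> posdef (\<gamma> r :: 'n::finite op)"
  obtains Y where "((\<lambda>r. mfun ln (\<gamma> r)) has_vector_derivative Y) (at s within S)"
    "\<gamma> s \<bullet> Y = Re (trace \<gamma>')"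
proof -
  obtain Y where Y: "(mfun ln has_derivative Y) (at (\<gamma> s) within {B. adj B = B})"
    "\<And>X. \<gamma> s \<bullet> Y X = Re (trace X)"
    using mfun_ln_has_derivative[OF pd[OF s]] by blast
  have "(mfun ln has_derivative Y) (at (\<gamma> s) within \<gamma> ` S)"
    using pd by (intro has_derivative_subset[OF Y(1)]) (auto simp: posdef_inner)
  from vector_derivative_diff_chain_within[OF \<gamma> this] that[of "Y \<gamma>'"] Y(2)
  show ?thesis by (simp add: o_def)
qed

text \<open>Differentiating the logarithm itself contributes only the trace of the velocity, which
  vanishes along curves of states.\<close>

lemma has_real_derivative_entropy:
  assumes \<gamma>: "(\<gamma> has_vector_derivative \<gamma>') (at s within S)" and s: "s \<in> S"
    and pd: "\<And>r. r \<in> S \<Longrightarrow> posdef (\<gamma> r :: 'n::finite op)"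
    and \<sigma>: "adj \<sigma> = \<sigma>"
  shows "((\<lambda>r. rel_entropy (\<gamma> r) \<sigma>) has_real_derivative
     \<gamma>' \<bullet> (mfun ln (\<gamma> s) - mfun ln \<sigma>) + Re (trace \<gamma>')) (at s within S)"
proof -
  obtain Y where Y: "((\<lambda>r. mfun ln (\<gamma> r)) has_vector_derivative Y) (at s within S)"
    "\<gamma> s \<bullet> Y = Re (trace \<gamma>')"
    using has_vector_derivative_mfun_ln[OF assms(1-3)] by blast
  have "((\<lambda>r. mfun ln (\<gamma> r) - mfun ln \<sigma>) has_vector_derivative Y) (at s within S)"
    using Y(1) by (auto intro!: derivative_eq_intros)
  from bounded_bilinear.has_vector_derivative[OF bounded_bilinear_inner \<gamma> this] Y(2)
  have d: "((\<lambda>r. \<gamma> r \<bullet> (mfun ln (\<gamma> r) - mfun ln \<sigma>)) has_real_derivative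
     \<gamma>' \<bullet> (mfun ln (\<gamma> s) - mfun ln \<sigma>) + Re (trace \<gamma>')) (at s within S)"
    by (simp add: has_real_derivative_iff_has_vector_derivative add.commute)
  have "rel_entropy (\<gamma> r) \<sigma> = \<gamma> r \<bullet> (mfun ln (\<gamma> r) - mfun ln \<sigma>)" if "r \<in> S" for r
    using pd[OF that] by (simp add: rel_entropy_def inner_op posdef_inner)
  then show ?thesis
    by (intro has_field_derivative_transform_within[OF d zero_less_one s]) simp
qed

section \<open>Interpolation between weighted Hilbert-Schmidt norms\<close>

lemma nn_integral_exp_half_line:
  assumes "0 < (c::real)"
  shows "(\<integral>\<^sup>+ x. ennreal (exp (- c * x)) * indicator {0..} x \<partial>lborel) = ennreal (1 / c)"
proof -
  have "((\<lambda>x. exp (- c * x)) \<longlongrightarrow> 0) at_top"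
    using assms by (intro filterlim_compose[OF exp_at_bot] filterlim_tendsto_neg_mult_at_bot[OF tendsto_const])
      (auto simp: filterlim_ident)
  then have "((\<lambda>x. - exp (- c * x) / c) \<longlongrightarrow> - 0 / c) at_top" using assms by (intro tendsto_intros) auto
  then have "(\<integral>\<^sup>+ x. ennreal (exp (- c * x)) * indicator {0..} x \<partial>lborel) = 0 - (- exp (- c * 0) / c)"
    using assms by (intro nn_integral_FTC_atLeast) (auto intro!: derivative_eq_intros)
  then show ?thesis by simp
qed

text \<open>The integral of \<open>l powr (s - 1) / (1 + l)\<close> over \<open>l > 0\<close> after
  the substitution \<open>l = exp x\<close>, that is \<pi> / sin (\<pi> s) for
  \<open>0 < s < 1\<close>. It is neither 0 nor infinite there and cancels in the end.\<close>

definition mellin_const :: "real \<Rightarrow> ennreal" where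
  "mellin_const s = (\<integral>\<^sup>+ x. ennreal (exp (s * x) / (1 + exp x)) \<partial>lborel)"

lemma mellin_const_finite:
  assumes "0 < s" "s < 1" shows "mellin_const s \<noteq> \<infinity>"
proof -
  have "mellin_const s \<le> (\<integral>\<^sup>+ x. ennreal (exp (- (1 - s) * x)) * indicator {0..} x
      + ennreal (exp (- s * (- x))) * indicator {0..} (- x) \<partial>lborel)"
    unfolding mellin_const_def
  proof (rule nn_integral_mono)
    fix x :: real
    have "exp (s * x) / (1 + exp x) \<le> exp (s * x) / exp x" "exp (s * x) / (1 + exp x) \<le> exp (s * x) / 1"
      by (intro divide_left_mono; simp add: add_pos_pos)+
    then have "exp (s * x) / (1 + exp x) \<le> exp (- (1 - s) * x)" "exp (s * x) / (1 + exp x) \<le> exp (- s * (- x))"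
      by (simp_all add: algebra_simps flip: exp_diff)
    then have *: "ennreal (exp (s * x) / (1 + exp x)) \<le> ennreal (exp (- (1 - s) * x))"
      "ennreal (exp (s * x) / (1 + exp x)) \<le> ennreal (exp (- s * (- x)))"
      by (auto intro: ennreal_leI)
    show "ennreal (exp (s * x) / (1 + exp x)) \<le> ennreal (exp (- (1 - s) * x)) * indicator {0..} x
      + ennreal (exp (- s * (- x))) * indicator {0..} (- x)"
    proof (cases "0 \<le> x")
      case True
      then show ?thesis using *(1) by (intro add_increasing2) simp_all
    next
      case False
      then show ?thesis using *(2) by (intro add_increasing) simp_all
    qed
  qed
  also have "\<dots> = (\<integral>\<^sup>+ x. ennreal (exp (- (1 - s) * x)) * indicator {0..} x \<partial>lborel)
      + (\<integral>\<^sup>+ x. ennreal (exp (- s * (- x))) * indicator {0..} (- x) \<partial>lborel)"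
    by (rule nn_integral_add) measurable
  also have "(\<integral>\<^sup>+ x. ennreal (exp (- s * (- x))) * indicator {0..} (- x) \<partial>lborel) =
      (\<integral>\<^sup>+ x. ennreal (exp (- s * x)) * indicator {0..} x \<partial>lborel)"
    using nn_integral_real_affine[of "\<lambda>x. ennreal (exp (- s * x)) * indicator {0..} x" "-1" 0] by simp
  finally show ?thesis
    using assms nn_integral_exp_half_line[of s] nn_integral_exp_half_line[of "1 - s"]
    by (auto simp: top_unique)
qed

lemma mellin_const_pos: "mellin_const s \<noteq> 0"
proof -
  \<comment> \<open>A lower bound of the integrand on \<open>{0..1}\<close>: the numerator is
    monotone in \<open>x\<close> and the denominator largest at 1.\<close>
  let ?c = "min 1 (exp s) / (1 + exp 1)"
  have "0 < ?c" by (auto intro!: divide_pos_pos add_pos_pos)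
  have "ennreal ?c = (\<integral>\<^sup>+ x. ennreal ?c * indicator {0..1::real} x \<partial>lborel)"
    by (subst nn_integral_cmult_indicator) auto
  also have "\<dots> \<le> mellin_const s"
    unfolding mellin_const_def
  proof (rule nn_integral_mono)
    fix x :: real
    have "?c \<le> exp (s * x) / (1 + exp x)" if "x \<in> {0..1}"
    proof (rule frac_le)
      show "min 1 (exp s) \<le> exp (s * x)"
        using that by (cases "0 \<le> s") (auto simp: min_le_iff_disj mult_le_cancel_left1 mult_nonneg_nonneg)
    qed (use that in \<open>auto intro: add_pos_pos\<close>)
    then show "ennreal ?c * indicator {0..1} x \<le> ennreal (exp (s * x) / (1 + exp x))"
      by (auto simp: indicator_def intro!: ennreal_leI)
  qed
  finally show ?thesis using \<open>0 < ?c\<close> by (auto simp: le_zero_eq ennreal_eq_0_iff)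
qed

text \<open>Peetre's K-functional of two weighted \<open>l\<^sup>2\<close>-norms generates the intermediate powers.\<close>

lemma powr_eq_mellin:
  assumes "0 < a" "0 < b"
  shows "ennreal (a powr s * b powr (1 - s)) * mellin_const s =
    (\<integral>\<^sup>+ x. ennreal (exp (s * x) * (a * b / (a + exp x * b))) \<partial>lborel)"
proof -
  \<comment> \<open>Translating the variable by \<open>t\<close> turns \<open>a + exp x * b\<close>
    into \<open>a * (1 + exp x)\<close>, which separates \<open>a\<close> and \<open>b\<close> from
    the integral.\<close>
  define t where "t = ln a - ln b"
  have et: "exp t = a / b" using assms by (simp add: t_def exp_diff)
  have "(\<integral>\<^sup>+ x. ennreal (exp (s * x) * (a * b / (a + exp x * b))) \<partial>lborel) =
    (\<integral>\<^sup>+ x. ennreal (exp (s * (t + x)) * (a * b / (a + exp (t + x) * b))) \<partial>lborel)"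
    using nn_integral_real_affine[of "\<lambda>x. ennreal (exp (s * x) * (a * b / (a + exp x * b)))" 1 t] by simp
  also have "\<dots> = (\<integral>\<^sup>+ x. ennreal (a powr s * b powr (1 - s)) * ennreal (exp (s * x) / (1 + exp x)) \<partial>lborel)"
  proof (rule nn_integral_cong)
    fix x :: real
    have "a * b / (a + exp (t + x) * b) = b / (1 + exp x)"
    proof -
      have "a + exp (t + x) * b = a * (1 + exp x)" using assms by (simp add: exp_add et algebra_simps)
      then show ?thesis using assms by simp
    qed
    moreover have "exp (s * (t + x)) * b = a powr s * b powr (1 - s) * exp (s * x)"
    proof -
      have "exp (s * (t + x)) * b = exp (s * ln a - s * ln b + s * x) * exp (ln b)"
        using assms by (simp add: t_def algebra_simps)
      also have "\<dots> = exp (s * ln a) * exp ((1 - s) * ln b) * exp (s * x)"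
        by (simp add: algebra_simps flip: exp_add)
      finally show ?thesis using assms by (simp add: powr_def)
    qed
    ultimately show "ennreal (exp (s * (t + x)) * (a * b / (a + exp (t + x) * b))) =
        ennreal (a powr s * b powr (1 - s)) * ennreal (exp (s * x) / (1 + exp x))"
      by (subst ennreal_mult[symmetric]) (auto simp: add_pos_pos less_imp_le)
  qed
  also have "\<dots> = ennreal (a powr s * b powr (1 - s)) * mellin_const s"
    unfolding mellin_const_def by (rule nn_integral_cmult) measurable
  finally show ?thesis ..
qed

section \<open>Weighted norms and the K-functional in an eigenbasis\<close>

lemma inner_conj_unitary:
  fixes A B :: "'n::finite op"
  assumes "unitary_op U" "unitary_op V" shows "(adj U ** A ** V) \<bullet> (adj U ** B ** V) = A \<bullet> B"
  using assms by (simp only: inner_mm_right[of _ V] unitary_op_cancel(3)[of V] inner_mm_left[of "adj U"]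
        adj_adj unitary_op_cancel(2))

lemma inner_schur: "X \<bullet> schur c X = (\<Sum>i\<in>UNIV. \<Sum>j\<in>UNIV. c i j * (cmod (X $ i $ j))\<^sup>2)"
  unfolding inner_vec_def
  by (intro sum.cong refl) (simp add: schur_def inner_complex_def cmod_power2, simp add: power2_eq_square algebra_simps)

lemma mm_dg_schur:
  "dg a ** X ** dg b = schur (\<lambda>i j. a i * b j) X"
  "dg a ** X = schur (\<lambda>i j. a i) X"
  "X ** dg b = schur (\<lambda>i j. b j) X"
  by (simp_all add: vec_eq_iff mm_dg_left mm_dg_right schur_def)

lemma conj_dg_sandwich:
  assumes U: "unitary_op U"
  shows "U ** dg a ** adj U ** C ** (U ** dg b ** adj U) = U ** schur (\<lambda>i j. a i * b j) (adj U ** C ** U) ** adj U"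
  by (simp add: matrix_mul_assoc flip: mm_dg_schur)

lemma inner_conj_schur:
  fixes C :: "'n::finite op"
  assumes U: "unitary_op U"
  shows "C \<bullet> (U ** schur c (adj U ** C ** U) ** adj U) =
    (\<Sum>i\<in>UNIV. \<Sum>j\<in>UNIV. c i j * (cmod ((adj U ** C ** U) $ i $ j))\<^sup>2)"
proof -
  have "C \<bullet> (U ** schur c (adj U ** C ** U) ** adj U) =
      (adj U ** C ** U) \<bullet> (adj U ** (U ** schur c (adj U ** C ** U) ** adj U) ** U)"
    by (simp only: inner_conj_unitary[OF U U])
  also have "adj U ** (U ** schur c (adj U ** C ** U) ** adj U) ** U = schur c (adj U ** C ** U)"
    using U by (simp add: unitary_op_cancel flip: matrix_mul_assoc) (simp add: unitary_op_def)
  finally show ?thesis by (simp add: inner_schur)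
qed

text \<open>A squared norm interpolating between the weight \<open>\<rho>\<close> on the right
  (\<open>s = 0\<close>) and on the left (\<open>s = 1\<close>), for positive definite
  \<open>\<rho>\<close>.\<close>

definition wnorm :: "('n::finite op) \<Rightarrow> real \<Rightarrow> 'n op \<Rightarrow> real" where
  "wnorm \<rho> s C = C \<bullet> (mfun (\<lambda>x. x powr s) \<rho> ** C ** mfun (\<lambda>x. x powr (1 - s)) \<rho>)"

lemma wnorm_spectral:
  assumes U: "unitary_op U" "\<rho> = U ** dg d ** adj U"
  shows "wnorm \<rho> s C = (\<Sum>i\<in>UNIV. \<Sum>j\<in>UNIV. d i powr s * d j powr (1 - s) * (cmod ((adj U ** C ** U) $ i $ j))\<^sup>2)"
  unfolding wnorm_def mfun_spectral[OF U] conj_dg_sandwich[OF U(1)] inner_conj_schur[OF U(1)] ..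

lemma inner_weight_spectral:
  fixes C :: "'n::finite op"
  assumes U: "unitary_op U" "\<rho> = U ** dg d ** adj U"
  shows "C \<bullet> (\<rho> ** C) = (\<Sum>i\<in>UNIV. \<Sum>j\<in>UNIV. d i * (cmod ((adj U ** C ** U) $ i $ j))\<^sup>2)"
    and "C \<bullet> (C ** \<rho>) = (\<Sum>i\<in>UNIV. \<Sum>j\<in>UNIV. d j * (cmod ((adj U ** C ** U) $ i $ j))\<^sup>2)"
proof -
  have one: "mat 1 = U ** dg (\<lambda>_. 1) ** adj U"
  proof -
    have "dg (\<lambda>_. 1) = (mat 1 :: 'n op)" by (simp add: dg_def mat_def vec_eq_iff)
    then show ?thesis using U by (simp add: unitary_op_def)
  qed
  have "\<rho> ** C = \<rho> ** C ** mat 1" by simp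
  also have "\<dots> = U ** schur (\<lambda>i j. d i * 1) (adj U ** C ** U) ** adj U"
    unfolding one U(2) conj_dg_sandwich[OF U(1)] ..
  finally show "C \<bullet> (\<rho> ** C) = (\<Sum>i\<in>UNIV. \<Sum>j\<in>UNIV. d i * (cmod ((adj U ** C ** U) $ i $ j))\<^sup>2)"
    by (simp add: inner_conj_schur[OF U(1)])
  have "C ** \<rho> = mat 1 ** C ** \<rho>" by simp
  also have "\<dots> = U ** schur (\<lambda>i j. 1 * d j) (adj U ** C ** U) ** adj U"
    unfolding one U(2) conj_dg_sandwich[OF U(1)] ..
  finally show "C \<bullet> (C ** \<rho>) = (\<Sum>i\<in>UNIV. \<Sum>j\<in>UNIV. d j * (cmod ((adj U ** C ** U) $ i $ j))\<^sup>2)"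
    by (simp add: inner_conj_schur[OF U(1)])
qed

text \<open>For positive \<open>d\<close> and \<open>l\<close>, \<open>l * kfun U d l C\<close> is
  the infimum of \<open>l * (C1 \<bullet> (C1 ** \<rho>)) + C2 \<bullet> (\<rho> ** C2)\<close> over
  all splittings \<open>C = C1 + C2\<close>, computed entrywise in the eigenbasis of
  \<open>\<rho>\<close>.\<close>

definition kfun :: "('n::finite op) \<Rightarrow> ('n \<Rightarrow> real) \<Rightarrow> real \<Rightarrow> 'n op \<Rightarrow> real" where
  "kfun U d l C = (\<Sum>i\<in>UNIV. \<Sum>j\<in>UNIV. d i * d j / (d i + l * d j) * (cmod ((adj U ** C ** U) $ i $ j))\<^sup>2)"

text \<open>For fixed \<open>x + y\<close> the right side is smallest when the two weights act in
  parallel. With moduli \<open>u\<close>, \<open>v\<close> of \<open>x\<close>, \<open>y\<close> and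
  denominators cleared, the gap is the square of \<open>l * b * u - a * v\<close>.\<close>

lemma parallel_sum_le:
  fixes a b l :: real
  assumes "0 < a" "0 < b" "0 < l"
  shows "l * (a * b / (a + l * b)) * (cmod (x + y))\<^sup>2 \<le> l * (b * (cmod x)\<^sup>2) + a * (cmod y)\<^sup>2"
proof -
  define u v where "u = cmod x" and "v = cmod y"
  have p: "0 < a + l * b" using assms by (simp add: add_pos_pos)
  have "l * (a * b) * (u + v)\<^sup>2 + (l * b * u - a * v)\<^sup>2 = (l * (b * u\<^sup>2) + a * v\<^sup>2) * (a + l * b)"
    by (simp add: power2_eq_square algebra_simps)
  then have "l * (a * b) * (u + v)\<^sup>2 \<le> (l * (b * u\<^sup>2) + a * v\<^sup>2) * (a + l * b)"
    by (smt (verit) zero_le_power2)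
  then have *: "l * (a * b / (a + l * b)) * (u + v)\<^sup>2 \<le> l * (b * u\<^sup>2) + a * v\<^sup>2"
    using p by (simp add: pos_divide_le_eq)
  have "(cmod (x + y))\<^sup>2 \<le> (u + v)\<^sup>2" unfolding u_def v_def by (intro power_mono norm_triangle_ineq) auto
  then have "l * (a * b / (a + l * b)) * (cmod (x + y))\<^sup>2 \<le> l * (a * b / (a + l * b)) * (u + v)\<^sup>2"
    using assms p by (intro mult_left_mono) auto
  with * show ?thesis by (simp add: u_def v_def)
qed

text \<open>\<open>powr_eq_mellin\<close> entry by entry. Nonnegative extended integrals allow sums
  and integrals to be exchanged without integrability conditions.\<close>

lemma wnorm_mellin:
  assumes U: "unitary_op U" "\<rho> = U ** dg p ** adj U" "\<And>i. 0 < p i"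
  shows "ennreal (wnorm \<rho> s C) * mellin_const s = (\<integral>\<^sup>+ x. ennreal (exp (s * x) * kfun U p (exp x) C) \<partial>lborel)"
proof -
  define c where "c i j = (cmod ((adj U ** C ** U) $ i $ j))\<^sup>2" for i j
  define f where "f i j x = exp (s * x) * (p i * p j / (p i + exp x * p j))" for i j x
  have pos: "0 \<le> f i j x" "0 \<le> c i j" for i j x using U(3) by (simp_all add: f_def c_def less_imp_le add_pos_pos)
  have [measurable]: "f i j \<in> borel_measurable borel" for i j unfolding f_def[abs_def] by measurable
  have e: "exp (s * x) * kfun U p (exp x) C = (\<Sum>i\<in>UNIV. \<Sum>j\<in>UNIV. c i j * f i j x)" for x
    by (simp add: kfun_def sum_distrib_left c_def f_def mult_ac)
  have "(\<integral>\<^sup>+ x. ennreal (exp (s * x) * kfun U p (exp x) C) \<partial>lborel) =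
      (\<integral>\<^sup>+ x. (\<Sum>i\<in>UNIV. \<Sum>j\<in>UNIV. ennreal (c i j) * ennreal (f i j x)) \<partial>lborel)"
    using pos by (simp add: e sum_nonneg ennreal_mult[symmetric] sum_ennreal)
  also have "\<dots> = (\<Sum>i\<in>UNIV. \<Sum>j\<in>UNIV. ennreal (c i j) * (\<integral>\<^sup>+ x. ennreal (f i j x) \<partial>lborel))"
    by (simp add: nn_integral_sum nn_integral_cmult)
  also have "\<dots> = (\<Sum>i\<in>UNIV. \<Sum>j\<in>UNIV. ennreal (c i j * (p i powr s * p j powr (1 - s))) * mellin_const s)"
  proof -
    have "(\<integral>\<^sup>+ x. ennreal (f i j x) \<partial>lborel) = ennreal (p i powr s * p j powr (1 - s)) * mellin_const s" for i j
      unfolding f_def by (rule powr_eq_mellin[OF U(3) U(3), symmetric])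
    then show ?thesis using pos by (simp only: ennreal_mult powr_ge_zero mult_nonneg_nonneg mult.assoc)
  qed
  also have "\<dots> = (\<Sum>i\<in>UNIV. \<Sum>j\<in>UNIV. ennreal (c i j * (p i powr s * p j powr (1 - s)))) * mellin_const s"
    by (simp only: sum_distrib_right)
  also have "(\<Sum>i\<in>UNIV. \<Sum>j\<in>UNIV. ennreal (c i j * (p i powr s * p j powr (1 - s)))) = ennreal (wnorm \<rho> s C)"
    using pos by (simp add: wnorm_spectral[OF U(1,2)] sum_ennreal sum_nonneg c_def mult_ac)
  finally show ?thesis ..
qed

text \<open>Contraction at the two ends of the interpolation scale: \<open>q0\<close> has the
  weights on the right, \<open>q1\<close> on the left. The weight may change from
  \<open>\<rho>'\<close> to \<open>\<rho>\<close>, but the factor \<open>\<kappa>\<close> is common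
  to both ends.\<close>

locale weighted_contraction =
  fixes T :: "'n::finite op \<Rightarrow> 'n op" and \<rho> \<rho>' :: "'n op" and \<kappa> :: real
  assumes T: "linear T" and \<kappa>: "0 \<le> \<kappa>" and pd: "posdef \<rho>" "posdef \<rho>'"
    and q0: "\<And>C. T C \<bullet> (T C ** \<rho>) \<le> \<kappa> * (C \<bullet> (C ** \<rho>'))"
    and q1: "\<And>C. T C \<bullet> (\<rho> ** T C) \<le> \<kappa> * (C \<bullet> (\<rho>' ** C))"
begin

text \<open>\<open>T\<close> maps the optimal splitting of \<open>C\<close> for
  \<open>\<rho>'\<close> to some splitting of \<open>T C\<close>, and every splitting bounds the
  K-functional of \<open>\<rho>\<close> from above.\<close>

lemma kfun_contraction:
  assumes U: "unitary_op U" "\<rho> = U ** dg p ** adj U" "\<And>i. 0 < p i"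
    and U': "unitary_op U'" "\<rho>' = U' ** dg p' ** adj U'" "\<And>i. 0 < p' i" and l: "0 < l"
  shows "kfun U p l (T C) \<le> \<kappa> * kfun U' p' l C"
proof -
  define M where "M = adj U' ** C ** U'"
  \<comment> \<open>The entrywise minimisers of \<open>l * b * x\<^sup>2 + a * y\<^sup>2\<close>
    with \<open>x + y\<close> fixed, for \<open>a = p' i\<close> and
    \<open>b = p' j\<close>.\<close>
  define C1 where "C1 = U' ** schur (\<lambda>i j. p' i / (p' i + l * p' j)) M ** adj U'"
  define C2 where "C2 = U' ** schur (\<lambda>i j. l * p' j / (p' i + l * p' j)) M ** adj U'"
  have pp: "0 < p' i + l * p' j" for i j using U'(3) l by (simp add: add_pos_pos)
  have "schur (\<lambda>i j. p' i / (p' i + l * p' j)) M + schur (\<lambda>i j. l * p' j / (p' i + l * p' j)) M = M"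
  proof -
    have "p' i / (p' i + l * p' j) + l * p' j / (p' i + l * p' j) = 1" for i j
      using pp[of i j] by (simp add: add_divide_distrib[symmetric])
    then show ?thesis
      by (simp only: schur_def vec_eq_iff vector_add_component vec_lambda_beta
          distrib_right[symmetric] of_real_add[symmetric]) simp
  qed
  then have "C1 + C2 = U' ** M ** adj U'" by (simp add: C1_def C2_def flip: mm_add_left mm_add_right)
  also have "\<dots> = C" using U'(1) by (simp add: M_def unitary_op_cancel matrix_mul_assoc)
      (simp add: unitary_op_def)
  finally have C12: "C = C1 + C2" ..
  have M1: "adj U' ** C1 ** U' = schur (\<lambda>i j. p' i / (p' i + l * p' j)) M"
    and M2: "adj U' ** C2 ** U' = schur (\<lambda>i j. l * p' j / (p' i + l * p' j)) M"
    using U'(1) by (simp_all add: C1_def C2_def unitary_op_cancel flip: matrix_mul_assoc)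
      (simp_all add: unitary_op_def)
  have "l * kfun U p l (T C) \<le> (\<Sum>i\<in>UNIV. \<Sum>j\<in>UNIV. l * (p j * (cmod ((adj U ** T C1 ** U) $ i $ j))\<^sup>2)
      + p i * (cmod ((adj U ** T C2 ** U) $ i $ j))\<^sup>2)"
    unfolding kfun_def sum_distrib_left
  proof (intro sum_mono)
    fix i j
    have "(adj U ** T C ** U) $ i $ j = (adj U ** T C1 ** U) $ i $ j + (adj U ** T C2 ** U) $ i $ j"
      unfolding C12 linear_add[OF T] by (simp add: mm_distribs)
    then show "l * (p i * p j / (p i + l * p j) * (cmod ((adj U ** T C ** U) $ i $ j))\<^sup>2)
      \<le> l * (p j * (cmod ((adj U ** T C1 ** U) $ i $ j))\<^sup>2) + p i * (cmod ((adj U ** T C2 ** U) $ i $ j))\<^sup>2"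
      using parallel_sum_le[OF U(3) U(3) l] by (simp add: mult.assoc)
  qed
  also have "\<dots> = l * (T C1 \<bullet> (T C1 ** \<rho>)) + T C2 \<bullet> (\<rho> ** T C2)"
    by (simp add: inner_weight_spectral[OF U(1,2)] sum.distrib sum_distrib_left)
  also have "\<dots> \<le> l * (\<kappa> * (C1 \<bullet> (C1 ** \<rho>'))) + \<kappa> * (C2 \<bullet> (\<rho>' ** C2))"
    using l by (intro add_mono mult_left_mono q0 q1) auto
  also have "\<dots> = \<kappa> * (l * (C1 \<bullet> (C1 ** \<rho>')) + C2 \<bullet> (\<rho>' ** C2))" by (simp add: algebra_simps)
  also have "l * (C1 \<bullet> (C1 ** \<rho>')) + C2 \<bullet> (\<rho>' ** C2) = l * kfun U' p' l C"
    unfolding inner_weight_spectral[OF U'(1,2)] kfun_def sum_distrib_left M1 M2 M_def[symmetric]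
      sum.distrib[symmetric]
  proof (intro sum.cong refl)
    fix i j
    define a b n where "a = p' i" and "b = p' j" and "n = cmod (M $ i $ j)"
    have "0 < a" "0 < b" using U'(3) by (auto simp: a_def b_def)
    then have ab: "a + l * b \<noteq> 0" using l by (metis add_pos_pos less_irrefl mult_pos_pos)
    have "l * (b * (a / (a + l * b) * n)\<^sup>2) + a * (l * b / (a + l * b) * n)\<^sup>2 =
        l * (a * b * (a + l * b) / (a + l * b)\<^sup>2 * n\<^sup>2)"
      by (simp add: power_mult_distrib power_divide add_divide_distrib[symmetric] power2_eq_square algebra_simps)
    also have "\<dots> = l * (a * b / (a + l * b) * n\<^sup>2)"
      using ab by (simp add: power2_eq_square)
    finally have "l * (b * (a / (a + l * b) * n)\<^sup>2) + a * (l * b / (a + l * b) * n)\<^sup>2 = l * (a * b / (a + l * b) * n\<^sup>2)" .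
    moreover have "cmod (schur (\<lambda>i j. p' i / (p' i + l * p' j)) M $ i $ j) = a / (a + l * b) * n"
      "cmod (schur (\<lambda>i j. l * p' j / (p' i + l * p' j)) M $ i $ j) = l * b / (a + l * b) * n"
      using pp[of i j] \<open>0 < a\<close> \<open>0 < b\<close> l
      by (simp_all add: schur_def norm_mult norm_divide a_def b_def n_def flip: of_real_mult of_real_add)
    ultimately show "l * (p' j * (cmod (schur (\<lambda>i j. p' i / (p' i + l * p' j)) M $ i $ j))\<^sup>2) +
           p' i * (cmod (schur (\<lambda>i j. l * p' j / (p' i + l * p' j)) M $ i $ j))\<^sup>2 =
           l * (p' i * p' j / (p' i + l * p' j) * (cmod (M $ i $ j))\<^sup>2)"
      by (simp add: a_def b_def n_def)
  qed
  finally have "l * kfun U p l (T C) \<le> l * (\<kappa> * kfun U' p' l C)" by (simp add: algebra_simps)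
  then show ?thesis using l by simp
qed

lemma wnorm_contraction:
  assumes s: "0 \<le> s" "s \<le> 1"
  shows "wnorm \<rho> s (T C) \<le> \<kappa> * wnorm \<rho>' s C"
proof -
  obtain U p where U: "unitary_op U" "\<rho> = U ** dg p ** adj U" "\<And>i. 0 < p i"
    using posdef_spectral[OF pd(1)] by blast
  obtain U' p' where U': "unitary_op U'" "\<rho>' = U' ** dg p' ** adj U'" "\<And>i. 0 < p' i"
    using posdef_spectral[OF pd(2)] by blast
  \<comment> \<open>The Mellin integral diverges at both end points, where \<open>q0\<close> and
    \<open>q1\<close> apply directly.\<close>
  consider "s = 0" | "s = 1" | "0 < s" "s < 1" using s by linarith
  then show ?thesis
  proof cases
    case 1
    have "wnorm \<rho> s (T C) = T C \<bullet> (T C ** \<rho>)" "wnorm \<rho>' s C = C \<bullet> (C ** \<rho>')"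
      unfolding wnorm_spectral[OF U(1,2)] wnorm_spectral[OF U'(1,2)] inner_weight_spectral[OF U(1,2)]
        inner_weight_spectral[OF U'(1,2)] using U(3) U'(3) by (simp_all add: 1 less_imp_neq[symmetric] less_imp_le)
    with q0 show ?thesis by simp
  next
    case 2
    have "wnorm \<rho> s (T C) = T C \<bullet> (\<rho> ** T C)" "wnorm \<rho>' s C = C \<bullet> (\<rho>' ** C)"
      unfolding wnorm_spectral[OF U(1,2)] wnorm_spectral[OF U'(1,2)] inner_weight_spectral[OF U(1,2)]
        inner_weight_spectral[OF U'(1,2)] using U(3) U'(3) by (simp_all add: 2 less_imp_neq[symmetric] less_imp_le)
    with q1 show ?thesis by simp
  next
    case 3
    have kpos: "0 \<le> kfun U' p' (exp x) C" for x
      unfolding kfun_def using U'(3) by (intro sum_nonneg mult_nonneg_nonneg divide_nonneg_pos) (auto simp: less_imp_le add_pos_pos)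
    have w0: "0 \<le> wnorm \<rho>' s C"
      unfolding wnorm_spectral[OF U'(1,2)] by (intro sum_nonneg) simp
    have "mellin_const s * ennreal (wnorm \<rho> s (T C)) = (\<integral>\<^sup>+ x. ennreal (exp (s * x) * kfun U p (exp x) (T C)) \<partial>lborel)"
      by (simp add: wnorm_mellin[OF U, symmetric] mult.commute[of "mellin_const s"])
    also have "\<dots> \<le> (\<integral>\<^sup>+ x. ennreal \<kappa> * ennreal (exp (s * x) * kfun U' p' (exp x) C) \<partial>lborel)"
    proof (rule nn_integral_mono)
      fix x :: real
      have "exp (s * x) * kfun U p (exp x) (T C) \<le> exp (s * x) * (\<kappa> * kfun U' p' (exp x) C)"
        by (intro mult_left_mono kfun_contraction U U') auto
      then show "ennreal (exp (s * x) * kfun U p (exp x) (T C)) \<le> ennreal \<kappa> * ennreal (exp (s * x) * kfun U' p' (exp x) C)"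
        using \<kappa> kpos by (subst ennreal_mult[symmetric]) (auto intro!: ennreal_leI simp: mult_ac)
    qed
    also have "\<dots> = ennreal \<kappa> * (\<integral>\<^sup>+ x. ennreal (exp (s * x) * kfun U' p' (exp x) C) \<partial>lborel)"
      unfolding kfun_def by (rule nn_integral_cmult) measurable
    also have "\<dots> = mellin_const s * ennreal (\<kappa> * wnorm \<rho>' s C)"
      unfolding wnorm_mellin[OF U', symmetric] ennreal_mult[OF \<kappa> w0] by (simp only: mult_ac)
    finally have "ennreal (wnorm \<rho> s (T C)) \<le> ennreal (\<kappa> * wnorm \<rho>' s C)"
      using mellin_const_finite[OF 3] mellin_const_pos by (simp add: ennreal_mult_le_mult_iff)
    then show ?thesis using \<kappa> w0 by (simp add: ennreal_le_iff)
  qed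
qed

end

section \<open>The twisted multiplication operators\<close>

text \<open>For positive \<open>x\<close> and \<open>y\<close> this is the logarithmic mean of
  \<open>exp (w / 2) * x\<close> and \<open>exp (- w / 2) * y\<close>. The integral form covers the
  case of equal arguments.\<close>

definition tw :: "real \<Rightarrow> real \<Rightarrow> real \<Rightarrow> real" where
  "tw w x y = integral {0..1} (\<lambda>s. exp (w * (s - 1 / 2)) * (x powr s * y powr (1 - s)))"

lemma tw_has_integral:
  assumes "0 < x" "0 < y"
  shows "((\<lambda>s. exp (w * (s - 1 / 2)) * (x powr s * y powr (1 - s))) has_integral tw w x y) {0..1}"
  unfolding tw_def using assms
  by (intro integrable_integral integrable_continuous_real continuous_intros) auto

lemma tw_pos:
  assumes "0 < x" "0 < y" shows "0 < tw w x y"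
proof -
  have c: "continuous_on (cbox 0 1) (\<lambda>s. exp (w * (s - 1 / 2)) * (x powr s * y powr (1 - s)))"
    using assms by (intro continuous_intros) auto
  have "0 \<le> tw w x y" unfolding tw_def
    by (rule integral_nonneg[OF has_integral_integrable[OF tw_has_integral[OF assms]]]) simp
  moreover have "tw w x y \<noteq> 0"
    using has_integral_0_cbox_imp_0[OF c, of 0] tw_has_integral[OF assms, of w] assms
    by auto
  ultimately show ?thesis by simp
qed

lemma tw_mult:
  assumes "0 < x" "0 < y"
  shows "tw w x y * (ln y - ln x - w) = exp (- w / 2) * y - exp (w / 2) * x"
proof -
  let ?F = "\<lambda>s. exp (w * (s - 1 / 2)) * (x powr s * y powr (1 - s))"
  let ?f = "\<lambda>s. ?F s * (ln x - ln y + w)"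
  have "(?f has_integral ?F 1 - ?F 0) {0..1}"
  proof (rule fundamental_theorem_of_calculus)
    fix s :: real
    show "(?F has_vector_derivative ?f s) (at s within {0..1})"
      unfolding has_real_derivative_iff_has_vector_derivative[symmetric] powr_def using assms
      by (auto intro!: derivative_eq_intros simp: algebra_simps)
  qed simp
  moreover have "(?f has_integral tw w x y * (ln x - ln y + w)) {0..1}"
    by (intro has_integral_mult_left tw_has_integral assms)
  ultimately have "tw w x y * (ln x - ln y + w) = ?F 1 - ?F 0" by (rule has_integral_unique[symmetric])
  then show ?thesis using assms by (simp add: algebra_simps)
qed

lemma tw_swap:
  assumes "0 < x" "0 < y" shows "tw (- w) y x = tw w x y"
proof -
  have "((\<lambda>s. exp (w * (1 - s - 1 / 2)) * (x powr (1 - s) * y powr (1 - (1 - s)))) has_integral tw w x y) {0..1}"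
    using has_integral_affinity01[where f = "\<lambda>s. exp (w * (s - 1 / 2)) * (x powr s * y powr (1 - s))"
        and i = "tw w x y" and m = "-1" and c = 1] tw_has_integral[OF assms, of w]
    by (simp add: algebra_simps image_diff_atLeastAtMost[of 1, simplified])
  moreover have "(\<lambda>s. exp (w * (1 - s - 1 / 2)) * (x powr (1 - s) * y powr (1 - (1 - s)))) =
      (\<lambda>s. exp (- w * (s - 1 / 2)) * (y powr s * x powr (1 - s)))"
    by (simp add: algebra_simps)
  ultimately show ?thesis
    using tw_has_integral[OF assms(2,1), of "- w"] by (metis has_integral_unique)
qed

lemma has_integral_schur:
  assumes "\<And>i j. ((\<lambda>s. c s i j) has_integral d i j) S"
  shows "((\<lambda>s. schur (c s) M) has_integral schur d M) S"
proof -
  let ?E = "\<lambda>i j. \<chi> k l. if k = i \<and> l = j then M $ i $ j else 0"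
  have *: "schur e M = (\<Sum>i\<in>UNIV. \<Sum>j\<in>UNIV. e i j *\<^sub>R ?E i j)" for e
  proof -
    have "(\<Sum>i\<in>UNIV. \<Sum>j\<in>UNIV. e i j *\<^sub>R (if k = i \<and> l = j then M $ i $ j else 0)) =
      (\<Sum>i\<in>UNIV. if i = k then e k l *\<^sub>R M $ k $ l else 0)" for k l
      by (rule sum.cong) (auto simp: if_distrib[of "\<lambda>x. _ *\<^sub>R x"] cong: if_cong)
    then show ?thesis by (simp add: vec_eq_iff schur_def scaleR_complex)
  qed
  show ?thesis unfolding * by (intro has_integral_sum has_integral_scaleR_left assms) auto
qed

lemma has_integral_mm_sandwich:
  fixes f :: "real \<Rightarrow> 'n::finite op"
  assumes "(f has_integral I) S" shows "((\<lambda>s. (U::'n op) ** f s ** (V::'n op)) has_integral U ** I ** V) S"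
proof -
  have "linear (\<lambda>X. U ** X ** V)"
    using linear_compose[OF linear_mm_left linear_mm_right] by (simp add: o_def)
  then show ?thesis
    using has_integral_linear[OF assms, of "\<lambda>X. U ** X ** V"] by (simp add: o_def linear_conv_bounded_linear)
qed

lemma twisted_mult_integrand:
  assumes U: "unitary_op U" "\<rho> = U ** dg d ** adj U"
  shows "exp (w * (s - 1 / 2)) *\<^sub>R (mfun (\<lambda>x. x powr s) \<rho> ** A ** mfun (\<lambda>x. x powr (1 - s)) \<rho>) =
    U ** schur (\<lambda>i j. exp (w * (s - 1 / 2)) * (d i powr s * d j powr (1 - s))) (adj U ** A ** U) ** adj U"
proof -
  have "schur (\<lambda>i j. c * e i j) X = c *\<^sub>R schur e X" for c e and X :: "'a op"
    by (simp add: vec_eq_iff schur_def scaleR_complex)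
  then show ?thesis
    by (simp add: mfun_spectral[OF U] conj_dg_sandwich[OF U(1)] mm_distribs)
qed

lemma twisted_mult_has_integral:
  assumes U: "unitary_op U" "\<rho> = U ** dg d ** adj U" "\<And>i. 0 < d i"
  shows "((\<lambda>s. exp (w * (s - 1 / 2)) *\<^sub>R (mfun (\<lambda>x. x powr s) \<rho> ** A ** mfun (\<lambda>x. x powr (1 - s)) \<rho>))
    has_integral (U ** schur (\<lambda>i j. tw w (d i) (d j)) (adj U ** A ** U) ** adj U)) {0..1}"
  unfolding twisted_mult_integrand[OF U(1,2)]
  by (intro has_integral_mm_sandwich has_integral_schur tw_has_integral U)

lemma twisted_mult_spectral:
  assumes U: "unitary_op U" "\<rho> = U ** dg d ** adj U" "\<And>i. 0 < d i"
  shows "twisted_mult \<rho> w A = U ** schur (\<lambda>i j. tw w (d i) (d j)) (adj U ** A ** U) ** adj U"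
  unfolding twisted_mult_def by (rule integral_unique[OF twisted_mult_has_integral[OF U]])

lemma linear_twisted_mult:
  assumes "posdef \<rho>" shows "linear (twisted_mult \<rho> w)"
proof -
  obtain U p where U: "unitary_op U" "\<rho> = U ** dg p ** adj U" "\<And>i. 0 < p i"
    using posdef_spectral[OF assms] by blast
  show ?thesis
    unfolding twisted_mult_spectral[OF U, abs_def]
    using linear_compose[OF linear_compose[OF linear_compose[OF linear_mm_left linear_mm_right] linear_schur]
          linear_compose[OF linear_mm_left linear_mm_right]]
    by (simp add: o_def)
qed

lemma adj_schur: "adj (schur c X) = schur (\<lambda>i j. c j i) (adj X)"
  by (simp add: vec_eq_iff adj_nth schur_def)

text \<open>The substitution \<open>s \<mapsto> 1 - s\<close> reverses the twist. This matches the
  pairing of a jump operator with its adjoint, of opposite frequency.\<close>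

lemma adj_twisted_mult:
  assumes "posdef \<rho>" shows "adj (twisted_mult \<rho> w A) = twisted_mult \<rho> (- w) (adj A)"
proof -
  obtain U p where U: "unitary_op U" "\<rho> = U ** dg p ** adj U" "\<And>i. 0 < p i"
    using posdef_spectral[OF assms] by blast
  show ?thesis
    using tw_swap[OF U(3) U(3)]
    by (simp add: twisted_mult_spectral[OF U] adj_mm adj_schur matrix_mul_assoc)
qed

lemma inner_twisted_mult_sym:
  fixes A B :: "'n::finite op"
  assumes "posdef \<rho>" shows "A \<bullet> twisted_mult \<rho> w B = twisted_mult \<rho> w A \<bullet> B"
proof -
  obtain U p where U: "unitary_op U" "\<rho> = U ** dg p ** adj U" "\<And>i. 0 < p i"
    using posdef_spectral[OF assms] by blast
  have *: "X \<bullet> schur c Y = schur c X \<bullet> Y" for X Y :: "'n op" and c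
    by (simp add: inner_vec_def schur_def inner_complex_def algebra_simps)
  have **: "adj U ** twisted_mult \<rho> w A ** U = schur (\<lambda>i j. tw w (p i) (p j)) (adj U ** A ** U)" for A
    using U(1) by (simp add: twisted_mult_spectral[OF U] unitary_op_cancel flip: matrix_mul_assoc)
      (simp add: unitary_op_def)
  have "A \<bullet> twisted_mult \<rho> w B = (adj U ** A ** U) \<bullet> (adj U ** twisted_mult \<rho> w B ** U)"
    by (simp only: inner_conj_unitary[OF U(1) U(1)])
  also have "\<dots> = (adj U ** twisted_mult \<rho> w A ** U) \<bullet> (adj U ** B ** U)"
    by (simp only: ** *)
  finally show ?thesis by (simp only: inner_conj_unitary[OF U(1) U(1)])
qed

lemma inner_twisted_mult_pos:
  fixes A :: "'n::finite op"
  assumes "posdef \<rho>" shows "0 \<le> A \<bullet> twisted_mult \<rho> w A" "A \<bullet> twisted_mult \<rho> w A = 0 \<Longrightarrow> A = 0"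
proof -
  obtain U p where U: "unitary_op U" "\<rho> = U ** dg p ** adj U" "\<And>i. 0 < p i"
    using posdef_spectral[OF assms] by blast
  let ?M = "adj U ** A ** U"
  have eq: "A \<bullet> twisted_mult \<rho> w A = (\<Sum>i\<in>UNIV. \<Sum>j\<in>UNIV. tw w (p i) (p j) * (cmod (?M $ i $ j))\<^sup>2)"
    by (simp add: twisted_mult_spectral[OF U] inner_conj_schur[OF U(1)])
  have pos: "0 \<le> tw w (p i) (p j) * (cmod (?M $ i $ j))\<^sup>2" for i j
    using tw_pos[OF U(3) U(3)] by (simp add: less_imp_le)
  show "0 \<le> A \<bullet> twisted_mult \<rho> w A" unfolding eq by (intro sum_nonneg pos)
  assume "A \<bullet> twisted_mult \<rho> w A = 0"
  then have "\<forall>i j. tw w (p i) (p j) * (cmod (?M $ i $ j))\<^sup>2 = 0"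
    unfolding eq by (simp add: sum_nonneg_eq_0_iff pos sum_nonneg del: mult_eq_0_iff)
  then have "?M = 0" using tw_pos[OF U(3) U(3)] by (simp add: vec_eq_iff) (metis less_irrefl)
  then have "norm ?M = 0" by simp
  then show "A = 0" by (simp add: norm_unitary_op U)
qed

text \<open>The contraction of \<open>wnorm\<close> is integrated over \<open>s\<close> against the
  positive weight \<open>exp (w * (s - 1 / 2))\<close>.\<close>

lemma (in weighted_contraction) twisted_mult_contraction:
  "T C \<bullet> twisted_mult \<rho> w (T C) \<le> \<kappa> * (C \<bullet> twisted_mult \<rho>' w C)"
proof -
  have *: "((\<lambda>s. exp (w * (s - 1 / 2)) * wnorm \<rho> s C) has_integral (C \<bullet> twisted_mult \<rho> w C)) {0..1}"
    if p: "posdef \<rho>" for \<rho> C :: "'n op"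
  proof -
    obtain U p where U: "unitary_op U" "\<rho> = U ** dg p ** adj U" "\<And>i. 0 < p i"
      using posdef_spectral[OF p] by blast
    show ?thesis
      using has_integral_linear[OF twisted_mult_has_integral[OF U, of w C] bounded_linear_inner_right[of C]]
      by (simp add: o_def twisted_mult_spectral[OF U] wnorm_def)
  qed
  have "((\<lambda>s. \<kappa> * (exp (w * (s - 1 / 2)) * wnorm \<rho>' s C)) has_integral \<kappa> * (C \<bullet> twisted_mult \<rho>' w C)) {0..1}"
    by (intro has_integral_mult_right * pd)
  with *[OF pd(1), of "T C"] show ?thesis
  proof (rule has_integral_le)
    fix s :: real assume "s \<in> {0..1}"
    then have "wnorm \<rho> s (T C) \<le> \<kappa> * wnorm \<rho>' s C" by (intro wnorm_contraction) auto
    then have "exp (w * (s - 1 / 2)) * wnorm \<rho> s (T C) \<le> exp (w * (s - 1 / 2)) * (\<kappa> * wnorm \<rho>' s C)"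
      by (intro mult_left_mono) auto
    then show "exp (w * (s - 1 / 2)) * wnorm \<rho> s (T C) \<le> \<kappa> * (exp (w * (s - 1 / 2)) * wnorm \<rho>' s C)"
      by (simp add: mult_ac)
  qed
qed

text \<open>
  The chain rule: twisted multiplication by \<open>\<rho>\<close> cancels the derivative of the logarithm and
  leaves an expression linear in \<open>\<rho>\<close>.
\<close>

lemma twisted_mult_commutator_ln:
  assumes "posdef \<rho>"
  shows "twisted_mult \<rho> w (X ** mfun ln \<rho> - mfun ln \<rho> ** X - w *\<^sub>R X) =
    exp (- w / 2) *\<^sub>R (X ** \<rho>) - exp (w / 2) *\<^sub>R (\<rho> ** X)"
proof -
  obtain U p where U: "unitary_op U" "\<rho> = U ** dg p ** adj U" "\<And>i. 0 < p i"
    using posdef_spectral[OF assms] by blast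
  let ?M = "adj U ** X ** U"
  have e: "adj U ** (X ** mfun ln \<rho> - mfun ln \<rho> ** X - w *\<^sub>R X) ** U =
      ?M ** dg (\<lambda>i. ln (p i)) - dg (\<lambda>i. ln (p i)) ** ?M - w *\<^sub>R ?M"
    using U(1) by (simp add: mfun_spectral[OF U(1,2)] mm_distribs unitary_op_cancel flip: matrix_mul_assoc)
      (simp add: unitary_op_def)
  have "schur (\<lambda>i j. tw w (p i) (p j)) (adj U ** (X ** mfun ln \<rho> - mfun ln \<rho> ** X - w *\<^sub>R X) ** U) =
      schur (\<lambda>i j. tw w (p i) (p j) * (ln (p j) - ln (p i) - w)) ?M"
    unfolding e by (simp add: vec_eq_iff schur_def mm_dg_left mm_dg_right scaleR_complex algebra_simps)
  also have "\<dots> = exp (- w / 2) *\<^sub>R (?M ** dg p) - exp (w / 2) *\<^sub>R (dg p ** ?M)"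
    unfolding tw_mult[OF U(3) U(3)] by (simp add: vec_eq_iff schur_def mm_dg_left mm_dg_right scaleR_complex algebra_simps)
  finally have "twisted_mult \<rho> w (X ** mfun ln \<rho> - mfun ln \<rho> ** X - w *\<^sub>R X) =
      U ** (exp (- w / 2) *\<^sub>R (?M ** dg p) - exp (w / 2) *\<^sub>R (dg p ** ?M)) ** adj U"
    by (simp add: twisted_mult_spectral[OF U])
  also have "\<dots> = exp (- w / 2) *\<^sub>R (X ** \<rho>) - exp (w / 2) *\<^sub>R (\<rho> ** X)"
    unfolding U(2) using U(1) by (simp add: mm_distribs unitary_op_cancel flip: matrix_mul_assoc)
      (simp add: unitary_op_def)
  finally show ?thesis .
qed

section \<open>One-parameter semigroups\<close>

context
  fixes L :: "'n::finite op \<Rightarrow> 'n op"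
  assumes L: "linear L"
begin

lemma linear_funpow: "linear (L ^^ k)"
  by (induction k) (auto simp: linear_iff linear_add[OF L] linear_cmul[OF L])

lemma summable_exp_semigroup: "summable (\<lambda>k. (t ^ k / fact k) *\<^sub>R (L ^^ k) A)"
proof -
  obtain B where B: "\<And>x. norm (L x) \<le> B * norm x" "B > 0"
    using linear_bounded_pos[OF L] by blast
  have *: "norm ((L ^^ k) A) \<le> B ^ k * norm A" for k
  proof (induction k)
    case (Suc k)
    have "norm (L ((L ^^ k) A)) \<le> B * (B ^ k * norm A)"
      using B(1)[of "(L ^^ k) A"] mult_left_mono[OF Suc, of B] B(2) by linarith
    then show ?case by (simp add: mult_ac)
  qed simp
  have le: "\<exists>N. \<forall>n\<ge>N. norm (norm ((t ^ n / fact n) *\<^sub>R (L ^^ n) A)) \<le> (\<bar>t\<bar> * B) ^ n / fact n * norm A"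
  proof (intro exI allI impI)
    fix n
    have "norm ((t ^ n / fact n) *\<^sub>R (L ^^ n) A) \<le> (\<bar>t\<bar> ^ n / fact n) * (B ^ n * norm A)"
      unfolding norm_scaleR real_norm_def abs_divide power_abs by (simp, intro divide_right_mono mult_left_mono *) auto
    then show "norm (norm ((t ^ n / fact n) *\<^sub>R (L ^^ n) A)) \<le> (\<bar>t\<bar> * B) ^ n / fact n * norm A"
      by (simp add: power_mult_distrib mult_ac)
  qed
  have "summable (\<lambda>n. (\<bar>t\<bar> * B) ^ n / fact n)"
    using summable_exp[of "\<bar>t\<bar> * B"] by (simp add: field_simps)
  then have "summable (\<lambda>n. (\<bar>t\<bar> * B) ^ n / fact n * norm A)" by (rule summable_mult2)
  from summable_norm_cancel[OF summable_comparison_test[OF le this]] show ?thesis .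
qed

lemma exp_semigroup_sums: "(\<lambda>k. (t ^ k / fact k) *\<^sub>R (L ^^ k) A) sums exp_semigroup L t A"
  unfolding exp_semigroup_def by (rule summable_sums[OF summable_exp_semigroup])

lemma exp_semigroup_0 [simp]: "exp_semigroup L 0 A = A"
proof -
  have "(\<lambda>k. (0 ^ k / fact k) *\<^sub>R (L ^^ k) A) = (\<lambda>k. if k = 0 then A else 0)"
    by (auto simp: power_0_left)
  with exp_semigroup_sums[of 0 A] sums_single[of 0 "\<lambda>_. A"] show ?thesis
    by (simp add: sums_unique2)
qed

lemma exp_semigroup_fixed:
  assumes "L A = 0" shows "exp_semigroup L t A = A"
proof -
  have "(L ^^ k) A = 0" if "k \<noteq> 0" for k
    using that assms by (cases k) (simp_all add: funpow_swap1 linear_0[OF linear_funpow])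
  then have "(\<lambda>k. (t ^ k / fact k) *\<^sub>R (L ^^ k) A) = (\<lambda>k. if k = 0 then A else 0)" by auto
  with exp_semigroup_sums[of t A] sums_single[of 0 "\<lambda>_. A"] show ?thesis
    by (simp add: sums_unique2)
qed

text \<open>Pairing with a fixed operator leaves an everywhere convergent scalar power series, which
  may be differentiated term by term.\<close>

lemma exp_semigroup_inner_derivative:
  "((\<lambda>t. exp_semigroup L t A \<bullet> b) has_real_derivative exp_semigroup L t (L A) \<bullet> b) (at t within S)"
proof -
  define c where "c k = (L ^^ k) A \<bullet> b / fact k" for k
  have s: "(\<lambda>k. c k * t ^ k) sums (exp_semigroup L t A \<bullet> b)" for t
    using bounded_linear.sums[OF bounded_linear_inner_left exp_semigroup_sums, of t A b]
    by (simp add: c_def mult_ac)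
  have "(\<lambda>k. ((t ^ k / fact k) *\<^sub>R (L ^^ k) (L A)) \<bullet> b) sums (exp_semigroup L t (L A) \<bullet> b)"
    by (rule bounded_linear.sums[OF bounded_linear_inner_left exp_semigroup_sums])
  moreover have "((t ^ k / fact k) *\<^sub>R (L ^^ k) (L A)) \<bullet> b = diffs c k * t ^ k" for k
    by (simp add: diffs_def c_def funpow_swap1 divide_simps del: of_nat_Suc)
  ultimately have d: "(\<lambda>k. diffs c k * t ^ k) sums (exp_semigroup L t (L A) \<bullet> b)" by simp
  have "((\<lambda>t. \<Sum>k. c k * t ^ k) has_real_derivative (\<Sum>k. diffs c k * t ^ k)) (at t)"
    by (rule termdiffs_strong_converges_everywhere) (rule sums_summable[OF s])
  then have "((\<lambda>t. exp_semigroup L t A \<bullet> b) has_real_derivative exp_semigroup L t (L A) \<bullet> b) (at t)"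
    by (simp add: sums_unique[OF s, symmetric] sums_unique[OF d, symmetric])
  then show ?thesis by (rule has_field_derivative_at_within)
qed

end

text \<open>An intertwining relation passes to each term of the exponential series. It is applied to
  commutators with jump operators, to the adjoint and to multiplication by
  \<open>\<i>\<close>.\<close>

lemma exp_semigroup_commute:
  assumes L: "linear L" and M: "linear M" and D: "linear D" and DL: "\<And>A. D (L A) = M (D A)"
  shows "D (exp_semigroup L t A) = exp_semigroup M t (D A)"
proof -
  have *: "D ((L ^^ k) A) = (M ^^ k) (D A)" for k
    by (induction k) (simp_all add: DL)
  have "(\<lambda>k. D ((t ^ k / fact k) *\<^sub>R (L ^^ k) A)) sums D (exp_semigroup L t A)"
    by (rule bounded_linear.sums[OF D[unfolded linear_conv_bounded_linear] exp_semigroup_sums[OF L]])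
  then have "(\<lambda>k. (t ^ k / fact k) *\<^sub>R (M ^^ k) (D A)) sums D (exp_semigroup L t A)"
    by (simp add: linear_cmul[OF D] *)
  then show ?thesis using exp_semigroup_sums[OF M] by (rule sums_unique2)
qed

lemma exp_semigroup_inner:
  assumes L: "linear L" and M: "linear M" and adj: "\<And>A B. L A \<bullet> B = A \<bullet> M B"
  shows "exp_semigroup L t A \<bullet> B = A \<bullet> exp_semigroup M t B"
proof -
  have *: "(L ^^ k) A \<bullet> B = A \<bullet> (M ^^ k) B" for k
    by (induction k arbitrary: B) (simp_all add: adj funpow_swap1[of M])
  have "(\<lambda>k. ((t ^ k / fact k) *\<^sub>R (L ^^ k) A) \<bullet> B) sums (exp_semigroup L t A \<bullet> B)"
    by (rule bounded_linear.sums[OF bounded_linear_inner_left exp_semigroup_sums[OF L]])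
  moreover have "(\<lambda>k. A \<bullet> ((t ^ k / fact k) *\<^sub>R (M ^^ k) B)) sums (A \<bullet> exp_semigroup M t B)"
    by (rule bounded_linear.sums[OF bounded_linear_inner_right exp_semigroup_sums[OF M]])
  ultimately show ?thesis by (simp add: * sums_unique2)
qed

context
  fixes L :: "'n::finite op \<Rightarrow> 'n op"
  assumes L: "linear L"
begin

lemma linear_exp_semigroup: "linear (exp_semigroup L t)"
proof (rule linearI)
  fix A B :: "'n op" and r :: real
  have "(\<lambda>k. (t ^ k / fact k) *\<^sub>R (L ^^ k) (A + B)) sums (exp_semigroup L t A + exp_semigroup L t B)"
    using sums_add[OF exp_semigroup_sums[OF L] exp_semigroup_sums[OF L], of t A t B]
    by (simp add: linear_add[OF linear_funpow[OF L]] scaleR_right_distrib)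
  then show "exp_semigroup L t (A + B) = exp_semigroup L t A + exp_semigroup L t B"
    using exp_semigroup_sums[OF L] by (rule sums_unique2[symmetric])
  show "exp_semigroup L t (r *\<^sub>R A) = r *\<^sub>R exp_semigroup L t A"
    using exp_semigroup_commute[OF L L, of "(*\<^sub>R) r" t A]
    by (simp add: linear_cmul[OF L] linear_scaleR)
qed

lemma exp_semigroup_gen: "exp_semigroup L t (L A) = L (exp_semigroup L t A)"
  using exp_semigroup_commute[OF L L L] by simp

text \<open>This separates the time from the argument, so that the chain rule and joint continuity
  reduce to finitely many fixed arguments.\<close>

lemma exp_semigroup_basis: "exp_semigroup L t A = (\<Sum>b\<in>Basis. (A \<bullet> b) *\<^sub>R exp_semigroup L t b)"
proof -
  have "exp_semigroup L t A = exp_semigroup L t (\<Sum>b\<in>Basis. (A \<bullet> b) *\<^sub>R b)"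
    by (simp add: euclidean_representation)
  then show ?thesis by (simp add: linear_sum[OF linear_exp_semigroup] linear_cmul[OF linear_exp_semigroup])
qed

lemma exp_semigroup_has_vector_derivative:
  "((\<lambda>t. exp_semigroup L t A) has_vector_derivative L (exp_semigroup L t A)) (at t within S)"
  unfolding has_vector_derivative_def
  by (subst has_derivative_componentwise_within)
    (use exp_semigroup_inner_derivative[OF L] in \<open>auto simp: has_field_derivative_def exp_semigroup_gen mult_commute_abs\<close>)

lemma exp_semigroup_chain:
  assumes \<tau>: "(\<tau> has_real_derivative \<tau>') (at s within S)"
    and \<gamma>: "(\<gamma> has_vector_derivative \<gamma>') (at s within S)"
  shows "((\<lambda>s. exp_semigroup L (\<tau> s) (\<gamma> s)) has_vector_derivative
    exp_semigroup L (\<tau> s) \<gamma>' + \<tau>' *\<^sub>R L (exp_semigroup L (\<tau> s) (\<gamma> s))) (at s within S)"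
proof -
  have b: "((\<lambda>s. exp_semigroup L (\<tau> s) b) has_vector_derivative \<tau>' *\<^sub>R L (exp_semigroup L (\<tau> s) b)) (at s within S)" for b
    using vector_diff_chain_within[OF \<tau>[unfolded has_real_derivative_iff_has_vector_derivative]
        exp_semigroup_has_vector_derivative] by (simp add: o_def)
  have c: "((\<lambda>s. \<gamma> s \<bullet> b) has_real_derivative \<gamma>' \<bullet> b) (at s within S)" for b
    using bounded_linear.has_vector_derivative[OF bounded_linear_inner_left \<gamma>]
    by (simp add: has_real_derivative_iff_has_vector_derivative)
  have "((\<lambda>s. \<Sum>b\<in>Basis. (\<gamma> s \<bullet> b) *\<^sub>R exp_semigroup L (\<tau> s) b) has_vector_derivative
    (\<Sum>b\<in>Basis. (\<gamma> s \<bullet> b) *\<^sub>R (\<tau>' *\<^sub>R L (exp_semigroup L (\<tau> s) b)) + (\<gamma>' \<bullet> b) *\<^sub>R exp_semigroup L (\<tau> s) b)) (at s within S)"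
    by (intro has_vector_derivative_sum has_vector_derivative_scaleR b c)
  moreover have "(\<Sum>b\<in>Basis. (\<gamma> s \<bullet> b) *\<^sub>R (\<tau>' *\<^sub>R L (exp_semigroup L (\<tau> s) b)) + (\<gamma>' \<bullet> b) *\<^sub>R exp_semigroup L (\<tau> s) b) =
      exp_semigroup L (\<tau> s) \<gamma>' + \<tau>' *\<^sub>R L (exp_semigroup L (\<tau> s) (\<gamma> s))"
    unfolding exp_semigroup_basis[of _ \<gamma>'] exp_semigroup_basis[of _ "\<gamma> s"]
    by (simp add: linear_sum[OF L] linear_cmul[OF L] sum.distrib scaleR_sum_right mult.commute add.commute)
  ultimately show ?thesis
    unfolding exp_semigroup_basis[of _ "\<gamma> _"] by simp
qed

lemma continuous_on_exp_semigroup: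
  assumes "continuous_on S \<tau>" "continuous_on S \<gamma>"
  shows "continuous_on S (\<lambda>s. exp_semigroup L (\<tau> s) (\<gamma> s))"
proof -
  have "continuous_on UNIV (\<lambda>t. exp_semigroup L t b)" for b
    by (auto simp: continuous_on_eq_continuous_within intro: has_vector_derivative_continuous[OF exp_semigroup_has_vector_derivative])
  then have "continuous_on S (\<lambda>s. exp_semigroup L (\<tau> s) b)" for b
    using continuous_on_compose2[OF _ assms(1) subset_UNIV] by blast
  then show ?thesis
    unfolding exp_semigroup_basis[of _ "\<gamma> _"] by (intro continuous_intros assms)
qed

text \<open>The curve \<open>?F\<close>, which splits the total time \<open>s + t\<close> at
  \<open>r\<close>, has derivative zero; its values at \<open>r = 0\<close> and \<open>r = t\<close>
  are the two sides.\<close>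

lemma exp_semigroup_add: "exp_semigroup L (s + t) A = exp_semigroup L s (exp_semigroup L t A)"
proof -
  let ?F = "\<lambda>r. exp_semigroup L (s + t - r) (exp_semigroup L r A)"
  have "(?F has_vector_derivative 0) (at r within UNIV)" for r
  proof -
    have "(?F has_vector_derivative exp_semigroup L (s + t - r) (L (exp_semigroup L r A))
        + (0 - 1) *\<^sub>R L (?F r)) (at r within UNIV)"
      by (intro exp_semigroup_chain exp_semigroup_has_vector_derivative derivative_intros)
    then show ?thesis by (simp add: exp_semigroup_gen)
  qed
  then obtain c where c: "\<And>r. r \<in> UNIV \<Longrightarrow> ?F r = c"
    using has_vector_derivative_zero_constant[of UNIV ?F] by auto
  from c[of 0] c[of t] show ?thesis by (simp add: exp_semigroup_0[OF L])
qed

end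

section \<open>Quantum Markov semigroups with detailed balance\<close>

lemma scaleR_mv: "(c *\<^sub>R (A::'n::finite op)) *v x = c *\<^sub>R (A *v x)"
  by (simp add: vec_eq_iff matrix_vector_mult_def scaleR_sum_right)

lemma lbd_nonneg_kernel:
  assumes A: "lbd 0 A" and x: "x \<bullet> (A *v x) = 0" shows "A *v x = 0"
proof -
  obtain U d where U: "unitary_op U" "A = U ** dg d ** adj U" using A spectral_theorem unfolding lbd_def by blast
  have d: "0 \<le> d i" for i using A lbd_conj_dg[OF U(1), of 0 d] by (simp add: U(2))
  have "\<forall>i. d i * (norm ((adj U *v x) $ i))\<^sup>2 = 0"
    using x d unfolding U(2) inner_conj_dg by (subst (asm) sum_nonneg_eq_0_iff) auto
  then have "dg d *v (adj U *v x) = 0" by (auto simp: vec_eq_iff dg_mv)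
  then show ?thesis by (simp add: U(2) flip: matrix_vector_mul_assoc)
qed

lemma inner_weight_nonneg:
  fixes C :: "'n::finite op"
  assumes "lbd 0 R" shows "0 \<le> C \<bullet> (C ** R)" "0 \<le> C \<bullet> (R ** C)"
proof -
  obtain U d where U: "unitary_op U" "R = U ** dg d ** adj U" using assms spectral_theorem unfolding lbd_def by blast
  have d: "0 \<le> d i" for i using assms lbd_conj_dg[OF U(1), of 0 d] by (simp add: U(2))
  show "0 \<le> C \<bullet> (C ** R)" "0 \<le> C \<bullet> (R ** C)"
    unfolding inner_weight_spectral[OF U] using d by (auto intro!: sum_nonneg)
qed

lemma linear_comm: "linear (comm X)"
  by (simp add: linear_iff comm_def mm_distribs algebra_simps)

lemma adj_comm: "adj (comm A B) = comm (adj B) (adj A)"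
  by (simp add: comm_def adj_simps)

lemma trace_comm: "trace (comm A B) = 0"
  using trace_mul_sym[of A B] by (simp add: comm_def trace_sub)

lemma inner_comm: "comm (X::'n::finite op) A \<bullet> B = A \<bullet> (adj X ** B - B ** adj X)"
  by (simp only: comm_def inner_diff_left inner_diff_right inner_mm_left[of X A] inner_mm_right[of A X])

lemma inner_sandwich: "(A ** B ** C) \<bullet> (D::'n::finite op) = B \<bullet> (adj A ** D ** adj C)"
  by (simp only: inner_mm_right[of "A ** B" C] inner_mm_left[of A B] matrix_mul_assoc)

text \<open>\<open>balance\<close> is detailed balance in logarithmic form, the infinitesimal
  version of \<open>modular \<sigma> (X k) = exp (- \<omega> k) *\<^sub>R X k\<close>.
  \<open>irreducible\<close> says that only scalars have zero gradient, which makes the metric well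
  defined.\<close>

locale qms =
  fixes J :: "'k set" and X :: "'k \<Rightarrow> 'n::finite op" and \<omega> :: "'k \<Rightarrow> real"
    and star :: "'k \<Rightarrow> 'k" and \<sigma> :: "'n op"
  assumes fin: "finite J"
    and star: "\<And>k. k \<in> J \<Longrightarrow> star k \<in> J" "\<And>k. k \<in> J \<Longrightarrow> star (star k) = k"
      "\<And>k. k \<in> J \<Longrightarrow> X (star k) = adj (X k)" "\<And>k. k \<in> J \<Longrightarrow> \<omega> (star k) = - \<omega> k"
    and \<sigma>_posdef: "posdef \<sigma>" and trace_\<sigma>: "trace \<sigma> = 1"
    and balance: "\<And>k. k \<in> J \<Longrightarrow> X k ** mfun ln \<sigma> - mfun ln \<sigma> ** X k = \<omega> k *\<^sub>R X k"
    and irreducible: "\<And>A. (\<And>k. k \<in> J \<Longrightarrow> comm (X k) A = 0) \<Longrightarrow> \<exists>c. A = c *\<^sub>C mat 1"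
begin

definition gen :: "'n op \<Rightarrow> 'n op" where
  "gen A = (\<Sum>k\<in>J. exp (- \<omega> k / 2) *\<^sub>R (adj (X k) ** comm A (X k) + comm (adj (X k)) A ** X k))"

text \<open>The generator in the Schroedinger picture; \<open>inner_gen\<close> identifies it as the
  Hilbert-Schmidt adjoint of \<open>gen\<close>.\<close>

definition dgen :: "'n op \<Rightarrow> 'n op" where
  "dgen \<rho> = (\<Sum>k\<in>J. exp (- \<omega> k / 2) *\<^sub>R
     (2 *\<^sub>R (X k ** \<rho> ** adj (X k)) - adj (X k) ** X k ** \<rho> - \<rho> ** adj (X k) ** X k))"

text \<open>
  \<open>gen\<close> with the sign of its jump term reversed. The sign appears when a commutator with one jump
  operator is moved past an anticommuting one.
\<close>

definition tgen :: "'n op \<Rightarrow> 'n op" where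
  "tgen B = (\<Sum>k\<in>J. exp (- \<omega> k / 2) *\<^sub>R
     (- (2 *\<^sub>R (adj (X k) ** B ** X k)) - adj (X k) ** X k ** B - B ** adj (X k) ** X k))"

abbreviation "PH \<equiv> exp_semigroup gen"
abbreviation "PS \<equiv> exp_semigroup dgen"

section \<open>Duality of the two pictures\<close>

lemma sum_star: "(\<Sum>k\<in>J. f (star k)) = (\<Sum>k\<in>J. f k)"
  by (rule sum.reindex_bij_witness[of _ star star]) (auto simp: star)

lemma linear_gen: "linear gen"
  by (rule linearI) (simp_all add: gen_def comm_def mm_distribs algebra_simps sum.distrib scaleR_sum_right sum_subtractf)

lemma linear_dgen: "linear dgen"
  by (rule linearI) (simp_all add: dgen_def mm_distribs algebra_simps sum.distrib scaleR_sum_right sum_subtractf)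

lemma linear_tgen: "linear tgen"
  by (rule linearI) (simp_all add: tgen_def mm_distribs algebra_simps sum.distrib scaleR_sum_right sum_subtractf sum_negf)

lemma gen_eq: "gen A = (\<Sum>k\<in>J. exp (- \<omega> k / 2) *\<^sub>R
     (2 *\<^sub>R (adj (X k) ** A ** X k) - adj (X k) ** X k ** A - A ** adj (X k) ** X k))"
  unfolding gen_def by (intro sum.cong refl arg_cong[of _ _ "(*\<^sub>R) _"])
    (simp add: comm_def mm_distribs matrix_mul_assoc scaleR_2)

lemma inner_gen: "gen A \<bullet> B = A \<bullet> dgen B"
proof -
  have "(adj Y ** A ** Y) \<bullet> B = A \<bullet> (Y ** B ** adj Y)"
    "(adj Y ** Y ** A) \<bullet> B = A \<bullet> (adj Y ** Y ** B)"
    "(A ** adj Y ** Y) \<bullet> B = A \<bullet> (B ** adj Y ** Y)" for Y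
    by (simp_all only: inner_sandwich[of "adj Y" A Y] inner_mm_left[of "adj Y ** Y" A]
        inner_mm_right[of "A ** adj Y" Y] inner_mm_right[of A "adj Y"] adj_mm adj_adj)
  then show ?thesis
    unfolding gen_eq dgen_def inner_sum_left inner_sum_right
    by (intro sum.cong refl) (simp only: inner_diff_left inner_diff_right inner_scaleR_left inner_scaleR_right)
qed

lemma adj_dgen: "adj (dgen \<rho>) = dgen (adj \<rho>)"
  unfolding dgen_def adj_sum
  by (intro sum.cong refl) (simp add: adj_simps matrix_mul_assoc algebra_simps)

lemma adj_tgen: "adj (tgen \<rho>) = tgen (adj \<rho>)"
  unfolding tgen_def adj_sum
  by (intro sum.cong refl) (simp add: adj_simps matrix_mul_assoc algebra_simps)

lemma gen_cscale: "gen (c *\<^sub>C A) = c *\<^sub>C gen A"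
  unfolding gen_eq cscale_sum_right
  by (intro sum.cong refl) (simp add: mm_cscale_left mm_cscale_right cscale_diff_right cscale_scaleR)

lemma trace_dgen: "trace (dgen \<rho>) = 0"
proof -
  have "trace (2 *\<^sub>R (X k ** \<rho> ** adj (X k)) - adj (X k) ** X k ** \<rho> - \<rho> ** adj (X k) ** X k) = 0" for k
    using trace_mul_sym[of "X k ** \<rho>" "adj (X k)"] trace_mul_sym[of "\<rho> ** adj (X k)" "X k"]
    by (simp add: trace_sub trace_scaleR matrix_mul_assoc)
  then show ?thesis
    unfolding dgen_def by (simp add: linear_sum[OF linear_trace] trace_scaleR)
qed

text \<open>Adjointness for the real inner product becomes adjointness for the complex one because
  \<open>PH t\<close> commutes with multiplication by \<open>\<i>\<close>.\<close>

lemma hs_adjoint_PH: "hs_adjoint UNIV (PH t) \<rho> = PS t \<rho>"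
  unfolding hs_adjoint_def
proof (rule the_equality)
  have "(\<i> *\<^sub>C PH t B) = PH t (\<i> *\<^sub>C B)" for B
    by (rule exp_semigroup_commute[OF linear_gen linear_gen linear_cscale]) (simp add: gen_cscale)
  then show "PS t \<rho> \<in> UNIV \<and> (\<forall>B\<in>UNIV. trace (adj B ** PS t \<rho>) = trace (adj (PH t B) ** \<rho>))"
    unfolding trace_mm_eq_inner
    by (simp add: exp_semigroup_inner[OF linear_gen linear_dgen inner_gen])
next
  fix C assume C: "C \<in> UNIV \<and> (\<forall>B\<in>UNIV. trace (adj B ** C) = trace (adj (PH t B) ** \<rho>))"
  have "B \<bullet> C = PH t B \<bullet> \<rho>" for B using C unfolding inner_op by simp
  then have "B \<bullet> C = B \<bullet> PS t \<rho>" for B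
    by (simp add: exp_semigroup_inner[OF linear_gen linear_dgen inner_gen])
  then show "C = PS t \<rho>" by (metis inner_commute vector_eq_rdot)
qed

text \<open>Detailed balance turns the contribution of \<open>mfun ln \<sigma>\<close> into the
  multiple \<open>\<omega> k *\<^sub>R X k\<close> that the chain rule
  \<open>twisted_mult_commutator_ln\<close> requires.\<close>

lemma twisted_mult_gradient:
  assumes "posdef \<rho>" "k \<in> J"
  shows "twisted_mult \<rho> (\<omega> k) (nc_grad X (mfun ln \<rho> - mfun ln \<sigma>) k) =
    exp (- \<omega> k / 2) *\<^sub>R (X k ** \<rho>) - exp (\<omega> k / 2) *\<^sub>R (\<rho> ** X k)"
proof -
  have "nc_grad X (mfun ln \<rho> - mfun ln \<sigma>) k = X k ** mfun ln \<rho> - mfun ln \<rho> ** X k - (X k ** mfun ln \<sigma> - mfun ln \<sigma> ** X k)"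
    by (simp add: nc_grad_def comm_def mm_distribs)
  then show ?thesis
    using twisted_mult_commutator_ln[OF assms(1)] by (simp add: balance[OF assms(2)])
qed

text \<open>Each flux is linear in \<open>\<rho>\<close> by the chain rule, so its divergence can be
  compared with the dissipator term by term.\<close>

lemma dgen_gradient_flow:
  assumes "posdef \<rho>"
  shows "dgen \<rho> = nc_div J X (\<lambda>k. twisted_mult \<rho> (\<omega> k) (nc_grad X (mfun ln \<rho> - mfun ln \<sigma>) k))"
proof -
  \<comment> \<open>The two halves of the dissipator. The part of the \<open>k\<close>-th flux with
    weight \<open>exp (\<omega> k / 2)\<close> is the \<open>b\<close>-half of the partner jump,
    since \<open>\<omega> (star k) = - \<omega> k\<close>.\<close>
  define a where "a k = exp (- \<omega> k / 2) *\<^sub>R (X k ** \<rho> ** adj (X k) - adj (X k) ** X k ** \<rho>)" for k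
  define b where "b k = exp (- \<omega> k / 2) *\<^sub>R (X k ** \<rho> ** adj (X k) - \<rho> ** adj (X k) ** X k)" for k
  have "nc_div J X (\<lambda>k. twisted_mult \<rho> (\<omega> k) (nc_grad X (mfun ln \<rho> - mfun ln \<sigma>) k)) = (\<Sum>k\<in>J. a k + b (star k))"
    unfolding nc_div_def
    by (intro sum.cong refl)
      (simp add: twisted_mult_gradient[OF assms] comm_def a_def b_def star mm_distribs matrix_mul_assoc algebra_simps)
  also have "\<dots> = (\<Sum>k\<in>J. a k + b k)" by (simp add: sum.distrib sum_star)
  also have "\<dots> = dgen \<rho>"
    unfolding dgen_def a_def b_def by (intro sum.cong refl) (simp add: algebra_simps scaleR_2)
  finally show ?thesis ..
qed

lemma dgen_\<sigma>: "dgen \<sigma> = 0"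
  unfolding dgen_gradient_flow[OF \<sigma>_posdef]
  by (simp add: nc_div_def nc_grad_def comm_def linear_0[OF linear_twisted_mult[OF \<sigma>_posdef]])

lemma PS_\<sigma>: "PS t \<sigma> = \<sigma>"
  by (rule exp_semigroup_fixed[OF linear_dgen dgen_\<sigma>])

section \<open>Trace and positivity under the Schroedinger semigroup\<close>

lemma adj_PS: "adj (PS t \<rho>) = PS t (adj \<rho>)"
  by (rule exp_semigroup_commute[OF linear_dgen linear_dgen linear_adj adj_dgen])

lemma trace_PS: "trace (PS t \<rho>) = trace \<rho>"
proof -
  have "((\<lambda>t. trace (PS t \<rho>)) has_vector_derivative trace (dgen (PS t \<rho>))) (at t within UNIV)" for t
    by (rule bounded_linear.has_vector_derivative[OF linear_trace[unfolded linear_conv_bounded_linear]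
          exp_semigroup_has_vector_derivative[OF linear_dgen]])
  then obtain c where c: "\<And>t. t \<in> UNIV \<Longrightarrow> trace (PS t \<rho>) = c"
    using has_vector_derivative_zero_constant[of UNIV "\<lambda>t. trace (PS t \<rho>)"] by (auto simp: trace_dgen)
  from c[of t] c[of 0] show ?thesis by (simp add: exp_semigroup_0[OF linear_dgen])
qed

text \<open>On a null vector of a positive semidefinite operator the two loss terms vanish and only
  the positive gain term remains.\<close>

lemma dgen_off_diagonal:
  assumes F: "lbd 0 F" and x: "x \<bullet> (F *v x) = 0" shows "0 \<le> x \<bullet> (dgen F *v x)"
proof -
  have Fx: "F *v x = 0" by (rule lbd_nonneg_kernel[OF F x])
  have "0 \<le> outer x \<bullet> (exp (- \<omega> k / 2) *\<^sub>R
     (2 *\<^sub>R (X k ** F ** adj (X k)) - adj (X k) ** X k ** F - F ** adj (X k) ** X k))" for k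
  proof -
    have "outer x \<bullet> (X k ** F ** adj (X k)) = (adj (X k) *v x) \<bullet> (F *v (adj (X k) *v x))"
      by (simp add: inner_outer inner_mv flip: matrix_vector_mul_assoc)
    moreover have "outer x \<bullet> (adj (X k) ** X k ** F) = 0"
      by (simp add: inner_outer Fx flip: matrix_vector_mul_assoc)
    moreover have "outer x \<bullet> (F ** adj (X k) ** X k) = 0"
      using F Fx by (simp add: inner_outer inner_mv[of _ F] lbd_def flip: matrix_vector_mul_assoc)
    ultimately show ?thesis
      using F by (simp add: inner_diff_right lbd_def)
  qed
  then show ?thesis
    unfolding inner_outer[symmetric] dgen_def inner_sum_right by (intro sum_nonneg)
qed

text \<open>Adding \<open>\<epsilon> e\<^sup>t \<sigma>\<close> turns the first time at which positivity fails into a contradiction.\<close>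

lemma lbd_PS:
  assumes A: "lbd 0 A" and "0 \<le> t" shows "lbd 0 (PS t A)"
proof -
  have sa: "adj (PS t A) = PS t A" for t using A by (simp add: adj_PS lbd_def)
  have \<sigma>pos: "0 < x \<bullet> (\<sigma> *v x)" if "x \<noteq> 0" for x using \<sigma>_posdef that by (simp add: posdef_inner)
  have main: "0 < x \<bullet> ((PS T A + (\<epsilon> * exp T) *\<^sub>R \<sigma>) *v x)" if \<epsilon>: "0 < \<epsilon>" and T: "0 \<le> T" and x: "norm x = 1" for \<epsilon> T x
  proof (rule ccontr)
    assume neg: "\<not> ?thesis"
    define F where "F t = PS t A + (\<epsilon> * exp t) *\<^sub>R \<sigma>" for t
    define f where "f y t = outer y \<bullet> F t" for y t
    have f: "f y t = y \<bullet> (F t *v y)" for y t by (simp add: f_def inner_outer)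
    have F': "(F has_vector_derivative dgen (PS t A) + (\<epsilon> * exp t) *\<^sub>R \<sigma>) (at t within S)" for t S
      unfolding F_def
      by (intro has_vector_derivative_add exp_semigroup_has_vector_derivative linear_dgen)
        (auto intro!: derivative_eq_intros simp: has_vector_derivative_def)
    have dF: "dgen (PS t A) = dgen (F t)" for t
      by (simp add: F_def linear_add[OF linear_dgen] linear_cmul[OF linear_dgen] dgen_\<sigma>)
    have contF: "continuous_on UNIV F"
      using F' by (auto simp: continuous_on_eq_continuous_within intro: has_vector_derivative_continuous)
    have f': "((\<lambda>t. f y t) has_real_derivative f' ) (at t)" if "f' = outer y \<bullet> (dgen (F t) + (\<epsilon> * exp t) *\<^sub>R \<sigma>)" for y t f'
      unfolding f_def that has_real_derivative_iff_has_vector_derivative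
      using bounded_linear.has_vector_derivative[OF bounded_linear_inner_right F'[of t UNIV]] by (simp add: dF)
    \<comment> \<open>The pairs of a time and a unit vector at which positivity fails. Compactness
      provides a first such time.\<close>
    define K where "K = {p \<in> {0..T} \<times> sphere (0::complex^'n) 1. f (snd p) (fst p) \<le> 0}"
    have cont: "continuous_on UNIV (\<lambda>p. f (snd p) (fst p))"
    proof -
      have "continuous_on UNIV (\<lambda>p :: real \<times> (complex^'n). F (fst p))"
        using continuous_on_compose2[OF contF continuous_on_fst[OF continuous_on_id]] by simp
      moreover have "continuous_on UNIV (\<lambda>p :: real \<times> (complex^'n). outer (snd p) :: 'n op)"
        unfolding outer_def by (intro continuous_intros)
      ultimately show ?thesis unfolding f_def by (intro continuous_intros)
    qed
    have "K = ({0..T} \<times> sphere 0 1) \<inter> {p. f (snd p) (fst p) \<le> 0}" by (auto simp: K_def)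
    then have "compact K"
      by (simp add: compact_Int_closed compact_Times closed_Collect_le cont)
    moreover have "K \<noteq> {}" using neg T x by (auto simp: K_def f F_def intro!: exI[of _ T] exI[of _ x])
    moreover have "continuous_on K fst" by (intro continuous_intros)
    ultimately obtain p where p: "p \<in> K" and minp: "\<And>q. q \<in> K \<Longrightarrow> fst p \<le> fst q"
      using continuous_attains_inf[of K fst] by metis
    obtain t0 x0 where p0: "p = (t0, x0)" by (cases p)
    have t0: "0 \<le> t0" "t0 \<le> T" "norm x0 = 1" "f x0 t0 \<le> 0" using p by (auto simp: K_def p0)
    have before: "0 < f y t" if "0 \<le> t" "t < t0" "norm y = 1" for t y
      using minp[of "(t, y)"] that t0 by (force simp: K_def p0)
    have "x0 \<noteq> 0" using t0(3) by auto
    then have \<sigma>x0: "0 < \<epsilon> * (x0 \<bullet> (\<sigma> *v x0))" using \<epsilon> \<sigma>pos[of x0] by simp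
    have "0 < f x0 0" if "t0 = 0"
      using A \<sigma>x0 by (auto simp: f F_def exp_semigroup_0[OF linear_dgen] matrix_vector_mult_add_rdistrib inner_add_right
          scaleR_mv lbd_def intro!: add_nonneg_pos)
    then have t0pos: "0 < t0" using t0 by (cases "t0 = 0") auto
    have at0: "0 \<le> f y t0" if y: "norm y = 1" for y
    proof (rule ccontr)
      assume "\<not> 0 \<le> f y t0"
      have "isCont (f y) t0" using f'[OF refl, of y t0] by (rule DERIV_isCont)
      then have "(f y \<longlongrightarrow> f y t0) (at_left t0)" by (simp add: isCont_def filterlim_at_split)
      moreover have "eventually (\<lambda>t. 0 \<le> f y t) (at_left t0)"
        using eventually_at_left_real[OF t0pos] by eventually_elim (use before y in \<open>auto intro: less_imp_le\<close>)
      ultimately have "0 \<le> f y t0" by (intro tendsto_lowerbound) auto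
      with \<open>\<not> 0 \<le> f y t0\<close> show False ..
    qed
    have "lbd 0 (F t0)"
      unfolding lbd_def
    proof (intro conjI allI)
      show "adj (F t0) = F t0" using \<sigma>_posdef by (simp add: F_def adj_simps sa posdef_inner)
      fix y show "0 * (y \<bullet> y) \<le> y \<bullet> (F t0 *v y)"
      proof (cases "y = 0")
        case False
        then have "0 \<le> f (inverse (norm y) *\<^sub>R y) t0" by (intro at0) simp
        then show ?thesis using False by (simp add: f mv_scaleR zero_le_mult_iff)
      qed simp
    qed
    moreover have fx0: "f x0 t0 = 0" using at0[OF t0(3)] t0(4) by simp
    ultimately have "0 \<le> x0 \<bullet> (dgen (F t0) *v x0)" by (intro dgen_off_diagonal) (simp_all add: f)
    moreover have "0 < \<epsilon> * exp t0 * (x0 \<bullet> (\<sigma> *v x0))" using mult_pos_pos[OF \<sigma>x0 exp_gt_zero[of t0]] by (simp add: mult_ac)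
    ultimately have "0 < outer x0 \<bullet> (dgen (F t0) + (\<epsilon> * exp t0) *\<^sub>R \<sigma>)"
      by (simp add: inner_add_right inner_outer)
    \<comment> \<open>The form vanishes at \<open>t0\<close> with positive slope, so it is negative
      shortly before, against the choice of \<open>t0\<close>. Capping the step by \<open>t0\<close>
      keeps the earlier time nonnegative.\<close>
    from DERIV_pos_inc_left[OF f'[OF refl] this] obtain d where
      d: "0 < d" "\<And>h. 0 < h \<Longrightarrow> h < d \<Longrightarrow> f x0 (t0 - h) < f x0 t0" by blast
    have "f x0 (t0 - min (d / 2) t0) < f x0 t0" using d t0pos by (intro d(2)) auto
    moreover have "0 < f x0 (t0 - min (d / 2) t0)" using d(1) t0pos t0(3) by (intro before) auto
    ultimately show False using fx0 by simp
  qed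
  have "0 \<le> x \<bullet> (PS t A *v x)" if x: "norm x = 1" for x
  proof (rule field_le_epsilon)
    fix e :: real assume "0 < e"
    have "x \<noteq> 0" using x by auto
    then have "0 < exp t * (x \<bullet> (\<sigma> *v x))" using \<sigma>pos[of x] by simp
    moreover from this have "x \<bullet> (\<sigma> *v x) \<noteq> 0" by auto
    \<comment> \<open>The value of \<epsilon> is chosen so that the correction at time
      \<open>t\<close> equals exactly \<open>e\<close> in the direction \<open>x\<close>.\<close>
    ultimately show "0 \<le> x \<bullet> (PS t A *v x) + e"
      using main[of "e / (exp t * (x \<bullet> (\<sigma> *v x)))" t x] \<open>0 < e\<close> \<open>0 \<le> t\<close> x
      by (simp add: matrix_vector_mult_add_rdistrib inner_add_right scaleR_mv)
  qed
  note pos = this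
  show ?thesis
    unfolding lbd_def
  proof (intro conjI allI sa)
    fix y show "0 * (y \<bullet> y) \<le> y \<bullet> (PS t A *v y)"
    proof (cases "y = 0")
      case False
      then show ?thesis using pos[of "inverse (norm y) *\<^sub>R y"] by (simp add: mv_scaleR zero_le_mult_iff)
    qed simp
  qed
qed

text \<open>\<open>\<rho>\<close> dominates a positive multiple of \<open>\<sigma>\<close>. As
  \<open>\<sigma>\<close> is stationary and positivity is preserved, \<open>PS t \<rho>\<close>
  dominates the same multiple.\<close>

lemma posdef_PS:
  assumes \<rho>: "posdef \<rho>" and t: "0 \<le> t" shows "posdef (PS t \<rho>)"
proof -
  obtain \<delta> where \<delta>: "0 < \<delta>" "lbd \<delta> \<rho>" using posdef_lbd[OF \<rho>] .
  define \<eta> where "\<eta> = \<delta> / (norm \<sigma> + 1)"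
  have \<eta>: "0 < \<eta>" using \<delta>(1) by (simp add: \<eta>_def add_nonneg_pos)
  have "norm \<sigma> + 1 \<noteq> 0" using norm_ge_zero[of \<sigma>] by linarith
  then have "\<eta> * (norm \<sigma> + 1) = \<delta>" by (simp add: \<eta>_def)
  then have "\<eta> * norm \<sigma> \<le> \<delta>" using \<eta> by (simp add: distrib_left)
  then have "lbd 0 (\<rho> - \<eta> *\<^sub>R \<sigma>)"
    using \<eta> \<rho> \<sigma>_posdef by (intro lbd_mono[OF lbd_perturb[OF \<delta>(2), of _ "\<eta> * norm \<sigma>"]])
      (auto simp: adj_simps posdef_inner)
  then have "lbd 0 (PS t \<rho> - \<eta> *\<^sub>R \<sigma>)"
    using lbd_PS[OF _ t, of "\<rho> - \<eta> *\<^sub>R \<sigma>"]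
    by (simp add: linear_diff[OF linear_exp_semigroup[OF linear_dgen]]
        linear_cmul[OF linear_exp_semigroup[OF linear_dgen]] PS_\<sigma>)
  then show ?thesis
    unfolding posdef_inner
  proof (intro conjI allI impI)
    show "adj (PS t \<rho>) = PS t \<rho>" using \<rho> by (simp add: adj_PS posdef_inner)
    fix x :: "complex^'n" assume "x \<noteq> 0"
    then have "0 < \<eta> * (x \<bullet> (\<sigma> *v x))" using \<eta> \<sigma>_posdef by (simp add: posdef_inner)
    also have "\<dots> \<le> x \<bullet> (PS t \<rho> *v x)"
      using \<open>lbd 0 (PS t \<rho> - \<eta> *\<^sub>R \<sigma>)\<close>
      by (simp add: lbd_def matrix_vector_mult_diff_rdistrib inner_diff_right scaleR_mv)
    finally show "0 < x \<bullet> (PS t \<rho> *v x)" .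
  qed
qed

lemma states_PS: "\<rho> \<in> states UNIV \<Longrightarrow> 0 \<le> t \<Longrightarrow> PS t \<rho> \<in> states UNIV"
  by (simp add: states_def posdef_PS trace_PS)

text \<open>With the jump term of \<open>tgen\<close> reversed, the difference of the two sides is a
  sum of squares of the anticommutators \<open>Y k\<close>; for \<open>gen\<close> in place of
  \<open>tgen\<close> commutators would appear.\<close>

lemma dissipation:
  assumes "lbd 0 R" shows "2 * (tgen B \<bullet> (B ** R)) \<le> gen (adj B ** B) \<bullet> R"
proof -
  have R: "adj R = R" using assms by (simp add: lbd_def)
  define Y where "Y k = B ** X k + X k ** B" for k
  have id: "gen (adj B ** B) - adj (tgen B) ** B - adj B ** tgen B =
      (\<Sum>k\<in>J. exp (- \<omega> k / 2) *\<^sub>R (2 *\<^sub>R (adj (Y k) ** Y k)))"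
    unfolding gen_eq tgen_def adj_sum mm_sum_left mm_sum_right sum_subtractf[symmetric]
    by (intro sum.cong refl) (simp only: Y_def adj_simps adj_adj mm_distribs matrix_mul_assoc scaleR_2 scaleR_right_distrib
        scaleR_diff_right scaleR_minus_right, simp add: algebra_simps)
  have "gen (adj B ** B) \<bullet> R - 2 * (tgen B \<bullet> (B ** R)) =
      (gen (adj B ** B) - adj (tgen B) ** B - adj B ** tgen B) \<bullet> R"
  proof -
    have "(adj (tgen B) ** B) \<bullet> R = (B ** R) \<bullet> tgen B"
      by (simp only: inner_mm_left[of "adj (tgen B)" B] inner_mm_right[of B R] adj_adj R)
    moreover have "(adj B ** tgen B) \<bullet> R = tgen B \<bullet> (B ** R)"
      by (simp add: inner_mm_left)
    ultimately show ?thesis by (simp add: inner_diff_left inner_diff_right inner_commute)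
  qed
  also have "\<dots> = (\<Sum>k\<in>J. exp (- \<omega> k / 2) * (2 * (Y k \<bullet> (Y k ** R))))"
    unfolding id inner_sum_left by (simp add: inner_mm_left[of "adj (Y _)"] mult.assoc)
  also have "0 \<le> \<dots>" by (intro sum_nonneg mult_nonneg_nonneg inner_weight_nonneg assms) auto
  finally show ?thesis by simp
qed

text \<open>The generator that governs one component of the gradient: \<open>tgen\<close> damped at
  the rate \<open>c\<close>.\<close>

definition sgen :: "real \<Rightarrow> 'n op \<Rightarrow> 'n op" where
  "sgen c B = tgen B - c *\<^sub>R B"

lemma linear_sgen: "linear (sgen c)"
  unfolding sgen_def using linear_tgen by (auto intro!: linear_compose_sub linear_scaleR)

text \<open>Interpolation in time: \<open>B\<close> evolves for time \<open>s\<close> and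
  \<open>\<rho>\<close> for the remaining \<open>t - s\<close>. By \<open>dissipation\<close> the
  undamped quantity \<open>\<phi>\<close> does not increase in \<open>s\<close>; its values at the
  ends of \<open>[0, t]\<close> are the two sides.\<close>

lemma schwarz_right:
  assumes \<rho>: "posdef \<rho>" and t: "0 \<le> t"
  shows "exp_semigroup (sgen c) t B \<bullet> (exp_semigroup (sgen c) t B ** \<rho>) \<le> exp (- 2 * c * t) * (B \<bullet> (B ** PS t \<rho>))"
proof -
  define C where "C s = exp_semigroup (sgen c) s B" for s
  define R where "R s = PS (t - s) \<rho>" for s
  define \<phi> where "\<phi> s = exp (2 * c * s) * (C s \<bullet> (C s ** R s))" for s
  have C': "(C has_vector_derivative sgen c (C s)) (at s)" for s
    unfolding C_def by (rule exp_semigroup_has_vector_derivative[OF linear_sgen])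
  have R': "(R has_vector_derivative - dgen (R s)) (at s)" for s
  proof -
    have "((\<lambda>s. t - s) has_real_derivative -1) (at s)" by (auto intro!: derivative_eq_intros)
    from exp_semigroup_chain[OF linear_dgen this has_vector_derivative_const[of \<rho>]]
    show ?thesis by (simp add: R_def[abs_def] linear_0[OF linear_exp_semigroup[OF linear_dgen]])
  qed
  have "\<phi> t \<le> \<phi> 0"
  proof (rule DERIV_nonpos_imp_nonincreasing[OF t])
    fix s assume s: "0 \<le> s" "s \<le> t"
    have "posdef (R s)" using posdef_PS[OF \<rho>, of "t - s"] s by (simp add: R_def)
    then obtain \<delta> where "0 < \<delta>" "lbd \<delta> (R s)" by (rule posdef_lbd)
    then have Rpos: "lbd 0 (R s)" by (auto intro: lbd_mono)
    have Rsa: "adj (R s) = R s" using Rpos by (simp add: lbd_def)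
    have "((\<lambda>s. C s \<bullet> (C s ** R s)) has_vector_derivative
        C s \<bullet> (C s ** (- dgen (R s)) + sgen c (C s) ** R s) + sgen c (C s) \<bullet> (C s ** R s)) (at s)"
      by (intro bounded_bilinear.has_vector_derivative[OF bounded_bilinear_inner] has_vector_derivative_mm C' R')
    then have "((\<lambda>s. C s \<bullet> (C s ** R s)) has_real_derivative
        C s \<bullet> (C s ** (- dgen (R s)) + sgen c (C s) ** R s) + sgen c (C s) \<bullet> (C s ** R s)) (at s)"
      by (simp add: has_real_derivative_iff_has_vector_derivative)
    moreover have "((\<lambda>s. exp (2 * c * s)) has_real_derivative 2 * c * exp (2 * c * s)) (at s)"
      by (auto intro!: derivative_eq_intros)
    ultimately have "(\<phi> has_real_derivative 2 * c * exp (2 * c * s) * (C s \<bullet> (C s ** R s)) +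
       (C s \<bullet> (C s ** (- dgen (R s)) + sgen c (C s) ** R s) + sgen c (C s) \<bullet> (C s ** R s)) * exp (2 * c * s)) (at s)"
      unfolding \<phi>_def[abs_def] by (intro DERIV_mult)
    moreover have "2 * c * exp (2 * c * s) * (C s \<bullet> (C s ** R s)) +
       (C s \<bullet> (C s ** (- dgen (R s)) + sgen c (C s) ** R s) + sgen c (C s) \<bullet> (C s ** R s)) * exp (2 * c * s) =
       exp (2 * c * s) * (2 * (tgen (C s) \<bullet> (C s ** R s)) - gen (adj (C s) ** C s) \<bullet> R s)"
    proof -
      have "C s \<bullet> (sgen c (C s) ** R s) = sgen c (C s) \<bullet> (C s ** R s)"
        using inner_mm_right[of "C s" "R s" "sgen c (C s)"] by (simp add: Rsa inner_commute)
      moreover have "sgen c (C s) \<bullet> (C s ** R s) = tgen (C s) \<bullet> (C s ** R s) - c * (C s \<bullet> (C s ** R s))"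
        by (simp add: sgen_def inner_diff_left)
      moreover have "C s \<bullet> (C s ** (- dgen (R s))) = - (gen (adj (C s) ** C s) \<bullet> R s)"
        by (simp add: inner_gen inner_mm_left mm_minus_right)
      ultimately show ?thesis
        by (simp only: inner_add_right) (simp add: algebra_simps)
    qed
    ultimately show "\<exists>y. (\<phi> has_real_derivative y) (at s) \<and> y \<le> 0"
      using dissipation[OF Rpos, of "C s"] by (auto simp: mult_le_0_iff)
  qed
  then have "exp (- 2 * c * t) * \<phi> t \<le> exp (- 2 * c * t) * \<phi> 0" by (intro mult_left_mono) auto
  moreover have "exp (- 2 * c * t) * \<phi> t = C t \<bullet> (C t ** \<rho>)"
    by (simp add: \<phi>_def R_def exp_semigroup_0[OF linear_dgen] flip: mult.assoc exp_add)
  moreover have "\<phi> 0 = B \<bullet> (B ** PS t \<rho>)"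
    by (simp add: \<phi>_def R_def C_def exp_semigroup_0[OF linear_sgen])
  ultimately show ?thesis by (simp only: C_def)
qed

text \<open>Taking adjoints exchanges left and right weights and commutes with the semigroup of
  \<open>sgen c\<close>.\<close>

lemma schwarz_left:
  assumes \<rho>: "posdef \<rho>" and t: "0 \<le> t"
  shows "exp_semigroup (sgen c) t B \<bullet> (\<rho> ** exp_semigroup (sgen c) t B) \<le> exp (- 2 * c * t) * (B \<bullet> (PS t \<rho> ** B))"
proof -
  have *: "adj (exp_semigroup (sgen c) t B) = exp_semigroup (sgen c) t (adj B)"
    by (rule exp_semigroup_commute[OF linear_sgen linear_sgen linear_adj]) (simp add: sgen_def adj_simps adj_tgen)
  have **: "D \<bullet> (R ** D) = adj D \<bullet> (adj D ** R)" if "posdef R" for D R :: "'n op"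
    using that inner_adj_adj[of D "R ** D"] by (simp add: adj_mm posdef_inner)
  show ?thesis
    unfolding **[OF \<rho>] **[OF posdef_PS[OF \<rho> t]] * by (rule schwarz_right[OF assms])
qed

lemma twisted_mult_decay:
  assumes \<rho>: "posdef \<rho>" and t: "0 \<le> t"
  shows "exp_semigroup (sgen c) t B \<bullet> twisted_mult \<rho> w (exp_semigroup (sgen c) t B) \<le>
    exp (- 2 * c * t) * (B \<bullet> twisted_mult (PS t \<rho>) w B)"
proof -
  interpret weighted_contraction "exp_semigroup (sgen c) t" \<rho> "PS t \<rho>" "exp (- 2 * c * t)"
    by (rule weighted_contraction.intro[OF linear_exp_semigroup[OF linear_sgen] _ \<rho> posdef_PS[OF \<rho> t]
          schwarz_right[OF assms] schwarz_left[OF assms]]) simp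
  show ?thesis by (rule twisted_mult_contraction)
qed

end

section \<open>The Riemannian metric\<close>

lemma subspace_traceless_sa: "subspace (traceless_sa (UNIV :: 'n::finite op set))"
  by (auto simp: subspace_def traceless_sa_def selfadjoint_def adj_simps trace_add trace_scaleR)
    (simp add: trace_def)

context qms
begin

text \<open>The map from potentials to tangent vectors. \<open>potential\<close> is its inverse on
  traceless self-adjoint operators, and the metric is the inverse quadratic form.\<close>

definition onsager :: "'n op \<Rightarrow> 'n op \<Rightarrow> 'n op" where
  "onsager \<rho> U = - nc_div J X (\<lambda>k. twisted_mult \<rho> (\<omega> k) (nc_grad X U k))"

abbreviation "TS \<equiv> traceless_sa (UNIV :: 'n op set)"
abbreviation "pot \<rho> T \<equiv> potential UNIV J X \<omega> \<rho> T"
abbreviation "met \<equiv> qms_metric UNIV J X \<omega>"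

lemma nc_grad_comm: "nc_grad X U k = comm (X k) U"
  by (simp add: nc_grad_def)

lemma linear_onsager:
  assumes "posdef \<rho>" shows "linear (onsager \<rho>)"
  by (intro linearI)
    (simp_all add: onsager_def nc_div_def nc_grad_comm linear_add[OF linear_comm] linear_cmul[OF linear_comm]
      linear_add[OF linear_twisted_mult[OF assms]] linear_cmul[OF linear_twisted_mult[OF assms]]
      comm_def[of _ "adj _"] mm_distribs algebra_simps sum.distrib sum_subtractf scaleR_sum_right)

lemma inner_onsager:
  "U \<bullet> onsager \<rho> V = (\<Sum>k\<in>J. comm (X k) U \<bullet> twisted_mult \<rho> (\<omega> k) (comm (X k) V))"
proof -
  have "comm (X k) U \<bullet> B = - (U \<bullet> comm B (adj (X k)))" for k B
    by (simp add: inner_comm) (simp add: comm_def inner_diff_right)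
  then show ?thesis
    by (simp add: onsager_def nc_div_def nc_grad_comm inner_sum_right sum_negf)
qed

lemma inner_onsager_sym:
  assumes "posdef \<rho>" shows "U \<bullet> onsager \<rho> V = onsager \<rho> U \<bullet> V"
  unfolding inner_commute[of "onsager \<rho> U"] inner_onsager
  by (intro sum.cong refl) (metis inner_twisted_mult_sym[OF assms] inner_commute)

lemma inner_onsager_nonneg:
  assumes "posdef \<rho>" shows "0 \<le> U \<bullet> onsager \<rho> U"
  unfolding inner_onsager by (intro sum_nonneg inner_twisted_mult_pos assms)

text \<open>The adjoint of the term for \<open>k\<close> is the term for \<open>star k\<close>: the
  adjoint reverses the twist and \<open>star\<close> reverses the frequency.\<close>

lemma adj_onsager:
  assumes "posdef \<rho>" shows "adj (onsager \<rho> U) = onsager \<rho> (adj U)"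
proof -
  define a where "a k = comm (twisted_mult \<rho> (\<omega> k) (comm (X k) (adj U))) (adj (X k))" for k
  have neg: "twisted_mult \<rho> w (- A) = - twisted_mult \<rho> w A" for w A
    by (rule linear_neg[OF linear_twisted_mult[OF assms]])
  have "adj (comm (twisted_mult \<rho> (\<omega> k) (comm (X k) U)) (adj (X k))) = a (star k)" if "k \<in> J" for k
  proof -
    have "comm (adj U) (adj (X k)) = - comm (X (star k)) (adj U)" using that by (simp add: comm_def star)
    then show ?thesis
      using that by (simp add: adj_comm adj_twisted_mult[OF assms] a_def star neg)
        (simp add: comm_def mm_distribs star)
  qed
  then show ?thesis
    by (simp add: onsager_def nc_div_def nc_grad_comm adj_minus adj_sum sum_star[of a] flip: a_def)
qed

lemma trace_onsager: "trace (onsager \<rho> U) = 0"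
  unfolding onsager_def nc_div_def by (simp add: linear_neg[OF linear_trace] linear_sum[OF linear_trace] trace_comm)

lemma onsager_TS: "posdef \<rho> \<Longrightarrow> U \<in> TS \<Longrightarrow> onsager \<rho> U \<in> TS"
  by (simp add: traceless_sa_def selfadjoint_def adj_onsager trace_onsager)

lemma onsager_eq_0:
  assumes \<rho>: "posdef \<rho>" and U: "U \<in> TS" and 0: "U \<bullet> onsager \<rho> U = 0" shows "U = 0"
proof -
  have "comm (X k) U = 0" if "k \<in> J" for k
    using 0 that inner_twisted_mult_pos[OF \<rho>] fin unfolding inner_onsager
    by (subst (asm) sum_nonneg_eq_0_iff) auto
  then obtain c where c: "U = c *\<^sub>C mat 1" using irreducible by blast
  have "trace U = c * CARD('n)" by (simp add: c trace_cscale trace_I)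
  then have "c = 0" using U by (simp add: traceless_sa_def)
  then show ?thesis by (simp add: c cscale_def vec_eq_iff)
qed

text \<open>Injectivity is irreducibility, since a traceless scalar vanishes; surjectivity is a
  dimension count. Together they make the definite description in \<open>potential\<close>
  meaningful.\<close>

lemma onsager_bij:
  assumes \<rho>: "posdef \<rho>" shows "inj_on (onsager \<rho>) TS" "onsager \<rho> ` TS = TS"
proof -
  note lin = linear_onsager[OF \<rho>]
  show inj: "inj_on (onsager \<rho>) TS"
    unfolding linear_injective_on_subspace_0[OF lin subspace_traceless_sa]
    using onsager_eq_0[OF \<rho>] by auto
  show "onsager \<rho> ` TS = TS"
  proof (rule subspace_dim_equal[OF linear_subspace_image[OF lin subspace_traceless_sa] subspace_traceless_sa])
    show "onsager \<rho> ` TS \<subseteq> TS" using onsager_TS[OF \<rho>] by auto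
    have "inj_on (onsager \<rho>) (span TS)" using inj by (simp add: span_eq_iff[THEN iffD2, OF subspace_traceless_sa])
    then show "dim TS \<le> dim (onsager \<rho> ` TS)" by (simp add: dim_image_eq[OF lin])
  qed
qed

section \<open>The metric as the inverse of the Onsager form\<close>

lemma pot:
  assumes \<rho>: "posdef \<rho>" and T: "T \<in> TS" shows "pot \<rho> T \<in> TS" "onsager \<rho> (pot \<rho> T) = T"
proof -
  obtain U where U: "U \<in> TS" "T = onsager \<rho> U" using onsager_bij(2)[OF \<rho>] T by blast
  have "pot \<rho> T = U"
    unfolding potential_def onsager_def[symmetric]
    by (rule the_equality) (use U onsager_bij(1)[OF \<rho>] in \<open>auto dest: inj_onD\<close>)
  with U show "pot \<rho> T \<in> TS" "onsager \<rho> (pot \<rho> T) = T" by simp_all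
qed

lemma met_onsager: "met \<rho> S T = pot \<rho> S \<bullet> onsager \<rho> (pot \<rho> T)"
  by (simp add: qms_metric_def inner_onsager nc_grad_comm flip: inner_op)

lemma met_pot:
  assumes "posdef \<rho>" "T \<in> TS" shows "met \<rho> S T = pot \<rho> S \<bullet> T"
  by (simp add: met_onsager pot(2)[OF assms])

lemma met_sym:
  assumes \<rho>: "posdef \<rho>" and "S \<in> TS" "T \<in> TS" shows "met \<rho> S T = met \<rho> T S"
  using inner_onsager_sym[OF \<rho>, of "pot \<rho> S" "pot \<rho> T"] assms
  by (simp add: met_pot pot inner_commute)

lemma met_add:
  assumes \<rho>: "posdef \<rho>" and "S \<in> TS" "T \<in> TS" "R \<in> TS"
  shows "met \<rho> R (S + T) = met \<rho> R S + met \<rho> R T"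
  using assms subspace_add[OF subspace_traceless_sa assms(2,3)] by (simp add: met_pot inner_add_right)

lemma met_scaleR:
  assumes \<rho>: "posdef \<rho>" and "S \<in> TS" "R \<in> TS"
  shows "met \<rho> R (c *\<^sub>R S) = c * met \<rho> R S"
  using assms subspace_scale[OF subspace_traceless_sa assms(2)] by (simp add: met_pot)

lemma met_nonneg: "posdef \<rho> \<Longrightarrow> 0 \<le> met \<rho> T T"
  by (simp add: met_onsager inner_onsager_nonneg)

lemma met_eq_0:
  assumes \<rho>: "posdef \<rho>" and T: "T \<in> TS" and "met \<rho> T T = 0" shows "T = 0"
  using assms onsager_eq_0[OF \<rho> pot(1)[OF \<rho> T]] pot(2)[OF \<rho> T]
  by (simp add: met_onsager linear_0[OF linear_onsager[OF \<rho>]])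

lemma dgen_TS: "adj \<rho> = \<rho> \<Longrightarrow> dgen \<rho> \<in> TS"
  by (simp add: traceless_sa_def selfadjoint_def adj_dgen trace_dgen)

lemma PS_TS: "T \<in> TS \<Longrightarrow> PS t T \<in> TS"
  by (simp add: traceless_sa_def selfadjoint_def adj_PS trace_PS)

text \<open>In a traceless direction \<open>T\<close> the differential of the relative entropy is
  \<open>T \<bullet> (mfun ln \<rho> - mfun ln \<sigma>)\<close>. Thus \<open>dgen \<rho>\<close> is
  minus its Riemannian gradient.\<close>

lemma met_dgen:
  assumes \<rho>: "posdef \<rho>" and T: "T \<in> TS"
  shows "met \<rho> (dgen \<rho>) T = - (T \<bullet> (mfun ln \<rho> - mfun ln \<sigma>))"
proof -
  let ?D = "mfun ln \<rho> - mfun ln \<sigma>"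
  have d: "dgen \<rho> \<in> TS" using \<rho> by (intro dgen_TS) (simp add: posdef_inner)
  have "met \<rho> (dgen \<rho>) T = pot \<rho> T \<bullet> dgen \<rho>" using met_sym[OF \<rho> d T] met_pot[OF \<rho> d] by simp
  also have "\<dots> = pot \<rho> T \<bullet> - onsager \<rho> ?D" by (simp add: onsager_def dgen_gradient_flow[OF \<rho>])
  also have "\<dots> = - (T \<bullet> ?D)"
    by (simp add: inner_onsager_sym[OF \<rho>] pot(2)[OF \<rho> T])
  finally show ?thesis .
qed

end

text \<open>\<open>c k\<close> is the damping rate of the \<open>k\<close>-th component of the
  gradient and \<open>lam\<close> a common lower bound. Positivity of \<open>lam\<close> yields
  convergence to \<open>\<sigma>\<close>.\<close>

locale intertwined_qms = qms J X \<omega> star \<sigma>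
  for J :: "'k set" and X :: "'k \<Rightarrow> 'n::finite op" and \<omega> star \<sigma> +
  fixes c :: "'k \<Rightarrow> real" and lam :: real
  assumes intertwine: "\<And>k A. k \<in> J \<Longrightarrow> comm (X k) (gen A) = sgen (c k) (comm (X k) A)"
    and lam: "0 < lam" "\<And>k. k \<in> J \<Longrightarrow> lam \<le> c k"
begin

lemma comm_PH: "k \<in> J \<Longrightarrow> comm (X k) (PH t A) = exp_semigroup (sgen (c k)) t (comm (X k) A)"
  by (rule exp_semigroup_commute[OF linear_gen linear_sgen linear_comm intertwine])

text \<open>The gradient estimate dual to \<open>met_contraction\<close>. Each component of the
  gradient evolves under its own \<open>sgen (c k)\<close>, so the decay holds term by term.\<close>

lemma onsager_PH:
  assumes \<rho>: "posdef \<rho>" and t: "0 \<le> t"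
  shows "PH t U \<bullet> onsager \<rho> (PH t U) \<le> exp (- 2 * lam * t) * (U \<bullet> onsager (PS t \<rho>) U)"
  unfolding inner_onsager sum_distrib_left
proof (rule sum_mono)
  fix k assume k: "k \<in> J"
  let ?C = "comm (X k) U"
  have "comm (X k) (PH t U) \<bullet> twisted_mult \<rho> (\<omega> k) (comm (X k) (PH t U)) \<le>
      exp (- 2 * c k * t) * (?C \<bullet> twisted_mult (PS t \<rho>) (\<omega> k) ?C)"
    unfolding comm_PH[OF k] by (rule twisted_mult_decay[OF \<rho> t])
  also have "\<dots> \<le> exp (- 2 * lam * t) * (?C \<bullet> twisted_mult (PS t \<rho>) (\<omega> k) ?C)"
    using lam(2)[OF k] t by (intro mult_right_mono inner_twisted_mult_pos posdef_PS \<rho>) (auto intro: mult_right_mono)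
  finally show "comm (X k) (PH t U) \<bullet> twisted_mult \<rho> (\<omega> k) (comm (X k) (PH t U)) \<le>
      exp (- 2 * lam * t) * (?C \<bullet> twisted_mult (PS t \<rho>) (\<omega> k) ?C)" .
qed

text \<open>Duality: contraction of a quadratic form under \<open>PH t\<close> is contraction of the
  inverse form under \<open>PS t\<close>. Nonnegativity of the Onsager form at
  \<open>V - \<mu> *\<^sub>R U\<close> is Cauchy-Schwarz between \<open>V\<close> and
  \<open>U\<close>, with \<open>\<mu>\<close> as the optimal scale.\<close>

theorem met_contraction:
  assumes \<rho>: "posdef \<rho>" and t: "0 \<le> t" and T: "T \<in> TS"
  shows "met (PS t \<rho>) (PS t T) (PS t T) \<le> exp (- 2 * lam * t) * met \<rho> T T"
proof -
  define \<mu> where "\<mu> = exp (- 2 * lam * t)"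
  define U where "U = pot \<rho> T"
  define V where "V = PH t (pot (PS t \<rho>) (PS t T))"
  define a where "a = met (PS t \<rho>) (PS t T) (PS t T)"
  have \<rho>': "posdef (PS t \<rho>)" by (rule posdef_PS[OF \<rho> t])
  have a: "a = V \<bullet> onsager \<rho> U"
    by (simp add: a_def met_pot[OF \<rho>' PS_TS[OF T]] V_def U_def pot(2)[OF \<rho> T]
        exp_semigroup_inner[OF linear_gen linear_dgen inner_gen])
  have V: "V \<bullet> onsager \<rho> V \<le> \<mu> * a"
    using onsager_PH[OF \<rho> t] by (simp add: V_def a_def met_onsager \<mu>_def)
  have "0 \<le> (V - \<mu> *\<^sub>R U) \<bullet> onsager \<rho> (V - \<mu> *\<^sub>R U)" by (rule inner_onsager_nonneg[OF \<rho>])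
  also have "\<dots> = V \<bullet> onsager \<rho> V - 2 * \<mu> * a + \<mu> * \<mu> * met \<rho> T T"
    using inner_onsager_sym[OF \<rho>, of V U]
    by (simp add: linear_diff[OF linear_onsager[OF \<rho>]] linear_cmul[OF linear_onsager[OF \<rho>]]
        inner_diff_left inner_diff_right a met_onsager U_def[symmetric] inner_commute[of U] algebra_simps)
  also have "\<dots> \<le> \<mu> * (\<mu> * met \<rho> T T - a)" using V by (simp add: algebra_simps)
  finally have "0 \<le> \<mu> * met \<rho> T T - a" by (simp add: zero_le_mult_iff \<mu>_def)
  then show ?thesis by (simp add: a_def \<mu>_def)
qed

section \<open>Exponential decay of the relative entropy\<close>

text \<open>Each coefficient \<open>B \<bullet> PS t a\<close> is the Onsager pairing at
  \<open>\<sigma>\<close> of \<open>PH t B\<close> with the potential \<open>U\<close> of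
  \<open>a\<close>. As \<open>\<sigma>\<close> is stationary, the gradient estimate makes the form
  at \<open>PH t B\<close> decay; the factor \<open>r\<close> balances the two sides of the
  resulting bound.\<close>

lemma PS_tendsto:
  assumes \<rho>: "\<rho> \<in> states UNIV" shows "((\<lambda>t. PS t \<rho>) \<longlongrightarrow> \<sigma>) at_top"
proof -
  define a where "a = \<rho> - \<sigma>"
  have a: "a \<in> TS"
    using \<rho> \<sigma>_posdef by (simp add: a_def traceless_sa_def selfadjoint_def adj_simps states_def posdef_inner trace_sub trace_\<sigma>)
  define U where "U = pot \<sigma> a"
  have U: "onsager \<sigma> U = a" unfolding U_def by (rule pot(2)[OF \<sigma>_posdef a])
  have b: "B \<bullet> PS t a \<le> exp (- lam * t) * ((B \<bullet> onsager \<sigma> B + U \<bullet> onsager \<sigma> U) / 2)" if "0 \<le> t" for t B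
  proof -
    define r where "r = exp (lam * t)"
    have r: "0 < r" by (simp add: r_def)
    let ?V = "r *\<^sub>R PH t B"
    have "0 \<le> (?V - U) \<bullet> onsager \<sigma> (?V - U)" by (rule inner_onsager_nonneg[OF \<sigma>_posdef])
    also have "\<dots> = r * r * (PH t B \<bullet> onsager \<sigma> (PH t B)) - 2 * r * (PH t B \<bullet> a) + U \<bullet> onsager \<sigma> U"
      using inner_onsager_sym[OF \<sigma>_posdef, of "PH t B" U]
      by (simp add: linear_diff[OF linear_onsager[OF \<sigma>_posdef]] linear_cmul[OF linear_onsager[OF \<sigma>_posdef]]
        inner_diff_left inner_diff_right U[symmetric] inner_commute[of U] algebra_simps)
    also have "PH t B \<bullet> a = B \<bullet> PS t a" by (rule exp_semigroup_inner[OF linear_gen linear_dgen inner_gen])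
    also have "r * r * (PH t B \<bullet> onsager \<sigma> (PH t B)) \<le> r * r * (exp (- 2 * lam * t) * (B \<bullet> onsager \<sigma> B))"
      using onsager_PH[OF \<sigma>_posdef that, of B] by (intro mult_left_mono) (simp_all add: PS_\<sigma>)
    also have "r * r * (exp (- 2 * lam * t) * (B \<bullet> onsager \<sigma> B)) = B \<bullet> onsager \<sigma> B"
      by (simp add: r_def flip: mult.assoc exp_add)
    finally have "r * (B \<bullet> PS t a) \<le> (B \<bullet> onsager \<sigma> B + U \<bullet> onsager \<sigma> U) / 2" by simp
    then have "exp (- lam * t) * (r * (B \<bullet> PS t a)) \<le> exp (- lam * t) * ((B \<bullet> onsager \<sigma> B + U \<bullet> onsager \<sigma> U) / 2)"
      by (intro mult_left_mono) auto
    then show ?thesis by (simp add: r_def flip: mult.assoc exp_add)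
  qed
  have "((\<lambda>t. PS t a \<bullet> B) \<longlongrightarrow> 0) at_top" for B
  proof (rule Lim_null_comparison)
    have "filterlim (\<lambda>t. - lam * t) at_bot at_top"
      using lam(1) by (intro filterlim_tendsto_neg_mult_at_bot[OF tendsto_const _ filterlim_ident]) auto
    then have "((\<lambda>t. exp (- lam * t)) \<longlongrightarrow> 0) at_top" by (rule filterlim_compose[OF exp_at_bot])
    from tendsto_mult_left_zero[OF this]
    show "((\<lambda>t. exp (- lam * t) * ((B \<bullet> onsager \<sigma> B + U \<bullet> onsager \<sigma> U) / 2)) \<longlongrightarrow> 0) at_top" .
    show "eventually (\<lambda>t. norm (PS t a \<bullet> B) \<le> exp (- lam * t) * ((B \<bullet> onsager \<sigma> B + U \<bullet> onsager \<sigma> U) / 2)) at_top"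
      using eventually_ge_at_top[of 0]
    proof eventually_elim
      case (elim t)
      have "B \<bullet> onsager \<sigma> (- B) = - (B \<bullet> onsager \<sigma> B)"
        by (simp add: linear_neg[OF linear_onsager[OF \<sigma>_posdef]])
      with b[OF elim, of B] b[OF elim, of "- B"] show ?case
        by (simp add: inner_commute[of "PS t a"] abs_le_iff)
    qed
  qed
  then have "((\<lambda>t. PS t a) \<longlongrightarrow> 0) at_top" by (subst tendsto_componentwise_iff) simp
  moreover have "PS t a = PS t \<rho> - \<sigma>" for t
    by (simp add: a_def linear_diff[OF linear_exp_semigroup[OF linear_dgen]] PS_\<sigma>)
  ultimately show ?thesis by (simp add: LIM_zero_iff)
qed

lemma rel_entropy_eq: "posdef \<rho> \<Longrightarrow> rel_entropy \<rho> \<sigma> = \<rho> \<bullet> (mfun ln \<rho> - mfun ln \<sigma>)"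
  by (simp add: rel_entropy_def inner_op posdef_inner)

lemma rel_entropy_PS_tendsto:
  assumes \<rho>: "\<rho> \<in> states UNIV" shows "((\<lambda>t. rel_entropy (PS t \<rho>) \<sigma>) \<longlongrightarrow> 0) at_top"
proof -
  have p: "posdef (PS t \<rho>)" if "0 \<le> t" for t using \<rho> that by (simp add: states_def posdef_PS)
  have "((\<lambda>t. mfun ln (PS t \<rho>)) \<longlongrightarrow> mfun ln \<sigma>) at_top"
  proof (rule continuous_on_tendsto_compose[OF continuous_on_mfun_ln PS_tendsto[OF \<rho>]])
    show "eventually (\<lambda>t. PS t \<rho> \<in> {A. posdef A}) at_top"
      using eventually_ge_at_top[of 0] by eventually_elim (simp add: p)
  qed (simp add: \<sigma>_posdef)
  then have "((\<lambda>t. PS t \<rho> \<bullet> (mfun ln (PS t \<rho>) - mfun ln \<sigma>)) \<longlongrightarrow> \<sigma> \<bullet> (mfun ln \<sigma> - mfun ln \<sigma>)) at_top"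
    by (intro tendsto_intros PS_tendsto \<rho>)
  then have "((\<lambda>t. PS t \<rho> \<bullet> (mfun ln (PS t \<rho>) - mfun ln \<sigma>)) \<longlongrightarrow> 0) at_top" by simp
  then show ?thesis
    by (rule Lim_transform_eventually)
      (use eventually_ge_at_top[of 0] in eventually_elim, simp add: rel_entropy_eq p)
qed

lemma rel_entropy_PS_derivative:
  assumes \<rho>: "\<rho> \<in> states UNIV" and s: "0 \<le> s"
  shows "((\<lambda>t. rel_entropy (PS t \<rho>) \<sigma>) has_real_derivative
    - met (PS s \<rho>) (dgen (PS s \<rho>)) (dgen (PS s \<rho>))) (at s within {0..})"
proof -
  have p: "posdef (PS t \<rho>)" if "0 \<le> t" for t using \<rho> that by (simp add: states_def posdef_PS)
  have d: "dgen (PS s \<rho>) \<in> TS" using p[OF s] by (intro dgen_TS) (simp add: posdef_inner)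
  have "((\<lambda>t. rel_entropy (PS t \<rho>) \<sigma>) has_real_derivative
     dgen (PS s \<rho>) \<bullet> (mfun ln (PS s \<rho>) - mfun ln \<sigma>) + Re (trace (dgen (PS s \<rho>)))) (at s within {0..})"
    using s p \<sigma>_posdef
    by (intro has_real_derivative_entropy exp_semigroup_has_vector_derivative linear_dgen) (auto simp: posdef_inner)
  then show ?thesis by (simp add: met_dgen[OF p[OF s] d] trace_dgen)
qed

theorem rel_entropy_decay:
  assumes \<rho>: "\<rho> \<in> states UNIV" and t: "0 \<le> t"
  shows "rel_entropy (PS t \<rho>) \<sigma> \<le> exp (- 2 * lam * t) * rel_entropy \<rho> \<sigma>"
proof -
  define f where "f s = rel_entropy (PS s \<rho>) \<sigma>" for s
  define I where "I s = met (PS s \<rho>) (dgen (PS s \<rho>)) (dgen (PS s \<rho>))" for s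
  \<comment> \<open>\<open>h\<close> compares the orbit with its shift by \<open>t\<close>. Its
    derivative \<open>I (s + t) - exp (- 2 * lam * t) * I s\<close> is nonpositive and its limit at
    infinity is 0, hence \<open>0 \<le> h 0\<close>.\<close>
  define h where "h s = exp (- 2 * lam * t) * f s - f (s + t)" for s
  have p: "posdef (PS s \<rho>)" if "0 \<le> s" for s using \<rho> that by (simp add: states_def posdef_PS)
  have f': "(f has_real_derivative - I s) (at s within {0..})" if "0 \<le> s" for s
    unfolding f_def[abs_def] I_def using rel_entropy_PS_derivative[OF \<rho> that] .
  have I_le: "I (s + t) \<le> exp (- 2 * lam * t) * I s" if "0 \<le> s" for s
  proof -
    have "PS (s + t) \<rho> = PS t (PS s \<rho>)" using exp_semigroup_add[OF linear_dgen, of t s] by (simp add: add.commute)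
    then show ?thesis
      using met_contraction[OF p[OF that] t dgen_TS] p[OF that]
      by (simp add: I_def exp_semigroup_gen[OF linear_dgen] posdef_inner)
  qed
  have cont: "continuous_on {0..} f"
    using f' by (auto simp: continuous_on_eq_continuous_within intro: DERIV_continuous)
  have "h b \<le> h 0" if "0 \<le> b" for b
  proof (rule DERIV_nonpos_imp_decreasing_open[OF that])
    show "continuous_on {0..b} h"
      unfolding h_def[abs_def] using t
      by (intro continuous_intros continuous_on_subset[OF cont] continuous_on_compose2[OF cont]) auto
    fix s assume s: "0 < s" "s < b"
    have "at s within {0..} = at s" "at (s + t) within {0..} = at (s + t)"
      using s t by (auto intro!: at_within_interior)
    with f'[of s] f'[of "s + t"] s t have d: "(f has_real_derivative - I s) (at s)"
      "(f has_real_derivative - I (s + t)) (at (s + t))" by auto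
    have "(h has_real_derivative exp (- 2 * lam * t) * - I s - - I (s + t)) (at s)"
      unfolding h_def[abs_def]
      by (intro DERIV_diff DERIV_cmult d(1) d(2)[unfolded DERIV_shift[of f _ s t]])
    then show "\<exists>y. (h has_real_derivative y) (at s) \<and> y \<le> 0"
      using I_le[of s] s by (intro exI conjI) auto
  qed
  moreover have "(h \<longlongrightarrow> 0) at_top"
  proof -
    have "(f \<longlongrightarrow> 0) at_top" unfolding f_def[abs_def] by (rule rel_entropy_PS_tendsto[OF \<rho>])
    moreover have "((\<lambda>s. f (s + t)) \<longlongrightarrow> 0) at_top"
      by (rule filterlim_compose[OF calculation filterlim_tendsto_add_at_top[OF tendsto_const filterlim_ident, of t, simplified add.commute]])
    ultimately have "(h \<longlongrightarrow> exp (- 2 * lam * t) * 0 - 0) at_top"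
      unfolding h_def[abs_def] by (intro tendsto_intros)
    then show ?thesis by simp
  qed
  ultimately have "0 \<le> h 0"
    by (intro tendsto_upperbound[of h 0 at_top]) (auto intro!: eventually_mono[OF eventually_ge_at_top[of 0]])
  then show ?thesis by (simp add: h_def f_def exp_semigroup_0[OF linear_dgen])
qed

end

section \<open>Geodesic convexity of the relative entropy\<close>

lemma linear_constant_derivative:
  fixes \<gamma> :: "real \<Rightarrow> 'a::euclidean_space" and h :: "'a \<Rightarrow> 'b::euclidean_space"
  assumes h: "linear h" and d: "(\<gamma> has_vector_derivative v) (at s within {0..1})" and s: "s \<in> {0..1}"
    and const: "\<And>r. r \<in> {0..1} \<Longrightarrow> h (\<gamma> r) = a"
  shows "h v = 0"
proof -
  have 1: "((\<lambda>r. h (\<gamma> r)) has_vector_derivative h v) (at s within cbox 0 1)"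
    using bounded_linear.has_vector_derivative[OF h[unfolded linear_conv_bounded_linear] d] by simp
  have 2: "((\<lambda>r. h (\<gamma> r)) has_vector_derivative 0) (at s within cbox 0 1)"
    by (rule has_vector_derivative_transform[where f = "\<lambda>_. a"]) (use s const in auto)
  show ?thesis
    using vector_derivative_unique_within_closed_interval[OF _ _ 1 2] s by simp
qed

lemma velocity_states:
  assumes d: "(\<gamma> has_vector_derivative v) (at s within {0..1})" and s: "s \<in> {0..1}"
    and \<gamma>: "\<gamma> ` {0..1} \<subseteq> states (UNIV :: 'n::finite op set)"
  shows "v \<in> traceless_sa UNIV"
proof -
  have "adj v - v = 0"
    using \<gamma> by (intro linear_constant_derivative[OF linear_compose_sub[OF linear_adj linear_ident] d s, of 0])
      (auto simp: states_def posdef_inner image_subset_iff)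
  moreover have "trace v = 0"
    using \<gamma> by (intro linear_constant_derivative[OF linear_trace d s, of 1]) (auto simp: states_def image_subset_iff)
  ultimately show ?thesis by (simp add: traceless_sa_def selfadjoint_def)
qed

lemma velocity_eq:
  assumes "(\<gamma> has_vector_derivative v) (at s within {0..1})" "s \<in> {0..1}"
  shows "velocity \<gamma> s = v"
  using vector_derivative_within_cbox[of 0 1 s \<gamma> v] assms by (simp add: velocity_def)

text \<open>A nonnegative test function concentrated on the interval of radius \<open>d\<close>
  around \<open>s\<close>. The outer square makes the positive part continuously
  differentiable.\<close>

definition bump :: "real \<Rightarrow> real \<Rightarrow> real \<Rightarrow> real" where
  "bump s d r = (max 0 (d\<^sup>2 - (r - s)\<^sup>2))\<^sup>2"

definition bump' :: "real \<Rightarrow> real \<Rightarrow> real \<Rightarrow> real" where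
  "bump' s d r = - 4 * (r - s) * max 0 (d\<^sup>2 - (r - s)\<^sup>2)"

lemma bump_has_derivative: "(bump s d has_real_derivative bump' s d r) (at r within S)"
proof -
  have sq: "((\<lambda>x::real. (max 0 x)\<^sup>2) has_real_derivative 2 * max 0 x) (at x)" for x
  proof -
    consider "x = 0" | "0 < x" | "x < 0" by linarith
    then show ?thesis
    proof cases
      case 1
      have "\<exists>g. (\<forall>w. (max 0 w)\<^sup>2 - (max 0 x)\<^sup>2 = g w * (w - x)) \<and> isCont g x \<and> g x = 2 * max 0 x"
        by (rule exI[of _ "max 0"]) (auto simp: 1 max_def power2_eq_square intro!: continuous_max)
      then show ?thesis by (simp add: CARAT_DERIV)
    next
      case 2
      have "((\<lambda>x::real. x\<^sup>2) has_real_derivative 2 * x) (at x)" by (auto intro!: derivative_eq_intros)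
      then have "((\<lambda>x::real. (max 0 x)\<^sup>2) has_real_derivative 2 * x) (at x)"
        by (rule has_field_derivative_transform_within_open[where S = "{0<..}"]) (use 2 in auto)
      then show ?thesis using 2 by simp
    next
      case 3
      have "((\<lambda>x::real. (max 0 x)\<^sup>2) has_real_derivative 0) (at x)"
        by (rule has_field_derivative_transform_within_open[where S = "{..<0}" and f = "\<lambda>_. 0"]) (use 3 in auto)
      then show ?thesis using 3 by simp
    qed
  qed
  have "((\<lambda>r. d\<^sup>2 - (r - s)\<^sup>2) has_real_derivative - 2 * (r - s)) (at r within S)"
    by (auto intro!: derivative_eq_intros)
  from DERIV_chain[OF sq this] show ?thesis
    by (simp add: bump_def[abs_def] bump'_def o_def algebra_simps)
qed

lemma continuous_on_bump': "continuous_on S (bump' s d)"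
  unfolding bump'_def[abs_def] by (intro continuous_intros)

text \<open>If \<open>y < \<mu>\<close>, then \<open>G\<close> lies above \<open>G s\<close> just to
  the left of \<open>s\<close> and below it just to the right. The derivative of a bump at
  \<open>s\<close> has the same sign pattern, so testing with the bump gives a strictly positive
  integral.\<close>

lemma weak_derivative_lower_bound:
  fixes F1 :: "real \<Rightarrow> real"
  assumes cont: "continuous_on {0..1} F1" and s: "s \<in> {0<..<1}"
    and d: "(F1 has_real_derivative y) (at s)"
    and weak: "\<And>\<phi> \<phi>'. \<lbrakk>\<And>r. r \<in> {0..1} \<Longrightarrow> (\<phi> has_real_derivative \<phi>' r) (at r within {0..1});
        continuous_on {0..1} \<phi>'; \<And>r. r \<in> {0..1} \<Longrightarrow> 0 \<le> \<phi> r; \<phi> 0 = 0; \<phi> 1 = 0\<rbrakk> \<Longrightarrow>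
        integral {0..1} (\<lambda>r. \<mu> * \<phi> r + \<phi>' r * F1 r) \<le> 0"
  shows "\<mu> \<le> y"
proof (rule ccontr)
  assume "\<not> \<mu> \<le> y"
  define G where "G r = F1 r - \<mu> * r" for r
  have G': "(G has_real_derivative y - \<mu>) (at s)"
    unfolding G_def[abs_def] using d by (auto intro!: derivative_eq_intros)
  obtain d1 where d1: "0 < d1" "\<And>h. 0 < h \<Longrightarrow> h < d1 \<Longrightarrow> G s < G (s - h)"
    using DERIV_neg_dec_left[OF G'] \<open>\<not> \<mu> \<le> y\<close> by auto
  obtain d2 where d2: "0 < d2" "\<And>h. 0 < h \<Longrightarrow> h < d2 \<Longrightarrow> G (s + h) < G s"
    using DERIV_neg_dec_right[OF G'] \<open>\<not> \<mu> \<le> y\<close> by auto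
  define e where "e = min (min d1 d2) (min s (1 - s))"
  have e: "0 < e" "e \<le> d1" "e \<le> d2" "e \<le> s" "e \<le> 1 - s" using d1(1) d2(1) s by (auto simp: e_def)
  let ?\<phi> = "bump s e" and ?\<phi>' = "bump' s e"
  have out: "?\<phi> r = 0" "?\<phi>' r = 0" if "e \<le> \<bar>r - s\<bar>" for r
  proof -
    have "e\<^sup>2 \<le> (r - s)\<^sup>2" using that e(1) by (simp add: abs_le_square_iff[symmetric])
    then show "?\<phi> r = 0" "?\<phi>' r = 0" by (auto simp: bump_def bump'_def)
  qed
  have c': "continuous_on {0..1} ?\<phi>'" by (rule continuous_on_bump')
  have "?\<phi> 0 = 0" "?\<phi> 1 = 0" using e by (auto intro!: out)
  then have w: "integral {0..1} (\<lambda>r. \<mu> * ?\<phi> r + ?\<phi>' r * F1 r) \<le> 0"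
    by (intro weak bump_has_derivative c') (auto simp: bump_def)
  \<comment> \<open>Integration by parts against the affine function \<open>\<mu> * r + G s\<close>
    absorbs the term \<open>\<mu> * \<phi>\<close> and leaves the integral of
    \<open>\<phi>' * (G - G s)\<close>.\<close>
  have byparts: "((\<lambda>r. ?\<phi>' r * (\<mu> * r + G s) + ?\<phi> r * \<mu>) has_integral 0) {0..1}"
  proof -
    have "((\<lambda>r. ?\<phi>' r * (\<mu> * r + G s) + ?\<phi> r * \<mu>) has_integral
        ?\<phi> 1 * (\<mu> * 1 + G s) - ?\<phi> 0 * (\<mu> * 0 + G s)) {0..1}"
      by (rule fundamental_theorem_of_calculus)
        (auto simp flip: has_real_derivative_iff_has_vector_derivative intro!: derivative_eq_intros bump_has_derivative)
    then show ?thesis using \<open>?\<phi> 0 = 0\<close> \<open>?\<phi> 1 = 0\<close> by simp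
  qed
  let ?f = "\<lambda>r. ?\<phi>' r * (G r - G s)"
  have cf: "continuous_on {0..1} ?f" unfolding G_def by (intro continuous_intros c' cont)
  have fpos: "0 \<le> ?f r" for r
  proof (cases "e \<le> \<bar>r - s\<bar>")
    case False
    consider "r = s" | "r < s" | "s < r" by linarith
    then show ?thesis
    proof cases
      case 2
      then have "G s < G r" using d1(2)[of "s - r"] False e by auto
      then show ?thesis using 2 by (auto simp: bump'_def intro!: mult_nonneg_nonneg mult_nonneg_nonpos2 mult_nonpos_nonpos)
    next
      case 3
      then have "G r < G s" using d2(2)[of "r - s"] False e by auto
      then show ?thesis using 3 by (auto simp: bump'_def intro!: mult_nonpos_nonpos mult_nonpos_nonneg mult_nonneg_nonpos2)
    qed (simp add: bump'_def)
  qed (simp add: out)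
  have int: "(?f has_integral integral {0..1} ?f) {0..1}"
    by (intro integrable_integral integrable_continuous_real cf)
  moreover have "integral {0..1} ?f = integral {0..1} (\<lambda>r. \<mu> * ?\<phi> r + ?\<phi>' r * F1 r)"
  proof -
    have "((\<lambda>r. ?f r + (?\<phi>' r * (\<mu> * r + G s) + ?\<phi> r * \<mu>)) has_integral integral {0..1} ?f + 0) {0..1}"
      by (intro has_integral_add int byparts)
    moreover have "(\<lambda>r. ?f r + (?\<phi>' r * (\<mu> * r + G s) + ?\<phi> r * \<mu>)) = (\<lambda>r. \<mu> * ?\<phi> r + ?\<phi>' r * F1 r)"
      by (simp add: G_def algebra_simps)
    ultimately show ?thesis by (simp add: integral_unique)
  qed
  ultimately have "integral {0..1} ?f = 0"
    using w Henstock_Kurzweil_Integration.integral_nonneg[of ?f "{0..1}"] fpos by (fastforce dest: has_integral_integrable)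
  then have "(?f has_integral 0) (cbox 0 1)" using int by simp
  then have "?f (s - e / 2) = 0"
    using has_integral_0_cbox_imp_0[of 0 1 ?f "s - e / 2"] cf fpos e by auto
  moreover have "G s < G (s - e / 2)" using d1(2)[of "e / 2"] e by auto
  moreover have "0 < ?\<phi>' (s - e / 2)" using e(1) by (simp add: bump'_def power2_eq_square)
  ultimately show False by simp
qed

text \<open>For \<open>x = 2 * lam * \<epsilon> * \<phi>\<close> the rational bound lets the factor
  \<open>\<epsilon>\<close> be divided out explicitly, so that the resulting integrand is continuous
  up to \<open>\<epsilon> = 0\<close>.\<close>

lemma exp_minus_le: "0 \<le> x \<Longrightarrow> exp (- x) \<le> 1 - x / (1 + (x::real))"
proof -
  assume x: "0 \<le> x"
  have "exp (- x) \<le> 1 / (1 + x)"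
    using exp_ge_add_one_self[of x] x by (simp add: exp_minus inverse_eq_divide frac_le)
  also have "\<dots> = 1 - x / (1 + x)" using x by (simp add: field_simps)
  finally show ?thesis .
qed

context intertwined_qms
begin

text \<open>
  Used with \<open>\<tau> = \<epsilon> \<phi>(s)\<close> along a geodesic, where \<open>W\<close> is the velocity of the curve obtained by
  running the gradient flow for the time \<open>\<tau>\<close> from each point.
\<close>

lemma met_variation:
  fixes \<tau>' :: real
  assumes \<rho>: "\<rho> \<in> states UNIV" and v: "v \<in> TS" and \<tau>: "0 \<le> \<tau>"
  defines "W \<equiv> PS \<tau> v + \<tau>' *\<^sub>R dgen (PS \<tau> \<rho>)"
  shows "met (PS \<tau> \<rho>) W W \<le> exp (- 2 * lam * \<tau>) * met \<rho> v v
     - 2 * \<tau>' * (W \<bullet> (mfun ln (PS \<tau> \<rho>) - mfun ln \<sigma>))"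
proof -
  let ?\<rho> = "PS \<tau> \<rho>"
  have \<rho>': "posdef \<rho>" using \<rho> by (simp add: states_def)
  have p: "posdef ?\<rho>" by (rule posdef_PS[OF \<rho>' \<tau>])
  have d: "dgen ?\<rho> \<in> TS" using p by (intro dgen_TS) (simp add: posdef_inner)
  have a: "PS \<tau> v \<in> TS" by (rule PS_TS[OF v])
  have s: "\<tau>' *\<^sub>R dgen ?\<rho> \<in> TS" by (rule subspace_scale[OF subspace_traceless_sa d])
  have W: "W \<in> TS" unfolding W_def by (rule subspace_add[OF subspace_traceless_sa a s])
  \<comment> \<open>\<open>W\<close> is expanded in one slot at a time, so that the cross term is
    again evaluated at \<open>W\<close>. What remains is \<open>- \<tau>' * \<tau>'\<close> times a
    square, which may be dropped.\<close>
  have "met ?\<rho> W W = met ?\<rho> W (PS \<tau> v) + met ?\<rho> W (\<tau>' *\<^sub>R dgen ?\<rho>)"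
    by (subst (2) W_def, rule met_add[OF p a s W])
  also have "met ?\<rho> W (\<tau>' *\<^sub>R dgen ?\<rho>) = \<tau>' * met ?\<rho> (dgen ?\<rho>) W"
    by (simp add: met_scaleR[OF p d W] met_sym[OF p W d])
  also have "met ?\<rho> W (PS \<tau> v) = met ?\<rho> (PS \<tau> v) (PS \<tau> v) + \<tau>' * met ?\<rho> (dgen ?\<rho>) (PS \<tau> v)"
    by (subst met_sym[OF p W a], subst W_def, subst met_add[OF p a s a])
      (simp add: met_scaleR[OF p d a] met_sym[OF p a d])
  also have "met ?\<rho> (dgen ?\<rho>) (PS \<tau> v) = met ?\<rho> (dgen ?\<rho>) W - \<tau>' * met ?\<rho> (dgen ?\<rho>) (dgen ?\<rho>)"
    by (simp add: W_def met_add[OF p a s d] met_scaleR[OF p d d])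
  finally have "met ?\<rho> W W = met ?\<rho> (PS \<tau> v) (PS \<tau> v) + 2 * \<tau>' * met ?\<rho> (dgen ?\<rho>) W
      - \<tau>' * \<tau>' * met ?\<rho> (dgen ?\<rho>) (dgen ?\<rho>)"
    by (simp add: algebra_simps)
  moreover have "0 \<le> \<tau>' * \<tau>' * met ?\<rho> (dgen ?\<rho>) (dgen ?\<rho>)" by (simp add: met_nonneg p)
  moreover have "met ?\<rho> (PS \<tau> v) (PS \<tau> v) \<le> exp (- 2 * lam * \<tau>) * met \<rho> v v"
    by (rule met_contraction[OF \<rho>' \<tau> v])
  ultimately show ?thesis by (simp add: met_dgen[OF p W])
qed

section \<open>Lengths, distance and the first variation\<close>

lemma riem_length_nonneg:
  assumes "C1_curve \<gamma>" "\<gamma> ` {0..1} \<subseteq> states UNIV" shows "0 \<le> riem_length met \<gamma>"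
proof -
  have "0 \<le> sqrt (met (\<gamma> s) (velocity \<gamma> s) (velocity \<gamma> s))" if "s \<in> {0..1}" for s
    using assms(2) that by (auto simp: states_def image_subset_iff intro!: met_nonneg)
  \<comment> \<open>A nonintegrable speed has integral 0 by convention.\<close>
  then show ?thesis
    unfolding riem_length_def
    by (cases "(\<lambda>s. sqrt (met (\<gamma> s) (velocity \<gamma> s) (velocity \<gamma> s))) integrable_on {0..1}")
      (auto simp: not_integrable_integral intro: Henstock_Kurzweil_Integration.integral_nonneg)
qed

lemma riem_dist_le:
  assumes "C1_curve \<gamma>" "\<gamma> ` {0..1} \<subseteq> states UNIV" "\<gamma> 0 = x" "\<gamma> 1 = y"
  shows "riem_dist (states UNIV) met x y \<le> riem_length met \<gamma>"
  unfolding riem_dist_def using assms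
  by (intro cInf_lower bdd_belowI[of _ 0]) (auto intro: riem_length_nonneg)

lemma first_variation:
  assumes geo: "minimizing_geodesic (states UNIV) met \<gamma>"
    and v: "\<And>s. s \<in> {0..1} \<Longrightarrow> (\<gamma> has_vector_derivative v s) (at s within {0..1})" "continuous_on {0..1} v"
    and sp: "0 < sp" "\<And>s. s \<in> {0..1} \<Longrightarrow> sqrt (met (\<gamma> s) (v s) (v s)) = sp"
    and \<phi>: "\<And>s. s \<in> {0..1} \<Longrightarrow> (\<phi> has_real_derivative \<phi>' s) (at s within {0..1})"
      "continuous_on {0..1} \<phi>'" "\<And>s. s \<in> {0..1} \<Longrightarrow> 0 \<le> \<phi> s" "\<phi> 0 = 0" "\<phi> 1 = 0"
  shows "integral {0..1} (\<lambda>s. lam * sp\<^sup>2 * \<phi> s + \<phi>' s * (v s \<bullet> (mfun ln (\<gamma> s) - mfun ln \<sigma>))) \<le> 0"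
proof -
  have \<gamma>M: "\<gamma> ` {0..1} \<subseteq> states UNIV" using geo by (simp add: minimizing_geodesic_def)
  have vTS: "v s \<in> TS" if "s \<in> {0..1}" for s by (rule velocity_states[OF v(1)[OF that] that \<gamma>M])
  have met_c: "met (\<gamma> s) (v s) (v s) = sp\<^sup>2" if "s \<in> {0..1}" for s
    using sp(2)[OF that] sp(1) by (metis less_imp_le real_sqrt_pow2_iff real_sqrt_ge_0_iff)
  have c\<phi>: "continuous_on {0..1} \<phi>"
    by (rule DERIV_continuous_on[OF \<phi>(1)])
  have c\<gamma>: "continuous_on {0..1} \<gamma>"
    by (rule continuous_on_vector_derivative[OF v(1)])
  define \<Gamma> where "\<Gamma> \<epsilon> s = PS (\<epsilon> * \<phi> s) (\<gamma> s)" for \<epsilon> s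
  define W where "W \<epsilon> s = PS (\<epsilon> * \<phi> s) (v s) + (\<epsilon> * \<phi>' s) *\<^sub>R dgen (\<Gamma> \<epsilon> s)" for \<epsilon> s
  \<comment> \<open>Chosen so that the squared speed of \<open>\<Gamma> \<epsilon>\<close> at
    \<open>s\<close> is at most
    \<open>sp\<^sup>2 + \<epsilon> * \<Theta> \<epsilon> s\<close>.\<close>
  define \<Theta> where "\<Theta> \<epsilon> s = - 2 * lam * \<phi> s / (1 + 2 * lam * \<epsilon> * \<phi> s) * sp\<^sup>2
     - 2 * \<phi>' s * (W \<epsilon> s \<bullet> (mfun ln (\<Gamma> \<epsilon> s) - mfun ln \<sigma>))" for \<epsilon> s
  have \<Gamma>M: "\<Gamma> \<epsilon> s \<in> states UNIV" if "0 \<le> \<epsilon>" "s \<in> {0..1}" for \<epsilon> s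
    unfolding \<Gamma>_def using that \<gamma>M \<phi>(3) by (intro states_PS) auto
  let ?D = "{0..1::real} \<times> cbox 0 (1::real)"
  have snd_in: "continuous_on {0..1} f \<Longrightarrow> continuous_on ?D (\<lambda>p. f (snd p))" for f :: "real \<Rightarrow> 'z::topological_space"
    by (rule continuous_on_compose2[of "{0..1}" f]) (auto intro: continuous_intros)
  have cont\<Gamma>: "continuous_on ?D (\<lambda>p. \<Gamma> (fst p) (snd p))"
    unfolding \<Gamma>_def by (intro continuous_on_exp_semigroup linear_dgen continuous_intros snd_in c\<phi> c\<gamma>)
  have cont_dgen: "continuous_on UNIV dgen"
    using linear_continuous_on linear_dgen linear_conv_bounded_linear by blast
  have contW: "continuous_on ?D (\<lambda>p. W (fst p) (snd p))"
    unfolding W_def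
    by (intro continuous_on_exp_semigroup linear_dgen continuous_intros snd_in c\<phi> v(2) \<phi>(2)
        continuous_on_compose2[OF cont_dgen cont\<Gamma>]) auto
  have cont_ln: "continuous_on ?D (\<lambda>p. mfun ln (\<Gamma> (fst p) (snd p)))"
    using \<Gamma>M by (intro continuous_on_compose2[OF continuous_on_mfun_ln cont\<Gamma>]) (auto simp: states_def)
  have den: "1 + 2 * lam * \<epsilon> * \<phi> s \<noteq> 0" if "0 \<le> \<epsilon>" "s \<in> {0..1}" for \<epsilon> s
  proof -
    have "0 \<le> 2 * lam * \<epsilon> * \<phi> s" using that \<phi>(3) lam(1) by simp
    then show ?thesis by linarith
  qed
  have cont\<Theta>: "continuous_on ?D (\<lambda>(\<epsilon>, s). \<Theta> \<epsilon> s)"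
    unfolding \<Theta>_def case_prod_beta
    by (intro continuous_intros snd_in c\<phi> \<phi>(2) contW cont_ln) (use den in auto)
  define H where "H \<epsilon> = integral {0..1} (\<Theta> \<epsilon>)" for \<epsilon>
  have contH: "continuous_on {0..1} H"
    using integral_continuous_on_param[OF cont\<Theta>] by (simp add: H_def[abs_def])
  have pair: "continuous_on {0..1} (\<lambda>s::real. (\<epsilon>, s))" for \<epsilon> :: real by (intro continuous_intros)
  have int\<Theta>: "(\<Theta> \<epsilon>) integrable_on {0..1}" if "\<epsilon> \<in> {0..1}" for \<epsilon>
  proof (rule integrable_continuous_real)
    show "continuous_on {0..1} (\<Theta> \<epsilon>)"
      using continuous_on_compose2[OF cont\<Theta> pair[of \<epsilon>]] that by (simp add: image_subset_iff)
  qed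
  have Hpos: "0 \<le> H \<epsilon>" if \<epsilon>: "0 < \<epsilon>" "\<epsilon> \<le> 1" for \<epsilon>
  proof -
    have dW: "(\<Gamma> \<epsilon> has_vector_derivative W \<epsilon> s) (at s within {0..1})" if "s \<in> {0..1}" for s
      unfolding \<Gamma>_def[abs_def] W_def
      by (intro exp_semigroup_chain[OF linear_dgen] DERIV_cmult \<phi>(1) v(1) that)
    have "continuous_on {0..1} (W \<epsilon>)"
      using continuous_on_compose2[OF contW pair[of \<epsilon>]] \<epsilon> by (simp add: image_subset_iff)
    then have C1: "C1_curve (\<Gamma> \<epsilon>)" unfolding C1_curve_def using dW by blast
    have sub: "\<Gamma> \<epsilon> ` {0..1} \<subseteq> states UNIV" using \<Gamma>M \<epsilon> by auto
    have "riem_dist (states UNIV) met (\<gamma> 0) (\<gamma> 1) \<le> riem_length met (\<Gamma> \<epsilon>)"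
      by (rule riem_dist_le[OF C1 sub]) (simp_all add: \<Gamma>_def \<phi> exp_semigroup_0[OF linear_dgen])
    moreover have "riem_dist (states UNIV) met (\<gamma> 0) (\<gamma> 1) = sp"
    proof -
      have "riem_length met \<gamma> = integral {0..1} (\<lambda>s::real. sp)"
        unfolding riem_length_def
        by (rule Henstock_Kurzweil_Integration.integral_cong) (simp add: velocity_eq[OF v(1)] sp(2))
      then show ?thesis using geo by (simp add: minimizing_geodesic_def)
    qed
    moreover have "riem_length met (\<Gamma> \<epsilon>) \<le> integral {0..1} (\<lambda>s. sp + \<epsilon> / (2 * sp) * \<Theta> \<epsilon> s)"
    proof -
      let ?l = "\<lambda>s. sqrt (met (\<Gamma> \<epsilon> s) (velocity (\<Gamma> \<epsilon>) s) (velocity (\<Gamma> \<epsilon>) s))"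
      let ?b = "\<lambda>s. sp + \<epsilon> / (2 * sp) * \<Theta> \<epsilon> s"
      have b: "?l s \<le> ?b s" "0 \<le> ?l s" if s: "s \<in> {0..1}" for s
      proof -
        let ?x = "2 * lam * \<epsilon> * \<phi> s" and ?g = "met (\<Gamma> \<epsilon> s) (W \<epsilon> s) (W \<epsilon> s)"
        have x: "0 \<le> ?x" using \<epsilon> \<phi>(3)[OF s] lam(1) by simp
        have pd: "posdef (\<Gamma> \<epsilon> s)" using \<Gamma>M[OF _ s] \<epsilon> by (simp add: states_def)
        have "?g \<le> exp (- 2 * lam * (\<epsilon> * \<phi> s)) * met (\<gamma> s) (v s) (v s)
           - 2 * (\<epsilon> * \<phi>' s) * (W \<epsilon> s \<bullet> (mfun ln (\<Gamma> \<epsilon> s) - mfun ln \<sigma>))"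
          unfolding W_def \<Gamma>_def using \<gamma>M s \<epsilon> \<phi>(3)[OF s] by (intro met_variation vTS) auto
        also have "exp (- 2 * lam * (\<epsilon> * \<phi> s)) * met (\<gamma> s) (v s) (v s) \<le> (1 - ?x / (1 + ?x)) * sp\<^sup>2"
          unfolding met_c[OF s] using exp_minus_le[OF x] by (intro mult_right_mono) (simp_all add: mult_ac)
        also have "(1 - ?x / (1 + ?x)) * sp\<^sup>2 - 2 * (\<epsilon> * \<phi>' s) * (W \<epsilon> s \<bullet> (mfun ln (\<Gamma> \<epsilon> s) - mfun ln \<sigma>)) =
            sp\<^sup>2 + \<epsilon> * \<Theta> \<epsilon> s"
          by (simp add: \<Theta>_def algebra_simps)
        finally have g: "?g \<le> sp\<^sup>2 + \<epsilon> * \<Theta> \<epsilon> s" by simp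
        have g0: "0 \<le> ?g" by (rule met_nonneg[OF pd])
        \<comment> \<open>The arithmetic-geometric mean inequality linearises the square root at the
          constant speed \<open>sp\<close>.\<close>
        have "2 * sp * sqrt ?g \<le> sp\<^sup>2 + (sqrt ?g)\<^sup>2"
          using zero_le_power2[of "sp - sqrt ?g"] by (simp add: power2_diff)
        then have "2 * sp * sqrt ?g \<le> sp\<^sup>2 + ?g" using g0 by simp
        also have "\<dots> \<le> 2 * sp * ?b s" using g sp(1) by (simp add: algebra_simps power2_eq_square)
        finally have "sqrt ?g \<le> ?b s" using sp(1) by simp
        then show "?l s \<le> ?b s" "0 \<le> ?l s" using g0 by (simp_all add: velocity_eq[OF dW[OF s] s])
      qed
      have ib: "?b integrable_on {0..1}"
        using \<epsilon> by (intro integrable_add integrable_const_ivl integrable_on_mult_right int\<Theta>) auto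
      show ?thesis
        unfolding riem_length_def
      proof (cases "?l integrable_on {0..1}")
        case True
        then show "integral {0..1} ?l \<le> integral {0..1} ?b" using b(1) by (intro Henstock_Kurzweil_Integration.integral_le ib)
      next
        case False
        \<comment> \<open>In this case the length is the default value 0, so nonnegativity of the
          upper bound suffices.\<close>
        have "0 \<le> integral {0..1} ?b" using b by (intro Henstock_Kurzweil_Integration.integral_nonneg ib) (meson order_trans)
        then show "integral {0..1} ?l \<le> integral {0..1} ?b" using False by (simp add: not_integrable_integral)
      qed
    qed
    moreover have "integral {0..1} (\<lambda>s. sp + \<epsilon> / (2 * sp) * \<Theta> \<epsilon> s) = sp + \<epsilon> / (2 * sp) * H \<epsilon>"
      using has_integral_add[OF has_integral_const_real[of sp 0 1]
          has_integral_mult_right[OF integrable_integral[OF int\<Theta>[of \<epsilon>]], of "\<epsilon> / (2 * sp)"]] \<epsilon>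
      by (intro integral_unique) (simp add: H_def)
    ultimately have "0 \<le> \<epsilon> / (2 * sp) * H \<epsilon>" by simp
    then show ?thesis using \<epsilon> sp(1) by (simp add: zero_le_mult_iff zero_le_divide_iff)
  qed
  have "0 \<le> H 0"
  proof -
    have "(H \<longlongrightarrow> H 0) (at 0 within {0..1})" using contH by (simp add: continuous_on_def)
    then have "(H \<longlongrightarrow> H 0) (at_right 0)" using at_within_Icc_at_right[of 0 "1::real"] by simp
    moreover have "eventually (\<lambda>\<epsilon>. 0 \<le> H \<epsilon>) (at_right 0)"
      using eventually_at_right_real[of 0 1] by (simp add: eventually_mono Hpos)
    ultimately show ?thesis by (intro tendsto_lowerbound[of H "H 0"]) auto
  qed
  moreover have "H 0 = integral {0..1} (\<lambda>s. (-2) * (lam * sp\<^sup>2 * \<phi> s + \<phi>' s * (v s \<bullet> (mfun ln (\<gamma> s) - mfun ln \<sigma>))))"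
    unfolding H_def
    by (rule Henstock_Kurzweil_Integration.integral_cong) (simp add: \<Theta>_def W_def \<Gamma>_def exp_semigroup_0[OF linear_dgen] algebra_simps)
  ultimately show ?thesis
    by (simp only: Henstock_Kurzweil_Integration.integral_mult_right)
qed

theorem rel_entropy_geodesically_convex:
  "geodesically_convex (states UNIV) met (\<lambda>\<rho>. rel_entropy \<rho> \<sigma>) lam"
  unfolding geodesically_convex_def
proof (intro allI impI)
  fix \<gamma> assume geo: "minimizing_geodesic (states UNIV) met \<gamma>"
  then obtain D sp where D: "D 0 = \<gamma>"
      "\<And>n s. s \<in> {0..1} \<Longrightarrow> (D n has_vector_derivative D (Suc n) s) (at s within {0..1})"
    and sp: "\<And>s. s \<in> {0..1} \<Longrightarrow> sqrt (met (\<gamma> s) (velocity \<gamma> s) (velocity \<gamma> s)) = sp"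
    and \<gamma>M: "\<gamma> ` {0..1} \<subseteq> states UNIV"
    unfolding minimizing_geodesic_def smooth_curve_def by blast
  define v where "v = D 1"
  have v: "(\<gamma> has_vector_derivative v s) (at s within {0..1})" if "s \<in> {0..1}" for s
    using D(2)[OF that, of 0] by (simp add: D(1) v_def)
  have v': "(v has_vector_derivative D 2 s) (at s within {0..1})" if "s \<in> {0..1}" for s
    using D(2)[OF that, of 1] by (simp add: v_def numeral_2_eq_2)
  have cv: "continuous_on {0..1} v"
    by (rule continuous_on_vector_derivative[OF v'])
  have c\<gamma>: "continuous_on {0..1} \<gamma>"
    by (rule continuous_on_vector_derivative[OF v])
  have pd: "posdef (\<gamma> s)" if "s \<in> {0..1}" for s using \<gamma>M that by (auto simp: states_def image_subset_iff)
  have vTS: "v s \<in> TS" if "s \<in> {0..1}" for s by (rule velocity_states[OF v[OF that] that \<gamma>M])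
  have vel: "velocity \<gamma> s = v s" if "s \<in> {0..1}" for s by (rule velocity_eq[OF v[OF that] that])
  have at: "at s within {0..1} = at s" if "s \<in> {0<..<1}" for s :: real
    using that by (intro at_within_interior) auto
  define F1 where "F1 s = v s \<bullet> (mfun ln (\<gamma> s) - mfun ln \<sigma>)" for s
  have dF: "((\<lambda>r. rel_entropy (\<gamma> r) \<sigma>) has_real_derivative F1 s) (at s)" if s: "s \<in> {0<..<1}" for s
  proof -
    have s': "s \<in> {0..1}" using s by auto
    have "((\<lambda>r. rel_entropy (\<gamma> r) \<sigma>) has_real_derivative F1 s + Re (trace (v s))) (at s within {0..1})"
      unfolding F1_def using \<sigma>_posdef by (intro has_real_derivative_entropy[OF v[OF s'] s' pd]) (auto simp: posdef_inner)
    then show ?thesis using vTS[OF s'] by (simp add: at[OF s] traceless_sa_def)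
  qed
  have cF1: "continuous_on {0..1} F1"
    unfolding F1_def using pd by (intro continuous_intros cv continuous_on_compose2[OF continuous_on_mfun_ln c\<gamma>]) auto
  have "\<exists>y. (F1 has_real_derivative y) (at s)" if s: "s \<in> {0<..<1}" for s
  proof -
    have s': "s \<in> {0..1}" using s by auto
    obtain Y where "((\<lambda>r. mfun ln (\<gamma> r)) has_vector_derivative Y) (at s within {0..1})"
      using has_vector_derivative_mfun_ln[OF v[OF s'] s' pd] by blast
    then have "((\<lambda>r. mfun ln (\<gamma> r) - mfun ln \<sigma>) has_vector_derivative Y) (at s within {0..1})"
      by (auto intro!: derivative_eq_intros)
    from bounded_bilinear.has_vector_derivative[OF bounded_bilinear_inner v'[OF s'] this]
    show ?thesis unfolding F1_def[abs_def] at[OF s] has_real_derivative_iff_has_vector_derivative by blast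
  qed
  then obtain F2 where F2: "\<And>s. s \<in> {0<..<1} \<Longrightarrow> (F1 has_real_derivative F2 s) (at s)" by metis
  have "lam * met (\<gamma> s) (v s) (v s) \<le> F2 s" if s: "s \<in> {0<..<1}" for s
  proof -
    have s': "s \<in> {0..1}" using s by auto
    have "0 \<le> sp" using sp[OF s'] met_nonneg[OF pd[OF s']] by (metis real_sqrt_ge_0_iff)
    \<comment> \<open>\<open>first_variation\<close> divides by the speed, so constant geodesics are
      treated separately; there both sides are 0.\<close>
    then consider "sp = 0" | "0 < sp" by linarith
    then show ?thesis
    proof cases
      case 1
      have v0: "v r = 0" if "r \<in> {0..1}" for r
        using sp[OF that] vel[OF that] by (intro met_eq_0[OF pd[OF that] vTS[OF that]]) (simp add: 1)
      have "(F1 has_real_derivative 0) (at s within {0<..<1})"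
        by (rule has_field_derivative_transform_within[of "\<lambda>_. 0" 0 s "{0<..<1}" 1]) (use s v0 in \<open>auto simp: F1_def\<close>)
      then have "(F1 has_real_derivative 0) (at s)"
        unfolding at_within_open[OF s open_greaterThanLessThan] .
      from DERIV_unique[OF F2[OF s] this] have "F2 s = 0" .
      then show ?thesis using v0[OF s'] pd[OF s'] by (simp add: met_pot subspace_0[OF subspace_traceless_sa])
    next
      case 2
      have cc: "sqrt (met (\<gamma> r) (v r) (v r)) = sp" if "r \<in> {0..1}" for r using sp[OF that] vel[OF that] by simp
      have "lam * sp\<^sup>2 \<le> F2 s"
      proof (rule weak_derivative_lower_bound[OF cF1 s F2[OF s]])
        fix \<phi> \<phi>' :: "real \<Rightarrow> real"
        assume \<phi>: "\<And>r. r \<in> {0..1} \<Longrightarrow> (\<phi> has_real_derivative \<phi>' r) (at r within {0..1})"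
          "continuous_on {0..1} \<phi>'" "\<And>r. r \<in> {0..1} \<Longrightarrow> 0 \<le> \<phi> r" "\<phi> 0 = 0" "\<phi> 1 = 0"
        show "integral {0..1} (\<lambda>r. lam * sp\<^sup>2 * \<phi> r + \<phi>' r * F1 r) \<le> 0"
          unfolding F1_def by (rule first_variation[OF geo v cv 2 cc \<phi>])
      qed
      moreover have "met (\<gamma> s) (v s) (v s) = sp\<^sup>2"
        using cc[OF s'] met_nonneg[OF pd[OF s']] by (metis real_sqrt_pow2)
      ultimately show ?thesis by simp
    qed
  qed
  then show "\<exists>F1 F2. \<forall>s\<in>{0<..<1}. ((\<lambda>r. rel_entropy (\<gamma> r) \<sigma>) has_real_derivative F1 s) (at s) \<and>
      (F1 has_real_derivative F2 s) (at s) \<and>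
      lam * met (\<gamma> s) (velocity \<gamma> s) (velocity \<gamma> s) \<le> F2 s"
    using dF F2 vel by (intro exI[of _ F1] exI[of _ F2]) auto
qed

end

section \<open>The Clifford algebra is the full matrix algebra\<close>

definition anticomm :: "'n::finite op \<Rightarrow> 'n op \<Rightarrow> bool" where
  "anticomm A B \<longleftrightarrow> A ** B = - (B ** A)"

lemma anticommD:
  assumes "anticomm A B" shows "A ** B = - (B ** A)" "A ** (B ** C) = - (B ** (A ** C))"
  using assms by (simp_all add: anticomm_def matrix_mul_assoc mm_minus_left)

definition monom_op :: "('a \<Rightarrow> 'n::finite op) \<Rightarrow> 'a list \<Rightarrow> 'n op" where
  "monom_op g xs = foldr (\<lambda>i M. g i ** M) xs (mat 1)"

lemma monom_op_simps [simp]: "monom_op g [] = mat 1" "monom_op g (a # xs) = g a ** monom_op g xs"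
  by (simp_all add: monom_op_def)

lemma monom_op_commute:
  assumes "\<And>k. k \<in> set xs \<Longrightarrow> g k ** M = M ** g k" shows "monom_op g xs ** M = M ** monom_op g xs"
  using assms by (induction xs) (simp_all, metis matrix_mul_assoc)

locale self_adjoint_clifford =
  fixes g :: "nat \<Rightarrow> 'n::finite op" and m :: nat
  assumes sa: "\<And>i. i < 2 * m \<Longrightarrow> adj (g i) = g i"
    and sq: "\<And>i. i < 2 * m \<Longrightarrow> g i ** g i = mat 1"
    and anti: "\<And>i j. i < 2 * m \<Longrightarrow> j < 2 * m \<Longrightarrow> i \<noteq> j \<Longrightarrow> anticomm (g i) (g j)"
    and card: "CARD('n) = 2 ^ m"
begin

text \<open>Moving \<open>g k\<close> through the product costs a sign at every factor other than
  \<open>g k\<close> itself.\<close>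

lemma monom_op_sign:
  assumes "k < 2 * m" "distinct xs" "set xs \<subseteq> {..<2 * m}"
  shows "g k ** monom_op g xs = (- 1) ^ card (set xs - {k}) *\<^sub>R (monom_op g xs ** g k)"
  using assms(2,3)
proof (induction xs)
  case (Cons a xs)
  have IH: "g k ** monom_op g xs = (- 1) ^ card (set xs - {k}) *\<^sub>R (monom_op g xs ** g k)" using Cons by simp
  show ?case
  proof (cases "a = k")
    case True
    then have "set (a # xs) - {k} = set xs - {k}" by auto
    have "g k ** (g k ** monom_op g xs) = g k ** ((- 1) ^ card (set xs - {k}) *\<^sub>R (monom_op g xs ** g k))"
      by (simp only: IH)
    then show ?thesis
      using \<open>set (a # xs) - {k} = set xs - {k}\<close> True by (simp add: mm_scaleR_right matrix_mul_assoc)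
  next
    case False
    then have "set (a # xs) - {k} = insert a (set xs - {k})" by auto
    then have c: "card (set (a # xs) - {k}) = Suc (card (set xs - {k}))" using Cons.prems by simp
    have "g k ** (g a ** monom_op g xs) = - (g a ** (g k ** monom_op g xs))"
      using anti[of k a] assms(1) Cons.prems False by (intro anticommD) auto
    then show ?thesis
      unfolding c monom_op_simps IH by (simp add: mm_scaleR_right flip: matrix_mul_assoc)
  qed
qed simp

lemma monom_op_unitary:
  assumes "set xs \<subseteq> {..<2 * m}" shows "adj (monom_op g xs) ** monom_op g xs = mat 1"
  using assms
proof (induction xs)
  case (Cons a xs)
  have "adj (monom_op g (a # xs)) ** monom_op g (a # xs) =
      adj (monom_op g xs) ** (g a ** g a) ** monom_op g xs"
    using Cons.prems by (simp add: adj_mm sa matrix_mul_assoc)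
  then show ?case using Cons by (simp add: sq)
qed simp

text \<open>The phases 1 and \<open>\<i>\<close> turn the \<open>2 ^ (2 * m)\<close> monomials into
  a family over the reals with as many members as the real dimension of the matrices of size
  \<open>2 ^ m\<close>.\<close>

definition cmonom :: "nat set \<times> bool \<Rightarrow> 'n op" where
  "cmonom p = (if snd p then \<i> else 1) *\<^sub>C monom_op g (sorted_list_of_set (fst p))"

lemma cmonom_sign:
  assumes "k < 2 * m" "S \<subseteq> {..<2 * m}"
  shows "g k ** cmonom (S, b) = (- 1) ^ card (S - {k}) *\<^sub>R (cmonom (S, b) ** g k)"
proof -
  have "finite S" using assms(2) by (rule finite_subset) simp
  then show ?thesis
    using monom_op_sign[of k "sorted_list_of_set S"] assms
    by (simp add: cmonom_def mm_cscale_right mm_cscale_left cscale_scaleR)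
qed

lemma cmonom_norm:
  assumes "S \<subseteq> {..<2 * m}" shows "cmonom (S, b) \<bullet> cmonom (S, b) = CARD('n)"
proof -
  have "finite S" using assms by (rule finite_subset) simp
  then have "adj (cmonom (S, b)) ** cmonom (S, b) = mat 1"
    using monom_op_unitary[of "sorted_list_of_set S"] assms
    by (simp add: cmonom_def adj_cscale mm_cscale_left mm_cscale_right cscale_cscale)
  then show ?thesis by (simp add: inner_op trace_I)
qed

text \<open>
  Two different monomials are told apart by a generator commuting with one and anticommuting with
  the other: this needs an even number of generators, since otherwise the product of all of them
  is central.
\<close>

lemma separating_generator:
  assumes "S \<subseteq> {..<2 * m}" "T \<subseteq> {..<2 * m}" "S \<noteq> T"
  obtains k where "k < 2 * m" "even (card (S - {k})) \<noteq> even (card (T - {k}))"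
proof -
  have fin: "finite S" "finite T" using assms finite_subset by blast+
  have in1: "even (card (R - {k})) \<noteq> even (card R)" if "k \<in> R" "finite R" for R :: "nat set" and k
    using that card_Suc_Diff1[of R k] by (metis even_Suc)
  show ?thesis
  proof (cases "even (card S) = even (card T)")
    case True
    obtain k where "k \<in> S \<longleftrightarrow> k \<notin> T" using assms(3) by blast
    moreover from this have "k < 2 * m" using assms by auto
    ultimately show ?thesis using in1[of k S] in1[of k T] fin True that[of k] by (cases "k \<in> S") auto
  next
    case False
    \<comment> \<open>Otherwise \<open>T\<close> is the complement of \<open>S\<close> in a set of
      even size, and the two cardinalities would have equal parity.\<close>
    have "\<exists>k<2 * m. k \<in> S \<longleftrightarrow> k \<in> T"
    proof (rule ccontr)
      assume "\<not> ?thesis"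
      then have "T = {..<2 * m} - S" using assms by auto
      then have "card T = 2 * m - card S" using fin assms by (simp add: card_Diff_subset)
      moreover have "card S \<le> 2 * m" using card_mono[OF _ assms(1)] by simp
      ultimately show False using False by simp
    qed
    then obtain k where "k < 2 * m" "k \<in> S \<longleftrightarrow> k \<in> T" by blast
    then show ?thesis using in1[of k S] in1[of k T] fin False that[of k] by (cases "k \<in> S") auto
  qed
qed

text \<open>Conjugation by a separating generator is an isometry that fixes one monomial and negates
  the other. For equal index sets the two elements differ by the phase \<open>\<i>\<close>, hence
  are orthogonal over the reals.\<close>

lemma cmonom_orthogonal:
  assumes S: "S \<subseteq> {..<2 * m}" and T: "T \<subseteq> {..<2 * m}" and ne: "(S, b) \<noteq> (T, b')"
  shows "cmonom (S, b) \<bullet> cmonom (T, b') = 0"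
proof (cases "S = T")
  case True
  have *: "(\<i> *\<^sub>C A) \<bullet> A = 0" for A :: "'n op"
  proof -
    have "trace (adj A ** A) = cnj (trace (adj A ** A))"
      by (metis adj_adj adj_mm trace_adj)
    then show ?thesis by (simp add: inner_cscale_i_left complex_eq_iff)
  qed
  show ?thesis
    using ne True *[of "cmonom (S, False)"] by (cases b; cases b') (auto simp: cmonom_def inner_commute)
next
  case False
  obtain k where k: "k < 2 * m" "even (card (S - {k})) \<noteq> even (card (T - {k}))"
    using separating_generator[OF S T False] .
  let ?A = "cmonom (S, b)" and ?B = "cmonom (T, b')"
  have gg: "g k ** M ** g k = (- 1) ^ n *\<^sub>R M" if "g k ** M = (- 1) ^ n *\<^sub>R (M ** g k)" for M n
    using that k(1) by (simp add: mm_scaleR_left sq flip: matrix_mul_assoc)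
  have "?A \<bullet> ?B = (g k ** ?A ** g k) \<bullet> (g k ** ?B ** g k)"
    using k(1) inner_conj_unitary[of "g k" "g k" ?A ?B] by (simp add: unitary_op_def sa sq)
  also have "\<dots> = - (?A \<bullet> ?B)"
    using k(2) unfolding gg[OF cmonom_sign[OF k(1) S]] gg[OF cmonom_sign[OF k(1) T]]
    by (cases "even (card (S - {k}))") auto
  finally show ?thesis by simp
qed

lemma span_cmonom: "span (cmonom ` (Pow {..<2 * m} \<times> UNIV)) = UNIV"
proof -
  let ?I = "Pow {..<2 * m} \<times> (UNIV :: bool set)"
  have inj: "inj_on cmonom ?I"
  proof (rule inj_onI, rule ccontr)
    fix p q assume pq: "p \<in> ?I" "q \<in> ?I" "cmonom p = cmonom q" "p \<noteq> q"
    then have "cmonom p \<bullet> cmonom q = 0"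
      using cmonom_orthogonal[of "fst p" "fst q" "snd p" "snd q"] by (cases p; cases q) simp
    moreover have "cmonom p \<bullet> cmonom p \<noteq> 0" using pq(1) by (cases p) (auto simp: cmonom_norm)
    ultimately show False using pq(3) by simp
  qed
  have "pairwise orthogonal (cmonom ` ?I)"
    unfolding pairwise_def orthogonal_def by (force intro!: cmonom_orthogonal)
  moreover have "0 \<notin> cmonom ` ?I"
  proof
    assume "0 \<in> cmonom ` ?I"
    then obtain S b where "S \<subseteq> {..<2 * m}" "cmonom (S, b) = 0" by auto
    then show False using cmonom_norm[of S b] by simp
  qed
  ultimately have ind: "independent (cmonom ` ?I)" by (rule pairwise_orthogonal_independent)
  have "card (cmonom ` ?I) = 2 ^ (2 * m) * 2"
    by (simp add: card_image[OF inj] card_cartesian_product card_Pow)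
  also have "\<dots> = dim (UNIV :: 'n op set)"
  proof -
    have "dim (UNIV :: 'n op set) = 2 ^ m * (2 ^ m * 2)" by (simp add: card)
    also have "\<dots> = 2 ^ (2 * m) * 2" by (simp only: mult_2 power_add mult.assoc)
    finally show ?thesis ..
  qed
  finally show ?thesis using card_eq_dim[of "cmonom ` ?I" UNIV] ind by auto
qed

lemma subalgebra_eq_UNIV:
  assumes A: "complex_subalgebra A" and g: "\<And>i. i < 2 * m \<Longrightarrow> g i \<in> A" shows "A = UNIV"
proof -
  have "monom_op g xs \<in> A" if "set xs \<subseteq> {..<2 * m}" for xs
    using that A g by (induction xs) (auto simp: complex_subalgebra_def)
  then have "cmonom ` (Pow {..<2 * m} \<times> UNIV) \<subseteq> A"
    using A by (auto simp: cmonom_def complex_subalgebra_def finite_subset)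
  moreover have "subspace A"
  proof -
    have "0 \<in> A"
    proof -
      have "0 *\<^sub>C mat 1 \<in> A" using A by (simp add: complex_subalgebra_def)
      moreover have "0 *\<^sub>C mat 1 = (0 :: 'n op)" by (simp add: cscale_def vec_eq_iff)
      ultimately show ?thesis by simp
    qed
    moreover have "r *\<^sub>R M \<in> A" if "M \<in> A" for r M
      using that A by (simp add: complex_subalgebra_def flip: cscale_of_real)
    ultimately show ?thesis using A by (auto simp: subspace_def complex_subalgebra_def)
  qed
  ultimately have "span (cmonom ` (Pow {..<2 * m} \<times> UNIV)) \<subseteq> A" by (rule span_minimal)
  then show ?thesis by (auto simp: span_cmonom)
qed

end

section \<open>From the generators \<open>Q\<close>, \<open>P\<close> to the full matrix
  algebra\<close>

lemma clifford_generatorsD: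
  assumes "clifford_generators m Q P" "j \<in> {1..m}" "k \<in> {1..m}"
  shows "adj (Q j) = Q j" "adj (P j) = P j"
    "Q j ** Q k + Q k ** Q j = mat (if j = k then 2 else 0)"
    "P j ** P k + P k ** P j = mat (if j = k then 2 else 0)"
    "Q j ** P k + P k ** Q j = 0"
  using assms by (simp_all add: clifford_generators_def selfadjoint_def)

lemma mat_two: "(mat 2 :: 'n::finite op) = 2 *\<^sub>R mat 1"
  by (simp add: mat_def vec_eq_iff scaleR_complex)

lemma clifford_square:
  assumes "A ** A + A ** A = mat 2" shows "A ** A = (mat 1 :: 'n::finite op)"
proof -
  have "2 *\<^sub>R (A ** A) = 2 *\<^sub>R mat 1" using assms by (simp add: mat_two scaleR_2)
  then show ?thesis by simp
qed

lemma clifford_generators_square: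
  assumes "clifford_generators m Q P" "j \<in> {1..m}"
  shows "Q j ** Q j = mat 1" "P j ** P j = mat 1"
proof -
  have "Q j ** Q j + Q j ** Q j = mat 2" "P j ** P j + P j ** P j = mat 2"
    unfolding clifford_generatorsD(3,4)[OF assms(1,2,2)] by simp_all
  then show "Q j ** Q j = mat 1" "P j ** P j = mat 1" by - (erule clifford_square)+
qed

lemma clifford_subalgebra_eq_UNIV:
  fixes Q P :: "nat \<Rightarrow> 'n::finite op"
  assumes c: "clifford_generators m Q P" and card: "CARD('n) = 2 ^ m"
    and A: "complex_subalgebra A" "\<And>j. j \<in> {1..m} \<Longrightarrow> Q j \<in> A \<and> P j \<in> A"
  shows "A = UNIV"
proof -
  \<comment> \<open>All generators in one sequence counted from 0: \<open>Q 1\<close> to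
    \<open>Q m\<close>, then \<open>P 1\<close> to \<open>P m\<close>.\<close>
  define g where "g i = (if i < m then Q (Suc i) else P (Suc (i - m)))" for i
  have mat0: "mat 0 = (0 :: 'n op)" by (simp add: mat_def vec_eq_iff)
  interpret self_adjoint_clifford g m
  proof
    fix i assume i: "i < 2 * m"
    then have in1: "i < m \<Longrightarrow> Suc i \<in> {1..m}" "\<not> i < m \<Longrightarrow> Suc (i - m) \<in> {1..m}" by auto
    show "adj (g i) = g i"
      using clifford_generatorsD(1)[OF c in1(1) in1(1)] clifford_generatorsD(2)[OF c in1(2) in1(2)] by (simp add: g_def)
    show "g i ** g i = mat 1"
      using clifford_generators_square(1)[OF c in1(1)] clifford_generators_square(2)[OF c in1(2)]
      by (simp add: g_def)
    fix j assume j: "j < 2 * m" "i \<noteq> j"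
    then have in2: "j < m \<Longrightarrow> Suc j \<in> {1..m}" "\<not> j < m \<Longrightarrow> Suc (j - m) \<in> {1..m}" by auto
    have "g i ** g j + g j ** g i = 0"
    proof (cases "i < m"; cases "j < m")
      assume *: "\<not> i < m" "\<not> j < m"
      then have "Suc (i - m) \<noteq> Suc (j - m)" using j(2) by simp
      then show ?thesis
        using * clifford_generatorsD(4)[OF c in1(2) in2(2)] by (simp add: g_def mat0)
    next
      assume *: "\<not> i < m" "j < m"
      then show ?thesis using clifford_generatorsD(5)[OF c in2(1) in1(2)] by (simp add: g_def add.commute)
    next
      assume *: "i < m" "j < m"
      then show ?thesis using clifford_generatorsD(3)[OF c in1(1) in2(1)] j(2) by (simp add: g_def mat0)
    next
      assume *: "i < m" "\<not> j < m"
      then show ?thesis using clifford_generatorsD(5)[OF c in1(1) in2(2)] by (simp add: g_def)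
    qed
    then show "anticomm (g i) (g j)" by (simp add: anticomm_def eq_neg_iff_add_eq_0)
  qed (rule card)
  show ?thesis by (rule subalgebra_eq_UNIV[OF A(1)]) (use A(2) in \<open>auto simp: g_def\<close>)
qed

lemma clifford_algebra_eq_UNIV:
  fixes Q P :: "nat \<Rightarrow> 'n::finite op"
  assumes "clifford_generators m Q P" "CARD('n) = 2 ^ m"
  shows "clifford_algebra m Q P = UNIV"
proof -
  have "A = UNIV" if "complex_subalgebra A" "Q ` {1..m} \<union> P ` {1..m} \<subseteq> A" for A
    using that by (intro clifford_subalgebra_eq_UNIV[OF assms]) auto
  then show ?thesis unfolding clifford_algebra_def hull_def by blast
qed

lemma central_scalar:
  fixes A :: "'n::finite op"
  assumes "\<And>M. A ** M = M ** A" shows "\<exists>c. A = c *\<^sub>C mat 1"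
proof -
  define E :: "'n \<Rightarrow> 'n \<Rightarrow> 'n op" where "E i j = (\<chi> a b. if a = i \<and> b = j then 1 else 0)" for i j
  have 1: "(A ** E i j) $ k $ l = (if l = j then A $ k $ i else 0)" for i j k l
    by (auto simp: matrix_matrix_mult_def E_def if_distrib[of "\<lambda>x. _ * x"] cong: if_cong)
  have 2: "(E i j ** A) $ k $ l = (if k = i then A $ j $ l else 0)" for i j k l
    by (auto simp: matrix_matrix_mult_def E_def if_distrib[of "\<lambda>x. x * _"] cong: if_cong)
  have *: "(if l = j then A $ k $ i else 0) = (if k = i then A $ j $ l else 0)" for i j k l
    using assms[of "E i j"] 1[of i j k l] 2[of i j k l] by simp
  have "A $ k $ i = 0" if "k \<noteq> i" for k i using *[of i i k i] that by simp
  moreover have "A $ i $ i = A $ j $ j" for i j using *[of j j i i] by simp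
  ultimately have "A = (A $ i $ i) *\<^sub>C mat 1" for i
    by (auto simp: vec_eq_iff cscale_def mat_def)
  then show ?thesis by blast
qed

section \<open>Canonical anticommutation relations\<close>

text \<open>The constant 2 instead of 1 comes from the factor \<open>1 / sqrt 2\<close> in
  \<open>fermi_Z\<close>; it makes \<open>adj (a j) ** a j\<close> twice a projection.\<close>

locale car =
  fixes m :: nat and a :: "nat \<Rightarrow> 'n::finite op"
  assumes car_same: "\<And>j k. j \<in> {1..m} \<Longrightarrow> k \<in> {1..m} \<Longrightarrow> a j ** a k + a k ** a j = 0"
    and car_adj: "\<And>j k. j \<in> {1..m} \<Longrightarrow> k \<in> {1..m} \<Longrightarrow>
        adj (a j) ** a k + a k ** adj (a j) = (if j = k then 2 *\<^sub>R mat 1 else 0)"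
begin

lemma car_adj_adj:
  assumes "j \<in> {1..m}" "k \<in> {1..m}" shows "adj (a j) ** adj (a k) + adj (a k) ** adj (a j) = 0"
proof -
  have "adj (a k ** a j + a j ** a k) = 0" using car_same[OF assms(2,1)] by simp
  then show ?thesis by (simp add: adj_add adj_mm)
qed

lemma car_square:
  assumes "j \<in> {1..m}" shows "a j ** a j = 0" "adj (a j) ** adj (a j) = 0"
proof -
  have "2 *\<^sub>R (a j ** a j) = 0" "2 *\<^sub>R (adj (a j) ** adj (a j)) = 0"
    using car_same[OF assms assms] car_adj_adj[OF assms assms] by (simp_all only: scaleR_2)
  then show "a j ** a j = 0" "adj (a j) ** adj (a j) = 0" by simp_all
qed

lemma car_number:
  assumes "j \<in> {1..m}" shows "adj (a j) ** a j = 2 *\<^sub>R mat 1 - a j ** adj (a j)"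
  using car_adj[OF assms assms] by (simp add: eq_diff_eq)

lemma car_anticomm:
  assumes "j \<in> {1..m}" "k \<in> {1..m}" "j \<noteq> k"
  shows "anticomm (a j) (a k)" "anticomm (adj (a j)) (a k)" "anticomm (a j) (adj (a k))"
    "anticomm (adj (a j)) (adj (a k))"
  using car_same[of j k] car_adj[of j k] car_adj[of k j] car_adj_adj[of j k] assms
  by (simp_all add: anticomm_def eq_neg_iff_add_eq_0 add.commute)

lemma car_nonzero:
  assumes "j \<in> {1..m}" shows "a j \<noteq> 0"
proof
  assume "a j = 0"
  with car_adj[OF assms assms] have "2 *\<^sub>R mat 1 = (0 :: 'n op)" by simp
  then have "(2 *\<^sub>R mat 1 :: 'n op) $ undefined $ undefined = 0" by simp
  then show False by (simp add: mat_def)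
qed

lemma centralizer_subalgebra: "complex_subalgebra {M. A ** M = M ** (A :: 'n op)}"
  unfolding complex_subalgebra_def
  by (auto simp: mm_distribs mm_cscale_left mm_cscale_right) (metis matrix_mul_assoc)

text \<open>Solving \<open>a = (Q + i P) / sqrt 2\<close> for \<open>Q\<close> and \<open>P\<close>
  gives self-adjoint Clifford generators. They generate all matrices, so an operator commuting with
  every \<open>a j\<close> and its adjoint is central.\<close>

lemma car_irreducible:
  assumes card: "CARD('n) = 2 ^ m"
    and A: "\<And>j. j \<in> {1..m} \<Longrightarrow> comm (a j) A = 0" "\<And>j. j \<in> {1..m} \<Longrightarrow> comm (adj (a j)) A = 0"
  shows "\<exists>c. A = c *\<^sub>C mat 1"
proof -
  define Q where "Q j = (1 / sqrt 2) *\<^sub>R (a j + adj (a j))" for j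
  define P where "P j = (1 / sqrt 2) *\<^sub>R (\<i> *\<^sub>C (adj (a j) - a j))" for j
  have half: "(1 / sqrt 2) *\<^sub>R ((1 / sqrt 2) *\<^sub>R x) = (1 / 2) *\<^sub>R x" for x :: "'n op" by simp
  have mat: "mat (if j = k then 2 else 0) = (if j = k then 2 *\<^sub>R mat 1 else (0 :: 'n op))" for j k :: nat
    by (simp add: mat_two mat_def vec_eq_iff scaleR_complex)
  have "clifford_generators m Q P"
    unfolding clifford_generators_def mat
  proof (intro conjI ballI)
    fix j assume j: "j \<in> {1..m}"
    show "selfadjoint (Q j)" "selfadjoint (P j)"
      by (simp_all add: selfadjoint_def Q_def P_def adj_add adj_diff adj_scaleR adj_cscale add.commute)
        (simp add: cscale_def vec_eq_iff algebra_simps)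
    fix k assume k: "k \<in> {1..m}"
    have s: "a j ** a k + a k ** a j = 0" "adj (a j) ** adj (a k) + adj (a k) ** adj (a j) = 0"
      by (rule car_same[OF j k], rule car_adj_adj[OF j k])
    have t: "adj (a j) ** a k + a k ** adj (a j) = (if j = k then 2 *\<^sub>R mat 1 else 0)"
      "adj (a k) ** a j + a j ** adj (a k) = (if j = k then 2 *\<^sub>R mat 1 else 0)"
      using car_adj[OF j k] car_adj[OF k j] by auto
    have "Q j ** Q k + Q k ** Q j = (1 / 2) *\<^sub>R ((a j ** a k + a k ** a j) + (adj (a j) ** adj (a k) + adj (a k) ** adj (a j))
       + ((adj (a j) ** a k + a k ** adj (a j)) + (adj (a k) ** a j + a j ** adj (a k))))"
      unfolding Q_def mm_scaleR_left mm_scaleR_right half scaleR_add_right[symmetric] by (simp add: mm_distribs algebra_simps)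
    also have "\<dots> = (if j = k then 2 *\<^sub>R mat 1 else 0)" unfolding s t by (simp add: scaleR_2[symmetric])
    finally show "Q j ** Q k + Q k ** Q j = (if j = k then 2 *\<^sub>R mat 1 else 0)" .
    have "P j ** P k + P k ** P j = (1 / 2) *\<^sub>R (- (a j ** a k + a k ** a j) - (adj (a j) ** adj (a k) + adj (a k) ** adj (a j))
       + ((adj (a j) ** a k + a k ** adj (a j)) + (adj (a k) ** a j + a j ** adj (a k))))"
      unfolding P_def mm_scaleR_left mm_scaleR_right half scaleR_add_right[symmetric] mm_cscale_left mm_cscale_right cscale_scaleR cscale_cscale
      by (simp add: cscale_of_real[of "- 1", simplified] mm_distribs algebra_simps)
    also have "\<dots> = (if j = k then 2 *\<^sub>R mat 1 else 0)" unfolding s t by (simp add: scaleR_2[symmetric])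
    finally show "P j ** P k + P k ** P j = (if j = k then 2 *\<^sub>R mat 1 else 0)" .
    have "Q j ** P k + P k ** Q j = (1 / 2) *\<^sub>R (\<i> *\<^sub>C (- (a j ** a k + a k ** a j) + (adj (a j) ** adj (a k) + adj (a k) ** adj (a j))
       - ((adj (a j) ** a k + a k ** adj (a j)) - (adj (a k) ** a j + a j ** adj (a k)))))"
      unfolding P_def Q_def
      by (simp add: mm_distribs mm_cscale_left mm_cscale_right cscale_scaleR cscale_add_right cscale_diff_right
          cscale_minus_right half algebra_simps)
    also have "\<dots> = 0" unfolding s t by simp
    finally show "Q j ** P k + P k ** Q j = 0" .
  qed
  then have "{M. A ** M = M ** A} = UNIV"
  proof (rule clifford_subalgebra_eq_UNIV[OF _ card centralizer_subalgebra])
    fix j assume "j \<in> {1..m}"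
    then have "A ** a j = a j ** A" "A ** adj (a j) = adj (a j) ** A" using A by (simp_all add: comm_def)
    then show "Q j \<in> {M. A ** M = M ** A} \<and> P j \<in> {M. A ** M = M ** A}"
      by (simp add: Q_def P_def mm_distribs mm_cscale_left mm_cscale_right)
  qed
  then show ?thesis by (intro central_scalar) blast
qed

end

lemma car_fermi_Z:
  assumes c: "clifford_generators m Q P" shows "car m (fermi_Z Q (P :: nat \<Rightarrow> 'n::finite op))"
proof
  fix j k assume j: "j \<in> {1..m}" and k: "k \<in> {1..m}"
  have half: "(1 / sqrt 2) *\<^sub>R ((1 / sqrt 2) *\<^sub>R x) = (1 / 2) *\<^sub>R x" for x :: "'n op" by simp
  have mat: "mat (if j = k then 2 else 0) = (if j = k then 2 *\<^sub>R mat 1 else (0 :: 'n op))"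
    by (simp add: mat_two mat_def vec_eq_iff scaleR_complex)
  note rel = clifford_generatorsD(3,4)[OF c j k, unfolded mat] clifford_generatorsD(5)[OF c j k] clifford_generatorsD(5)[OF c k j]
  note sa = clifford_generatorsD(1,2)[OF c j j]
  have "fermi_Z Q P j ** fermi_Z Q P k + fermi_Z Q P k ** fermi_Z Q P j =
     (1 / 2) *\<^sub>R ((Q j ** Q k + Q k ** Q j) - (P j ** P k + P k ** P j)
       + \<i> *\<^sub>C ((Q j ** P k + P k ** Q j) + (Q k ** P j + P j ** Q k)))"
    unfolding fermi_Z_def mm_scaleR_left mm_scaleR_right half scaleR_add_right[symmetric]
    by (simp add: mm_distribs mm_cscale_left mm_cscale_right cscale_cscale cscale_of_real[of "- 1", simplified] cscale_add_right algebra_simps)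
  also have "\<dots> = 0" unfolding rel by simp
  finally show "fermi_Z Q P j ** fermi_Z Q P k + fermi_Z Q P k ** fermi_Z Q P j = 0" .
  have z: "adj (fermi_Z Q P j) = (1 / sqrt 2) *\<^sub>R (Q j - \<i> *\<^sub>C P j)"
    by (simp add: fermi_Z_def adj_add adj_scaleR adj_cscale sa) (simp add: cscale_def vec_eq_iff)
  have "adj (fermi_Z Q P j) ** fermi_Z Q P k + fermi_Z Q P k ** adj (fermi_Z Q P j) =
     (1 / 2) *\<^sub>R ((Q j ** Q k + Q k ** Q j) + (P j ** P k + P k ** P j)
       + \<i> *\<^sub>C ((Q j ** P k + P k ** Q j) - (Q k ** P j + P j ** Q k)))"
    unfolding z unfolding fermi_Z_def mm_scaleR_left mm_scaleR_right half scaleR_add_right[symmetric]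
    by (simp add: mm_distribs mm_cscale_left mm_cscale_right cscale_cscale cscale_of_real[of "- 1", simplified] cscale_add_right cscale_diff_right algebra_simps)
  also have "\<dots> = (if j = k then 2 *\<^sub>R mat 1 else 0)" unfolding rel by (simp add: scaleR_2[symmetric])
  finally show "adj (fermi_Z Q P j) ** fermi_Z Q P k + fermi_Z Q P k ** adj (fermi_Z Q P j) =
      (if j = k then 2 *\<^sub>R mat 1 else 0)" .
qed

section \<open>The parity operator\<close>

text \<open>Distributing the power of \<open>\<i>\<close> makes each factor a self-adjoint unitary,
  and these factors commute with one another.\<close>

lemma fermi_W_monom: "fermi_W m Q P = monom_op (\<lambda>j. \<i> *\<^sub>C (Q j ** P j)) [1..<Suc m]"
proof -
  have "\<i> ^ length xs *\<^sub>C foldr (\<lambda>j M. Q j ** P j ** M) xs (mat 1) = monom_op (\<lambda>j. \<i> *\<^sub>C (Q j ** P j)) xs" for xs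
  proof (induction xs)
    case (Cons j xs)
    show ?case
      by (simp add: Cons[symmetric] mm_cscale_left mm_cscale_right cscale_cscale mult.commute)
  qed simp
  from this[of "[1..<Suc m]"] show ?thesis by (simp add: fermi_W_def del: upt_Suc)
qed

text \<open>The factor \<open>D j\<close> anticommutes with \<open>Q j\<close> and
  \<open>P j\<close>, while the other factors commute with them. Hence exactly one sign arises when
  \<open>fermi_W\<close> passes a generator.\<close>

lemma fermi_W_properties:
  fixes Q P :: "nat \<Rightarrow> 'n::finite op"
  assumes c: "clifford_generators m Q P"
  shows "adj (fermi_W m Q P) = fermi_W m Q P" "fermi_W m Q P ** fermi_W m Q P = mat 1"
    "j \<in> {1..m} \<Longrightarrow> anticomm (fermi_W m Q P) (fermi_Z Q P j)"
    "j \<in> {1..m} \<Longrightarrow> anticomm (fermi_W m Q P) (adj (fermi_Z Q P j))"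
proof -
  define D where "D j = \<i> *\<^sub>C (Q j ** P j)" for j
  have W: "fermi_W m Q P = monom_op D [1..<Suc m]" by (simp add: fermi_W_monom D_def[abs_def])
  have mat0: "mat 0 = (0 :: 'n op)" by (simp add: mat_def vec_eq_iff)
  have anti: "R ** S + S ** R = 0 \<Longrightarrow> anticomm R S" for R S :: "'n op"
    by (simp add: anticomm_def eq_neg_iff_add_eq_0)
  have QP: "anticomm (Q j) (P k)" "anticomm (P k) (Q j)" if "j \<in> {1..m}" "k \<in> {1..m}" for j k
    using clifford_generatorsD(5)[OF c that] by (auto intro!: anti simp: add.commute)
  have QQ: "anticomm (Q j) (Q k)" "anticomm (P j) (P k)" if "j \<in> {1..m}" "k \<in> {1..m}" "j \<noteq> k" for j k
    using clifford_generatorsD(3,4)[OF c that(1,2)] that(3) by (auto intro!: anti simp: mat0)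
  have sq: "Q j ** Q j = mat 1" "P j ** P j = mat 1" if "j \<in> {1..m}" for j
    by (rule clifford_generators_square[OF c that])+
  have sq': "Q j ** (Q j ** M) = M" "P j ** (P j ** M) = M" if "j \<in> {1..m}" for j and M :: "'n op"
    using sq[OF that] by (simp_all add: matrix_mul_assoc)
  have minus: "\<i> *\<^sub>C \<i> *\<^sub>C M = - M" for M :: "'n op" by (simp add: cscale_def vec_eq_iff)
  note ac = mm_cscale_left mm_cscale_right mm_minus_left mm_minus_right cscale_minus_right matrix_mul_assoc[symmetric]
  have D_sa: "adj (D j) = D j" and D_sq: "D j ** D j = mat 1" and
    D_self: "anticomm (D j) (Q j)" "anticomm (D j) (P j)" if j: "j \<in> {1..m}" for j
  proof -
    note r = anticommD[OF QP(2)[OF j j]] sq[OF j] sq'[OF j]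
    show "adj (D j) = D j"
      using clifford_generatorsD(1,2)[OF c j j]
      by (simp add: D_def adj_cscale adj_mm r) (simp add: cscale_def vec_eq_iff)
    show "D j ** D j = mat 1" by (simp add: D_def ac r minus)
    show "anticomm (D j) (Q j)" "anticomm (D j) (P j)" by (simp_all add: D_def anticomm_def ac r)
  qed
  have D_other: "D k ** Q j = Q j ** D k" "D k ** P j = P j ** D k"
    if j: "j \<in> {1..m}" "k \<in> {1..m}" "j \<noteq> k" for j k
  proof -
    note r = anticommD[OF QP(2)[OF j(1,2)]] anticommD[OF QQ(1)[OF j(2,1) j(3)[symmetric]]]
      anticommD[OF QQ(2)[OF j(2,1) j(3)[symmetric]]] anticommD[OF QP(1)[OF j(2,1)]]
    show "D k ** Q j = Q j ** D k" "D k ** P j = P j ** D k" by (simp_all add: D_def ac r)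
  qed
  have D_D: "D k ** D j = D j ** D k" if "j \<in> {1..m}" "k \<in> {1..m}" for j k
  proof (cases "j = k")
    case False
    have "D k ** (Q j ** P j) = Q j ** P j ** D k"
      using D_other[OF that False] by (metis matrix_mul_assoc)
    then show ?thesis by (simp add: D_def[of j] mm_cscale_left mm_cscale_right)
  qed simp
  have comm_monom: "monom_op D xs ** D j = D j ** monom_op D xs" if "set xs \<subseteq> {1..m}" "j \<in> {1..m}" for xs j
    using that D_D by (intro monom_op_commute) auto
  have "adj (monom_op D xs) = monom_op D xs \<and> monom_op D xs ** monom_op D xs = mat 1" if "set xs \<subseteq> {1..m}" for xs
    using that
  proof (induction xs)
    case (Cons j xs)
    let ?w = "monom_op D xs"
    have j: "j \<in> {1..m}" and IH: "adj ?w = ?w" "?w ** ?w = mat 1" using Cons by auto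
    have cm: "?w ** D j = D j ** ?w" using Cons.prems by (intro comm_monom) auto
    have "D j ** ?w ** (D j ** ?w) = D j ** (?w ** D j) ** ?w" by (simp add: matrix_mul_assoc)
    also have "\<dots> = D j ** D j ** (?w ** ?w)" unfolding cm by (simp add: matrix_mul_assoc)
    finally show ?case using IH cm D_sa[OF j] D_sq[OF j] by (simp add: adj_mm)
  qed simp
  moreover have "set [1..<Suc m] \<subseteq> {1..m}" by auto
  ultimately show "adj (fermi_W m Q P) = fermi_W m Q P" "fermi_W m Q P ** fermi_W m Q P = mat 1"
    unfolding W by blast+
  assume j: "j \<in> {1..m}"
  have anti_monom: "anticomm (monom_op D xs) R" if "distinct xs" "set xs \<subseteq> {1..m}" "j \<in> set xs"
    "anticomm (D j) R" "\<And>k. k \<in> {1..m} \<Longrightarrow> k \<noteq> j \<Longrightarrow> D k ** R = R ** D k" for xs R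
    using that(1-3)
  proof (induction xs)
    case (Cons k xs)
    let ?w = "monom_op D xs"
    show ?case
    proof (cases "k = j")
      case True
      then have w: "?w ** R = R ** ?w" using Cons.prems by (intro monom_op_commute that(5)) auto
      have "D j ** ?w ** R = D j ** R ** ?w" by (simp add: w flip: matrix_mul_assoc)
      then show ?thesis using that(4) True by (simp add: anticomm_def mm_minus_left matrix_mul_assoc)
    next
      case False
      then have "?w ** R = - (R ** ?w)" using Cons by (auto simp: anticomm_def)
      then have "D k ** ?w ** R = - (D k ** R ** ?w)" by (simp add: mm_minus_right flip: matrix_mul_assoc)
      then show ?thesis using that(5)[of k] Cons.prems False by (simp add: anticomm_def matrix_mul_assoc)
    qed
  qed simp
  have "anticomm (fermi_W m Q P) (Q j)" "anticomm (fermi_W m Q P) (P j)"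
    unfolding W using j D_self[OF j] D_other[OF j] by (auto intro!: anti_monom)
  then have *: "fermi_W m Q P ** Q j = - (Q j ** fermi_W m Q P)" "fermi_W m Q P ** P j = - (P j ** fermi_W m Q P)"
    by (simp_all add: anticomm_def)
  show "anticomm (fermi_W m Q P) (fermi_Z Q P j)"
    by (simp add: anticomm_def fermi_Z_def mm_distribs mm_cscale_left mm_cscale_right * cscale_minus_right algebra_simps)
  show "anticomm (fermi_W m Q P) (adj (fermi_Z Q P j))"
    using clifford_generatorsD(1,2)[OF c j j]
    by (simp add: anticomm_def fermi_Z_def adj_simps adj_cscale mm_distribs mm_cscale_left mm_cscale_right * cscale_minus_right algebra_simps)
qed

text \<open>The two copies of \<open>fermi_W\<close> cancel after moving past 1, 0 and 2 factors,
  respectively. The one remaining sign does no harm, so the \<open>V j\<close> inherit the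
  anticommutation relations of the \<open>Z j\<close>.\<close>

lemma fermi_V_sandwich:
  assumes c: "clifford_generators m Q P" and j: "j \<in> {1..m}" and k: "k \<in> {1..m}"
  shows "fermi_V m Q P j ** fermi_V m Q P k = - (fermi_Z Q P j ** fermi_Z Q P k)"
    "adj (fermi_V m Q P j) ** fermi_V m Q P k = adj (fermi_Z Q P j) ** fermi_Z Q P k"
    "fermi_V m Q P k ** adj (fermi_V m Q P j) = fermi_Z Q P k ** adj (fermi_Z Q P j)"
proof -
  let ?W = "fermi_W m Q P"
  note w = fermi_W_properties[OF c]
  have WW: "?W ** (?W ** M) = M" for M by (simp add: w(2) matrix_mul_assoc)
  note r = anticommD[OF w(3)[OF j]] anticommD[OF w(3)[OF k]] anticommD[OF w(4)[OF j]]
  show "fermi_V m Q P j ** fermi_V m Q P k = - (fermi_Z Q P j ** fermi_Z Q P k)"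
    "adj (fermi_V m Q P j) ** fermi_V m Q P k = adj (fermi_Z Q P j) ** fermi_Z Q P k"
    "fermi_V m Q P k ** adj (fermi_V m Q P j) = fermi_Z Q P k ** adj (fermi_Z Q P j)"
    by (simp_all only: fermi_V_def adj_mm w(1), simp_all add: r mm_minus_left mm_minus_right WW w(2) matrix_mul_assoc[symmetric])
qed

lemma car_fermi_V:
  assumes c: "clifford_generators m Q P" shows "car m (fermi_V m Q (P :: nat \<Rightarrow> 'n::finite op))"
proof
  interpret Z: car m "fermi_Z Q P" by (rule car_fermi_Z[OF c])
  fix j k assume j: "j \<in> {1..m}" and k: "k \<in> {1..m}"
  show "fermi_V m Q P j ** fermi_V m Q P k + fermi_V m Q P k ** fermi_V m Q P j = 0"
    unfolding fermi_V_sandwich(1)[OF c j k] fermi_V_sandwich(1)[OF c k j] minus_add_distrib[symmetric]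
      Z.car_same[OF j k] by simp
  show "adj (fermi_V m Q P j) ** fermi_V m Q P k + fermi_V m Q P k ** adj (fermi_V m Q P j) =
      (if j = k then 2 *\<^sub>R mat 1 else 0)"
    using Z.car_adj[OF j k] by (simp only: fermi_V_sandwich[OF c j k])
qed

section \<open>The Fermi Ornstein-Uhlenbeck semigroup\<close>

text \<open>A number operator is quadratic, so \<open>V k\<close> commutes with those of all other
  modes. In its own mode \<open>V k\<close> times the number operator is \<open>V k\<close>, and the
  product in the other order vanishes.\<close>

lemma fermi_h_commutator:
  fixes Q P :: "nat \<Rightarrow> 'n::finite op"
  assumes c: "clifford_generators m Q P" and k: "k \<in> {1..m}"
  shows "fermi_V m Q P k ** fermi_h m e Q P - fermi_h m e Q P ** fermi_V m Q P k = e k *\<^sub>R fermi_V m Q P k"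
proof -
  interpret V: car m "fermi_V m Q P" by (rule car_fermi_V[OF c])
  let ?V = "fermi_V m Q P"
  have N: "fermi_N Q P j = (1 / 2) *\<^sub>R (adj (?V j) ** ?V j)" if "j \<in> {1..m}" for j
    by (simp add: fermi_N_def fermi_V_sandwich[OF c that that])
  have *: "?V k ** (e j *\<^sub>R fermi_N Q P j) - (e j *\<^sub>R fermi_N Q P j) ** ?V k = (if j = k then e k *\<^sub>R ?V k else 0)"
    if j: "j \<in> {1..m}" for j
  proof (cases "j = k")
    case True
    have VV: "?V k ** (?V k ** M) = 0" for M using V.car_square(1)[OF k] by (simp add: matrix_mul_assoc)
    show ?thesis
      by (simp add: True N[OF k] V.car_number[OF k] mm_distribs matrix_mul_assoc[symmetric] VV V.car_square(1)[OF k]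
          scaleR_diff_right)
  next
    case False
    note r = anticommD[OF V.car_anticomm(1)[OF j k False]] anticommD[OF V.car_anticomm(2)[OF j k False]]
    show ?thesis
      using False by (simp add: N[OF j] mm_distribs matrix_mul_assoc[symmetric] r)
  qed
  have "?V k ** fermi_h m e Q P - fermi_h m e Q P ** ?V k = (\<Sum>j\<in>{1..m}. if j = k then e k *\<^sub>R ?V k else 0)"
    unfolding fermi_h_def mm_sum_left mm_sum_right sum_subtractf[symmetric] by (intro sum.cong refl *)
  then show ?thesis using k by simp
qed

lemma adj_fermi_h: "adj (fermi_h m e Q P) = fermi_h m e Q P"
  by (simp add: fermi_h_def fermi_N_def adj_sum adj_scaleR adj_mm)

text \<open>In the logarithm the normalisation becomes an additive scalar, which drops out of every
  commutator.\<close>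

lemma gibbs_state:
  fixes h :: "'n::finite op" and \<beta> :: real
  assumes h: "adj h = h"
  defines "G \<equiv> mfun exp ((- \<beta>) *\<^sub>R h)"
  defines "\<sigma> \<equiv> inverse (trace G) *\<^sub>C G"
  shows "posdef \<sigma>" "trace \<sigma> = 1" "\<exists>c. mfun ln \<sigma> = (- \<beta>) *\<^sub>R h - c *\<^sub>R mat 1"
proof -
  obtain U d where U: "unitary_op U" "h = U ** dg d ** adj U" using spectral_theorem[OF h] .
  have dgs: "U ** dg (\<lambda>i. r * f i) ** adj U = r *\<^sub>R (U ** dg f ** adj U)" for r f
  proof -
    have "dg (\<lambda>i. r * f i) = (r *\<^sub>R dg f :: 'n op)" by (simp add: dg_def vec_eq_iff scaleR_complex)
    then show ?thesis by (simp add: mm_distribs)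
  qed
  have G: "G = U ** dg (\<lambda>i. exp (- \<beta> * d i)) ** adj U"
    unfolding G_def by (rule mfun_spectral[OF U(1)]) (simp only: dgs U(2))
  define z where "z = (\<Sum>i\<in>UNIV. exp (- \<beta> * d i))"
  have z: "0 < z" unfolding z_def by (rule sum_pos) auto
  have "trace G = trace (dg (\<lambda>i. exp (- \<beta> * d i)) :: 'n op)"
    using U(1) trace_mul_sym[of "U ** dg (\<lambda>i. exp (- \<beta> * d i))" "adj U"]
    by (simp add: G matrix_mul_assoc unitary_op_def)
  also have "\<dots> = complex_of_real z" by (simp add: trace_def dg_def z_def)
  finally have tG: "trace G = complex_of_real z" .
  have s: "\<sigma> = inverse z *\<^sub>R G" by (simp add: \<sigma>_def tG flip: of_real_inverse cscale_of_real)
  have \<sigma>: "\<sigma> = U ** dg (\<lambda>i. inverse z * exp (- \<beta> * d i)) ** adj U" by (simp only: s dgs G)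
  show "posdef \<sigma>" unfolding \<sigma> conj_dg_posdef[OF U(1)] using z by simp
  show "trace \<sigma> = 1" using z by (simp add: s trace_scaleR tG)
  have "mfun ln \<sigma> = U ** dg (\<lambda>i. ln (inverse z * exp (- \<beta> * d i))) ** adj U"
    by (rule mfun_spectral[OF U(1) \<sigma>])
  also have "dg (\<lambda>i. ln (inverse z * exp (- \<beta> * d i))) = (- \<beta>) *\<^sub>R dg d - ln z *\<^sub>R (mat 1 :: 'n op)"
    using z by (simp add: ln_mult ln_inverse dg_def mat_def vec_eq_iff scaleR_complex)
  also have "U ** ((- \<beta>) *\<^sub>R dg d - ln z *\<^sub>R mat 1) ** adj U = (- \<beta>) *\<^sub>R h - ln z *\<^sub>R mat 1"
    using U(1) by (simp add: mm_distribs U(2) unitary_op_def)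
  finally show "\<exists>c. mfun ln \<sigma> = (- \<beta>) *\<^sub>R h - c *\<^sub>R mat 1" by blast
qed

text \<open>In an eigenbasis of \<open>\<sigma>\<close> the matrix of \<open>X\<close> lives on the
  entries with \<open>ln (p j) - ln (p i) = w\<close>, which turns the additive relation into a
  multiplicative one. Uniqueness of \<open>w\<close> uses \<open>X \<noteq> 0\<close>.\<close>

lemma bohr_freq_eq:
  fixes X :: "'n::finite op"
  assumes \<sigma>: "posdef \<sigma>" and X: "X ** mfun ln \<sigma> - mfun ln \<sigma> ** X = w *\<^sub>R X" "X \<noteq> 0"
  shows "bohr_freq \<sigma> X = w"
proof -
  obtain U p where U: "unitary_op U" "\<sigma> = U ** dg p ** adj U" "\<And>i. 0 < p i"
    using posdef_spectral[OF \<sigma>] by blast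
  let ?M = "adj U ** X ** U"
  have "adj U ** (X ** mfun ln \<sigma> - mfun ln \<sigma> ** X) ** U = ?M ** dg (\<lambda>i. ln (p i)) - dg (\<lambda>i. ln (p i)) ** ?M"
    using U(1) by (simp add: mfun_spectral[OF U(1,2)] mm_distribs unitary_op_cancel flip: matrix_mul_assoc)
      (simp add: unitary_op_def)
  moreover have "adj U ** (w *\<^sub>R X) ** U = w *\<^sub>R ?M" by (simp add: mm_distribs)
  ultimately have "?M ** dg (\<lambda>i. ln (p i)) - dg (\<lambda>i. ln (p i)) ** ?M = w *\<^sub>R ?M" using X(1) by simp
  then have "?M $ i $ j * (ln (p j) - ln (p i) - w) = 0" for i j
    by (simp add: vec_eq_iff mm_dg_left mm_dg_right scaleR_complex algebra_simps)
  then have M: "?M $ i $ j = 0 \<or> ln (p j) - ln (p i) = w" for i j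
    by (auto simp flip: of_real_diff simp: of_real_eq_0_iff[where 'a = complex] algebra_simps)
  have "complex_of_real (p i) * ?M $ i $ j = exp (- w) * ?M $ i $ j * complex_of_real (p j)" for i j
  proof (cases "?M $ i $ j = 0")
    case False
    then have "ln (p i) = - w + ln (p j)" using M[of i j] by simp
    then have "p i = exp (- w) * p j" using U(3) by (metis exp_add exp_ln)
    then show ?thesis by (simp add: exp_of_real)
  qed simp
  then have "dg p ** ?M = exp (- w) *\<^sub>R (?M ** dg p)"
    by (simp add: vec_eq_iff mm_dg_left mm_dg_right scaleR_complex mult.assoc)
  then have "U ** (dg p ** ?M) ** adj U = exp (- w) *\<^sub>R (U ** (?M ** dg p) ** adj U)" by (simp add: mm_distribs)
  moreover have "U ** (dg p ** ?M) ** adj U = \<sigma> ** X" "U ** (?M ** dg p) ** adj U = X ** \<sigma>"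
    using U(1) by (simp_all add: U(2) unitary_op_cancel flip: matrix_mul_assoc) (simp_all add: unitary_op_def)
  ultimately have sX: "\<sigma> ** X = exp (- w) *\<^sub>R (X ** \<sigma>)" by simp
  have "\<sigma> ** (U ** dg (\<lambda>i. inverse (p i)) ** adj U) = mat 1"
  proof -
    have "dg p ** dg (\<lambda>i. inverse (p i)) = (mat 1 :: 'n op)"
      using U(3)[THEN less_imp_neq] by (simp add: vec_eq_iff mm_dg_left) (auto simp: dg_def mat_def)
    then have "U ** (dg p ** dg (\<lambda>i. inverse (p i))) ** adj U = mat 1" using U(1) by (simp add: unitary_op_def)
    then show ?thesis using U(1) by (simp add: U(2) unitary_op_cancel flip: matrix_mul_assoc)
  qed
  then have "\<exists>A'. \<sigma> ** A' = mat 1 \<and> A' ** \<sigma> = mat 1" using matrix_left_right_inverse by blast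
  from someI_ex[OF this] have inv: "\<sigma> ** matrix_inv \<sigma> = mat 1" by (simp add: matrix_inv_def)
  have mod: "modular \<sigma> X = exp (- w) *\<^sub>R X"
    by (simp add: modular_def sX mm_scaleR_left inv flip: matrix_mul_assoc)
  show ?thesis
    unfolding bohr_freq_def mod using X(2) by (intro the_equality) (auto simp: scaleR_cancel_right)
qed

text \<open>\<open>X\<close> passes the product \<open>V' ** V\<close> with two cancelling signs,
  but enters the sandwiched term past a single factor; this reverses the sign of that term.\<close>

lemma commutator_jump:
  fixes V V' X A :: "'n::finite op"
  assumes "anticomm X V" "anticomm X V'"
  shows "comm X (2 *\<^sub>R (V' ** A ** V) - V' ** V ** A - A ** V' ** V) =
    - (2 *\<^sub>R (V' ** comm X A ** V)) - V' ** V ** comm X A - comm X A ** V' ** V"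
proof -
  note r = anticommD[OF assms(1)] anticommD[OF assms(2)]
  show ?thesis
    by (simp add: comm_def mm_distribs matrix_mul_assoc[symmetric] r scaleR_diff_right algebra_simps)
qed

text \<open>Here \<open>V\<close> anticommutes with \<open>V'\<close> only up to the scalar 2, and
  the defect is the damping \<open>2 * (p + q)\<close>; the prefactor 1/4 of the generator turns it
  into the cosh. The hypotheses are symmetric in \<open>V\<close> and \<open>V'\<close>, so the
  lemma also serves for the adjoint.\<close>

lemma commutator_jump_self:
  fixes V V' A :: "'n::finite op"
  assumes V: "V ** V = 0" "V' ** V' = 0" "V' ** V = 2 *\<^sub>R mat 1 - V ** V'"
  shows "comm V (p *\<^sub>R (2 *\<^sub>R (V' ** A ** V) - V' ** V ** A - A ** V' ** V)
      + q *\<^sub>R (2 *\<^sub>R (V ** A ** V') - V ** V' ** A - A ** V ** V')) =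
    p *\<^sub>R (- (2 *\<^sub>R (V' ** comm V A ** V)) - V' ** V ** comm V A - comm V A ** V' ** V)
      + q *\<^sub>R (- (2 *\<^sub>R (V ** comm V A ** V')) - V ** V' ** comm V A - comm V A ** V ** V')
      - (2 * (p + q)) *\<^sub>R comm V A"
proof -
  have VM: "V ** (V ** M) = 0" "V' ** (V' ** M) = 0" "V' ** (V ** M) = 2 *\<^sub>R M - V ** (V' ** M)" for M :: "'n op"
    using V by (simp_all add: matrix_mul_assoc mm_distribs)
  show ?thesis
    by (simp add: comm_def mm_distribs matrix_mul_assoc[symmetric] V VM scaleR_diff_right scaleR_add_right
        scaleR_add_left distrib_left) (simp add: algebra_simps flip: scaleR_add_left)
qed

lemma fermi_V_bohr:
  fixes Q P :: "nat \<Rightarrow> 'n::finite op" and \<beta> :: real and e :: "nat \<Rightarrow> real"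
  assumes c: "clifford_generators m Q P" and k: "k \<in> fermi_index m"
  defines "\<sigma> \<equiv> fermi_sigma m \<beta> e Q P"
  shows "posdef \<sigma>" "trace \<sigma> = 1"
    "fermi_jump m Q P k ** mfun ln \<sigma> - mfun ln \<sigma> ** fermi_jump m Q P k =
      bohr_freq \<sigma> (fermi_jump m Q P k) *\<^sub>R fermi_jump m Q P k"
    "bohr_freq \<sigma> (fermi_jump m Q P k) = (if snd k then \<beta> * e (fst k) else - \<beta> * e (fst k))"
proof -
  interpret V: car m "fermi_V m Q P" by (rule car_fermi_V[OF c])
  let ?h = "fermi_h m e Q P" and ?X = "fermi_jump m Q P k" and ?V = "fermi_V m Q P (fst k)"
  have j: "fst k \<in> {1..m}" using k by (auto simp: fermi_index_def)
  note g = gibbs_state[OF adj_fermi_h, of \<beta> m e Q P, folded fermi_sigma_def[unfolded Let_def]]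
  show pd: "posdef \<sigma>" and "trace \<sigma> = 1" unfolding \<sigma>_def by (rule g)+
  obtain c' where ln: "mfun ln \<sigma> = (- \<beta>) *\<^sub>R ?h - c' *\<^sub>R mat 1" unfolding \<sigma>_def using g(3) by blast
  have hV: "?V ** ?h - ?h ** ?V = e (fst k) *\<^sub>R ?V" by (rule fermi_h_commutator[OF c j])
  have hV': "adj ?V ** ?h - ?h ** adj ?V = - (e (fst k) *\<^sub>R adj ?V)"
    using arg_cong[OF hV, of adj] by (simp add: adj_simps adj_fermi_h algebra_simps)
  have X: "?X = (1 / 2) *\<^sub>R (if snd k then adj ?V else ?V)" by (simp add: fermi_jump_def case_prod_beta)
  have ln': "M ** mfun ln \<sigma> - mfun ln \<sigma> ** M = (- \<beta>) *\<^sub>R (M ** ?h - ?h ** M)" for M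
    by (simp add: ln mm_distribs scaleR_diff_right)
  have eq: "?X ** mfun ln \<sigma> - mfun ln \<sigma> ** ?X = (if snd k then \<beta> * e (fst k) else - \<beta> * e (fst k)) *\<^sub>R ?X"
  proof -
    have "?X ** ?h - ?h ** ?X = (1 / 2) *\<^sub>R (if snd k then adj ?V ** ?h - ?h ** adj ?V else ?V ** ?h - ?h ** ?V)"
      by (simp add: X mm_distribs scaleR_diff_right)
    also have "\<dots> = (1 / 2) *\<^sub>R (if snd k then - (e (fst k) *\<^sub>R adj ?V) else e (fst k) *\<^sub>R ?V)"
      unfolding hV hV' ..
    finally show ?thesis unfolding ln' by (simp add: X)
  qed
  have "adj ?V \<noteq> 0" using V.car_nonzero[OF j] by (metis adj_adj adj_zero)
  then have "?X \<noteq> 0" using V.car_nonzero[OF j] by (simp add: X)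
  from bohr_freq_eq[OF pd eq this]
  show w: "bohr_freq \<sigma> ?X = (if snd k then \<beta> * e (fst k) else - \<beta> * e (fst k))" .
  show "?X ** mfun ln \<sigma> - mfun ln \<sigma> ** ?X = bohr_freq \<sigma> ?X *\<^sub>R ?X" unfolding w by (rule eq)
qed

section \<open>The Fermi data as an intertwined semigroup, and the conclusion\<close>

lemma fermi_sum: "(\<Sum>k\<in>fermi_index m. f k) = (\<Sum>j\<in>{1..m}. f (j, False) + f (j, True))"
  by (simp add: fermi_index_def sum.cartesian_product[symmetric, of "\<lambda>j b. f (j, b)", simplified] UNIV_bool)

theorem fermi_qms:
  fixes Q P :: "nat \<Rightarrow> 'n::finite op" and \<beta> :: real and e :: "nat \<Rightarrow> real"
  assumes m: "m \<ge> 1" and card: "CARD('n) = 2 ^ m" and c: "clifford_generators m Q P"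
  defines "\<sigma> \<equiv> fermi_sigma m \<beta> e Q P"
  defines "\<omega> \<equiv> \<lambda>k. bohr_freq \<sigma> (fermi_jump m Q P k)"
  shows "intertwined_qms (fermi_index m) (fermi_jump m Q P) \<omega> (\<lambda>(j, b). (j, \<not> b)) \<sigma>
      (\<lambda>k. cosh (\<beta> * e (fst k) / 2)) (Min ((\<lambda>j. cosh (\<beta> * e j / 2)) ` {1..m}))"
    and "qms.gen (fermi_index m) (fermi_jump m Q P) \<omega> = fermi_generator m \<beta> e Q P"
proof -
  let ?J = "fermi_index m" and ?X = "fermi_jump m Q P" and ?V = "fermi_V m Q P"
  let ?p = "\<lambda>j. exp (\<beta> * e j / 2)" and ?q = "\<lambda>j. exp (- \<beta> * e j / 2)"
  interpret V: car m ?V by (rule car_fermi_V[OF c])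
  have 1: "(1, False) \<in> ?J" using m by (simp add: fermi_index_def)
  have w: "\<omega> (j, b) = (if b then \<beta> * e j else - \<beta> * e j)" if "j \<in> {1..m}" for j b
    unfolding \<omega>_def \<sigma>_def using fermi_V_bohr(4)[OF c, where k = "(j, b)" and \<beta> = \<beta> and e = e] that by (simp add: fermi_index_def)
  have X: "?X (j, b) = (1 / 2) *\<^sub>R (if b then adj (?V j) else ?V j)" for j b by (simp add: fermi_jump_def)
  interpret qms ?J ?X \<omega> "\<lambda>(j, b). (j, \<not> b)" \<sigma>
  proof
    show "finite ?J" by (simp add: fermi_index_def)
    show "posdef \<sigma>" "trace \<sigma> = 1" unfolding \<sigma>_def by (rule fermi_V_bohr[OF c 1])+
    fix k assume k: "k \<in> ?J"
    then obtain j b where jb: "k = (j, b)" "j \<in> {1..m}" by (auto simp: fermi_index_def)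
    show "(case k of (j, b) \<Rightarrow> (j, \<not> b)) \<in> ?J" using jb by (simp add: fermi_index_def)
    show "(case case k of (j, b) \<Rightarrow> (j, \<not> b) of (j, b) \<Rightarrow> (j, \<not> b)) = k" by (simp add: jb)
    show "?X (case k of (j, b) \<Rightarrow> (j, \<not> b)) = adj (?X k)" by (simp add: jb X adj_scaleR)
    show "\<omega> (case k of (j, b) \<Rightarrow> (j, \<not> b)) = - \<omega> k" using w[OF jb(2)] by (simp add: jb)
    show "?X k ** mfun ln \<sigma> - mfun ln \<sigma> ** ?X k = \<omega> k *\<^sub>R ?X k"
      unfolding \<omega>_def \<sigma>_def by (rule fermi_V_bohr(3)[OF c k])
  next
    fix A assume A: "\<And>k. k \<in> ?J \<Longrightarrow> comm (?X k) A = 0"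
    show "\<exists>c. A = c *\<^sub>C mat 1"
    proof (rule V.car_irreducible[OF card])
      fix j assume j: "j \<in> {1..m}"
      have "comm (?X (j, b)) A = 0" for b using A j by (simp add: fermi_index_def)
      from this[of False] this[of True] show "comm (?V j) A = 0" "comm (adj (?V j)) A = 0"
        by (simp_all add: X comm_def mm_distribs flip: scaleR_diff_right)
    qed
  qed
  have weight: "exp (- \<omega> (j, False) / 2) = ?p j" "exp (- \<omega> (j, True) / 2) = ?q j" if "j \<in> {1..m}" for j
    using w[OF that] by simp_all
  have "gen A = fermi_generator m \<beta> e Q P A" for A
    unfolding gen_def fermi_sum fermi_generator_def scaleR_sum_right Let_def
    by (intro sum.cong refl, simp only: weight)
      (simp add: X comm_def mm_distribs adj_scaleR scaleR_add_right scaleR_diff_right)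
  then show "gen = fermi_generator m \<beta> e Q P" by blast
  define Lp where "Lp j A = 2 *\<^sub>R (adj (?V j) ** A ** ?V j) - adj (?V j) ** ?V j ** A - A ** adj (?V j) ** ?V j" for j A
  define Lq where "Lq j A = 2 *\<^sub>R (?V j ** A ** adj (?V j)) - ?V j ** adj (?V j) ** A - A ** ?V j ** adj (?V j)" for j A
  define Tp where "Tp j A = - (2 *\<^sub>R (adj (?V j) ** A ** ?V j)) - adj (?V j) ** ?V j ** A - A ** adj (?V j) ** ?V j" for j A
  define Tq where "Tq j A = - (2 *\<^sub>R (?V j ** A ** adj (?V j))) - ?V j ** adj (?V j) ** A - A ** ?V j ** adj (?V j)" for j A
  have gen: "gen A = (\<Sum>j\<in>{1..m}. (1 / 4) *\<^sub>R (?p j *\<^sub>R Lp j A + ?q j *\<^sub>R Lq j A))" for A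
    unfolding gen_eq fermi_sum
    by (intro sum.cong refl, simp only: weight)
      (simp add: X Lp_def Lq_def mm_distribs adj_scaleR scaleR_add_right scaleR_diff_right)
  have tgen: "tgen A = (\<Sum>j\<in>{1..m}. (1 / 4) *\<^sub>R (?p j *\<^sub>R Tp j A + ?q j *\<^sub>R Tq j A))" for A
    unfolding tgen_def fermi_sum
    by (intro sum.cong refl, simp only: weight)
      (simp add: X Tp_def Tq_def mm_distribs adj_scaleR scaleR_add_right scaleR_diff_right)
  have key: "comm R (gen A) = sgen (cosh (\<beta> * e k / 2)) (comm R A)" if k: "k \<in> {1..m}" and R: "R = ?V k \<or> R = adj (?V k)" for R k A
  proof -
    have "comm R ((1 / 4) *\<^sub>R (?p j *\<^sub>R Lp j A + ?q j *\<^sub>R Lq j A)) =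
      (1 / 4) *\<^sub>R (?p j *\<^sub>R Tp j (comm R A) + ?q j *\<^sub>R Tq j (comm R A)) -
      (if j = k then cosh (\<beta> * e k / 2) *\<^sub>R comm R A else 0)" if j: "j \<in> {1..m}" for j
    proof (cases "j = k")
      case False
      have a: "anticomm R (?V j)" "anticomm R (adj (?V j))"
        using R V.car_anticomm[OF k j not_sym[OF False]] by auto
      show ?thesis
        using False commutator_jump[OF a] commutator_jump[OF a(2,1)]
        by (simp add: linear_add[OF linear_comm] linear_cmul[OF linear_comm] Lp_def Lq_def Tp_def Tq_def)
    next
      case True
      have n: "adj (?V k) ** ?V k = 2 *\<^sub>R mat 1 - ?V k ** adj (?V k)" by (rule V.car_number[OF k])
      then have n': "?V k ** adj (?V k) = 2 *\<^sub>R mat 1 - adj (?V k) ** ?V k" by simp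
      note sq = V.car_square[OF k]
      have "comm R (?p k *\<^sub>R Lp k A + ?q k *\<^sub>R Lq k A) =
          ?p k *\<^sub>R Tp k (comm R A) + ?q k *\<^sub>R Tq k (comm R A) - (2 * (?p k + ?q k)) *\<^sub>R comm R A"
        using R
      proof
        assume R: "R = ?V k"
        show ?thesis
          unfolding R Lp_def Lq_def Tp_def Tq_def by (rule commutator_jump_self[OF sq n])
      next
        assume R: "R = adj (?V k)"
        \<comment> \<open>Exchanging \<open>V\<close> with its adjoint also exchanges the weights
          \<open>?p\<close> and \<open>?q\<close>; the damping is symmetric in them.\<close>
        show ?thesis
          using commutator_jump_self[OF sq(2,1) n', of "?q k" A "?p k"]
          unfolding R Lp_def Lq_def Tp_def Tq_def by (simp add: add.commute)
      qed
      moreover have "cosh (\<beta> * e k / 2) = (1 / 4) * (2 * (?p k + ?q k))" by (simp add: cosh_def)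
      ultimately show ?thesis
        using True by (simp only: linear_cmul[OF linear_comm] if_True refl scaleR_diff_right scaleR_scaleR)
    qed
    then have "comm R (gen A) = (\<Sum>j\<in>{1..m}. (1 / 4) *\<^sub>R (?p j *\<^sub>R Tp j (comm R A) + ?q j *\<^sub>R Tq j (comm R A)) -
      (if j = k then cosh (\<beta> * e k / 2) *\<^sub>R comm R A else 0))"
      unfolding gen linear_sum[OF linear_comm] by (intro sum.cong refl)
    also have "\<dots> = sgen (cosh (\<beta> * e k / 2)) (comm R A)"
      unfolding sum_subtractf tgen sgen_def using k by simp
    finally show ?thesis .
  qed
  have fin: "finite ((\<lambda>j. cosh (\<beta> * e j / 2)) ` {1..m})" "(\<lambda>j. cosh (\<beta> * e j / 2)) ` {1..m} \<noteq> {}"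
    using m by auto
  show "intertwined_qms ?J ?X \<omega> (\<lambda>(j, b). (j, \<not> b)) \<sigma>
      (\<lambda>k. cosh (\<beta> * e (fst k) / 2)) (Min ((\<lambda>j. cosh (\<beta> * e j / 2)) ` {1..m}))"
  proof
    show "0 < Min ((\<lambda>j. cosh (\<beta> * e j / 2)) ` {1..m})" using fin by (subst Min_gr_iff) (auto simp: cosh_real_pos)
    fix k assume "k \<in> ?J"
    then obtain j b where jb: "k = (j, b)" "j \<in> {1..m}" by (auto simp: fermi_index_def)
    show "Min ((\<lambda>j. cosh (\<beta> * e j / 2)) ` {1..m}) \<le> cosh (\<beta> * e (fst k) / 2)"
      using jb fin(1) by (intro Min_le) auto
    fix A
    have half: "comm ((1 / 2) *\<^sub>R R) B = (1 / 2) *\<^sub>R comm R B" for R B :: "'n op"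
      by (simp add: comm_def mm_distribs scaleR_diff_right)
    have "sgen d ((1 / 2) *\<^sub>R B) = (1 / 2) *\<^sub>R sgen d B" for d B by (rule linear_cmul[OF linear_sgen])
    then show "comm (?X k) (gen A) = sgen (cosh (\<beta> * e (fst k) / 2)) (comm (?X k) A)"
      using key[OF jb(2), of "?V j" A] key[OF jb(2), of "adj (?V j)" A] by (cases b) (simp_all add: jb X half)
  qed
qed

theorem theorem8p6:
  fixes Q P :: "nat \<Rightarrow> complex^'n^'n"
    and m :: nat and e :: "nat \<Rightarrow> real" and \<beta> :: real
  assumes "m \<ge> 1"
    and "CARD('n) = 2 ^ m"
    and "clifford_generators m Q P"
    and "\<beta> \<ge> 0"
  defines "\<A> \<equiv> clifford_algebra m Q P"
    and "\<sigma> \<equiv> fermi_sigma m \<beta> e Q P"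
    and "\<P> \<equiv> exp_semigroup (fermi_generator m \<beta> e Q P)"
    and "lam \<equiv> Min ((\<lambda>j. cosh (\<beta> * e j / 2)) ` {1..m})"
  shows "(\<forall>\<rho>\<in>states \<A>. \<forall>t\<ge>0.
            rel_entropy (hs_adjoint \<A> (\<P> t) \<rho>) \<sigma> \<le> exp (- 2 * lam * t) * rel_entropy \<rho> \<sigma>)
       \<and> geodesically_convex (states \<A>) (fermi_metric m \<beta> e Q P) (\<lambda>\<rho>. rel_entropy \<rho> \<sigma>) lam"
proof -
  let ?\<omega> = "\<lambda>k. bohr_freq \<sigma> (fermi_jump m Q P k)"
  interpret intertwined_qms "fermi_index m" "fermi_jump m Q P" ?\<omega> "\<lambda>(j, b). (j, \<not> b)" \<sigma>
      "\<lambda>k. cosh (\<beta> * e (fst k) / 2)" lam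
    unfolding \<sigma>_def lam_def by (rule fermi_qms(1)[OF assms(1-3)])
  have \<A>: "\<A> = UNIV" unfolding \<A>_def by (rule clifford_algebra_eq_UNIV[OF assms(3,2)])
  have \<P>: "\<P> = PH" unfolding \<P>_def \<sigma>_def fermi_qms(2)[OF assms(1-3)] ..
  have met: "fermi_metric m \<beta> e Q P = met"
    unfolding fermi_metric_def \<A>[unfolded \<A>_def] \<sigma>_def ..
  show ?thesis
    unfolding \<A> \<P> met hs_adjoint_PH using rel_entropy_decay rel_entropy_geodesically_convex by blast
qed

end
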